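(* Let $\Omega\subset\mathbb{R}^n$ be a bounded domain with smooth boundary. Suppose that $\Omega$ is convex, with strictly positive principal curvatures along $\partial\Omega$. Let $f\in C^1(\mathbb{R})$, and let $a\in C^{1,1}_{loc}((0,+\infty))$ satisfy $a(t)>0$ and $a(t)+a'(t)t>0$ for every $t\in(0,+\infty)$. Let $u\in C^2(\overline{\Omega})$ be a stable weak solution (in the sense defined in the context) of the Neumann problem $$\operatorname{div}(a(|\nabla u|)\nabla u)+f(u)=0\ \text{ in }\Omega,\qquad a(|\nabla u|)\,\partial_\nu u=0\ \text{ on }\partial\Omega .$$ Then $u$ is constant in $\Omega$.
   Context: Notation: $\nu$ is the external unit normal to $\partial\Omega$; $\langle\cdot,\cdot\rangle$ is the Euclidean scalar product. Principal curvatures of $\partial\Omega$ are taken with the sign convention for which those of a ball are positive. For $\xi\in\mathbb{R}^n\setminus\{0\}$, $A(\xi)$ is the $n\times n$ matrix with entries $$A_{hk}(\xi)=\frac{a'(|\xi|)}{|\xi|}\xi_h\xi_k+a(|\xi|)\delta_{hk},\qquad 1\le h,k\le n.$$ When condition (A2) below holds, $A$ extends continuously to $\xi=0$ by $A(0)=a(0)\,\mathrm{Id}$, and this extension is used. Weak solution: $u$ is a weak solution of the Neumann problem if $u\in C^1(\overline\Omega)$, $$\int_\Omega a(|\nabla u|)\langle\nabla u,\nabla\varphi\rangle\,dx-\int_\Omega f(u)\varphi\,dx=0\quad\text{for all }\varphi\in C^1(\overline\Omega),$$ and at least one of the following holds: (A1) $\{x\in\overline\Omega:\nabla u(x)=0\}=\varnothing$;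 (A2) $a\in C^0([0,+\infty))$ and the map $t\mapsto t\,a(t)$ belongs to $C^1([0,+\infty))$. Stability: a weak solution $u$ is stable if $$\int_\Omega\langle A(\nabla u)\nabla\varphi,\nabla\varphi\rangle\,dx-\int_\Omega f'(u)\varphi^2\,dx\ge0\quad\text{for all }\varphi\in C^1(\overline\Omega).$$ *)

theory Defs
  imports "HOL-Analysis.Analysis"
begin

section \<open>Partial derivatives, the classes \<open>C\<^sup>k\<close>\<close>

definition partial :: "'n::finite \<Rightarrow> (real^'n \<Rightarrow> real) \<Rightarrow> real^'n \<Rightarrow> real" where
  "partial i \<phi> x = frechet_derivative \<phi> (at x) (axis i 1)"

definition gradient :: "(real^'n::finite \<Rightarrow> real) \<Rightarrow> real^'n \<Rightarrow> real^'n" where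
  "gradient \<phi> x = (\<chi> i. partial i \<phi> x)"

text \<open>The set argument of \<open>Ck_on\<close> and of \<open>Ck_closure\<close> is meant to be open.\<close>

primrec Ck_on :: "nat \<Rightarrow> (real^'n::finite) set \<Rightarrow> (real^'n \<Rightarrow> real) \<Rightarrow> bool" where
  "Ck_on 0 U \<phi> \<longleftrightarrow> continuous_on U \<phi>"
| "Ck_on (Suc k) U \<phi> \<longleftrightarrow>
     (\<forall>x\<in>U. \<phi> differentiable (at x)) \<and> (\<forall>i. Ck_on k U (partial i \<phi>))"

definition smooth_on :: "(real^'n::finite) set \<Rightarrow> (real^'n \<Rightarrow> real) \<Rightarrow> bool" where
  "smooth_on U \<phi> \<longleftrightarrow> (\<forall>k. Ck_on k U \<phi>)"

definition extends_to_closure :: "(real^'n::finite) set \<Rightarrow> (real^'n \<Rightarrow> real) \<Rightarrow> bool" where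
  "extends_to_closure \<Omega> \<phi> \<longleftrightarrow>
     (\<exists>\<psi>. continuous_on (closure \<Omega>) \<psi> \<and> (\<forall>x\<in>\<Omega>. \<psi> x = \<phi> x))"

text \<open>\<open>Ck_closure k \<Omega>\<close> is the space \<open>C\<^sup>k\<close> of the closure of \<open>\<Omega>\<close>: the functions on \<open>\<Omega>\<close> whose
  derivatives of order at most \<open>k\<close> exist in \<open>\<Omega>\<close> and extend continuously to the closure.
  The HOL function represents its restriction to \<open>\<Omega>\<close>; its values elsewhere are irrelevant,
  the boundary values being those of the continuous extension.\<close>

primrec Ck_closure :: "nat \<Rightarrow> (real^'n::finite) set \<Rightarrow> (real^'n \<Rightarrow> real) \<Rightarrow> bool" where
  "Ck_closure 0 \<Omega> \<phi> \<longleftrightarrow> extends_to_closure \<Omega> \<phi>"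
| "Ck_closure (Suc k) \<Omega> \<phi> \<longleftrightarrow>
     extends_to_closure \<Omega> \<phi> \<and> (\<forall>x\<in>\<Omega>. \<phi> differentiable (at x)) \<and>
     (\<forall>i. Ck_closure k \<Omega> (partial i \<phi>))"

text \<open>The continuous extension of the gradient from \<open>\<Omega>\<close> to its closure.\<close>

definition closure_gradient ::
    "(real^'n::finite) set \<Rightarrow> (real^'n \<Rightarrow> real) \<Rightarrow> real^'n \<Rightarrow> real^'n" where
  "closure_gradient \<Omega> \<phi> x = Lim (at x within \<Omega>) (gradient \<phi>)"

definition C11_loc_pos :: "(real \<Rightarrow> real) \<Rightarrow> bool" where
  "C11_loc_pos a \<longleftrightarrow>
     (\<forall>t>0. a differentiable (at t)) \<and>
     (\<forall>K. compact K \<and> K \<subseteq> {0<..} \<longrightarrow> (\<exists>L. L-lipschitz_on K (deriv a)))"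

text \<open>Of class \<open>C\<^sup>1\<close> on the closed half-line, with a one-sided derivative at 0.\<close>

definition C1_halfline :: "(real \<Rightarrow> real) \<Rightarrow> bool" where
  "C1_halfline g \<longleftrightarrow>
     (\<exists>g'. continuous_on {0..} g' \<and>
           (\<forall>t\<ge>0. (g has_real_derivative g' t) (at t within {0..})))"


section \<open>Smooth boundaries and principal curvatures\<close>

definition boundary_defining ::
    "(real^'n::finite) set \<Rightarrow> real^'n \<Rightarrow> (real^'n) set \<Rightarrow> (real^'n \<Rightarrow> real) \<Rightarrow> bool" where
  "boundary_defining \<Omega> p U \<rho> \<longleftrightarrow>
     open U \<and> p \<in> U \<and> smooth_on U \<rho> \<and> (\<forall>x\<in>U. gradient \<rho> x \<noteq> 0) \<and>
     \<Omega> \<inter> U = {x\<in>U. \<rho> x < 0} \<and> frontier \<Omega> \<inter> U = {x\<in>U. \<rho> x = 0}"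

definition smooth_boundary :: "(real^'n::finite) set \<Rightarrow> bool" where
  "smooth_boundary \<Omega> \<longleftrightarrow> (\<forall>p\<in>frontier \<Omega>. \<exists>U \<rho>. boundary_defining \<Omega> p U \<rho>)"

text \<open>Since \<open>\<rho> < 0\<close> inside \<open>\<Omega>\<close>, this is at boundary points the external unit normal, extended
  smoothly to a neighbourhood.\<close>

definition unit_normal :: "(real^'n::finite \<Rightarrow> real) \<Rightarrow> real^'n \<Rightarrow> real^'n" where
  "unit_normal \<rho> x = sgn (gradient \<rho> x)"

text \<open>The principal curvatures at \<open>p\<close> are the eigenvalues of the shape operator
  \<open>v \<mapsto> d\<nu>\<^sub>p(v)\<close> of the tangent space at \<open>p\<close>. On tangent vectors it does not depend on the
  choice of \<open>\<rho>\<close>. For the external normal \<open>\<nu>\<close> and with this sign, a ball of radius \<open>R\<close> has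
  principal curvatures \<open>1/R\<close>.\<close>

definition principal_curvature :: "(real^'n::finite) set \<Rightarrow> real^'n \<Rightarrow> real \<Rightarrow> bool" where
  "principal_curvature \<Omega> p \<kappa> \<longleftrightarrow>
     (\<exists>U \<rho> v. boundary_defining \<Omega> p U \<rho> \<and> v \<noteq> 0 \<and> v \<bullet> unit_normal \<rho> p = 0 \<and>
        frechet_derivative (unit_normal \<rho>) (at p) v = \<kappa> *\<^sub>R v)"


section \<open>Weak solutions and stability\<close>

definition A_matrix :: "(real \<Rightarrow> real) \<Rightarrow> real^'n::finite \<Rightarrow> real^'n^'n" where
  "A_matrix a \<xi> =
     (if \<xi> = 0 then a 0 *\<^sub>R mat 1
      else (\<chi> h k. deriv a (norm \<xi>) / norm \<xi> * \<xi> $ h * \<xi> $ k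
                    + a (norm \<xi>) * (if h = k then 1 else 0)))"

definition condition_A1 :: "(real^'n::finite) set \<Rightarrow> (real^'n \<Rightarrow> real) \<Rightarrow> bool" where
  "condition_A1 \<Omega> u \<longleftrightarrow> {x \<in> closure \<Omega>. closure_gradient \<Omega> u x = 0} = {}"

definition condition_A2 :: "(real \<Rightarrow> real) \<Rightarrow> bool" where
  "condition_A2 a \<longleftrightarrow> continuous_on {0..} a \<and> C1_halfline (\<lambda>t. t * a t)"

definition weak_solution ::
    "(real^'n::finite) set \<Rightarrow> (real \<Rightarrow> real) \<Rightarrow> (real \<Rightarrow> real) \<Rightarrow> (real^'n \<Rightarrow> real) \<Rightarrow> bool" where
  "weak_solution \<Omega> a f u \<longleftrightarrow>
     Ck_closure 1 \<Omega> u \<and>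
     (\<forall>\<phi>. Ck_closure 1 \<Omega> \<phi> \<longrightarrow>
        (LINT x:\<Omega>|lebesgue. a (norm (gradient u x)) * (gradient u x \<bullet> gradient \<phi> x))
        - (LINT x:\<Omega>|lebesgue. f (u x) * \<phi> x) = 0) \<and>
     (condition_A1 \<Omega> u \<or> condition_A2 a)"

definition stable_weak_solution ::
    "(real^'n::finite) set \<Rightarrow> (real \<Rightarrow> real) \<Rightarrow> (real \<Rightarrow> real) \<Rightarrow> (real^'n \<Rightarrow> real) \<Rightarrow> bool" where
  "stable_weak_solution \<Omega> a f u \<longleftrightarrow>
     weak_solution \<Omega> a f u \<and>
     (\<forall>\<phi>. Ck_closure 1 \<Omega> \<phi> \<longrightarrow>
        (LINT x:\<Omega>|lebesgue. (A_matrix a (gradient u x) *v gradient \<phi> x) \<bullet> gradient \<phi> x)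
        - (LINT x:\<Omega>|lebesgue. deriv f (u x) * (\<phi> x)\<^sup>2) \<ge> 0)"

end

theory Submission
  imports Defs
begin

text \<open>Write \<open>v\<close> for the gradient of \<open>u\<close>, \<open>w i\<close> for the gradients of its components, and \<open>A\<close> for
  \<open>A(\<nabla>u)\<close>. Testing the weak equation with difference quotients of \<open>\<eta> v\<^sub>i\<close>, where \<open>\<eta>\<close> is a cutoff
  built from the gauge of \<open>\<Omega>\<close>, and letting \<open>\<eta>\<close> tend to 1 yields
  \<open>\<integral> \<Sum>\<^sub>i A w\<^sub>i \<cdot> w\<^sub>i - f'(u) \<bar>v\<bar>\<^sup>2 \<le> 0\<close>, because \<open>D\<^sup>2u v \<cdot> \<nu> \<le> 0\<close> on the boundary by convexity and
  \<open>v \<cdot> \<nu> = 0\<close>. Stability tested with \<open>sqrt (\<epsilon>\<^sup>2 + \<bar>v\<bar>\<^sup>2)\<close> bounds the same integral from below, and in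
  the limit \<open>\<epsilon> \<rightarrow> 0\<close> the equality case of Cauchy-Schwarz forces \<open>D\<^sup>2u\<close> to be a multiple of
  \<open>v v\<^sup>T\<close> wherever \<open>v \<noteq> 0\<close>. So near such a point \<open>u\<close> depends on one variable only, and \<open>v\<close> is
  constant on whole hyperplane slices of \<open>\<Omega>\<close>; where these reach the boundary, \<open>v \<cdot> \<nu> = 0\<close>
  contradicts the strict convexity that positive curvatures entail.\<close>


section \<open>Gradients and supporting normals\<close>

text \<open>The obstacle is regularity: \<open>u\<close> is only C^2 and the flux a(|v|)v only C^1,
  so each field \<open>A w_i\<close> is merely continuous and has no pointwise divergence, while the
  test functions \<open>\<eta> v_i\<close> have no second derivatives. Difference quotients of
  compactly supported test functions avoid both problems; the boundary term then appears as a limit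
  over a thin layer rather than as a surface integral. The squared gauge suits this limit: it is
  C^1, its gradient on the frontier is a positive multiple of the normal, and its sublevel sets are
  homothetic copies of the domain, so a layer of width \<delta> has volume O(\<delta>), which
  compensates the factor 1/\<delta> in the gradient of the cutoff. The pointwise condition v
  \<bullet> \<nu> = 0 is not part of the notion of weak solution and is recovered from the weak
  form. The parameter \<epsilon> in the stability test is there because |v| need not be
  differentiable where v vanishes. Conditions (A1) and (A2) both serve to make A(v) continuous up to
  the boundary: either v avoids the origin or A is continuous there.\<close>

lemma vec_has_derivative:
  fixes f :: "'a::real_normed_vector \<Rightarrow> real^'n"
  assumes "\<And>i. ((\<lambda>x. f x $ i) has_derivative (\<lambda>h. f' h $ i)) (at x within S)"
  shows "(f has_derivative f') (at x within S)"
  unfolding has_derivative_componentwise_within[of f]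
  using assms by (auto simp: Basis_vec_def inner_axis)

lemma gradient_has_derivative:
  assumes "\<phi> differentiable (at x)"
  shows "(\<phi> has_derivative (\<lambda>h. gradient \<phi> x \<bullet> h)) (at x)"
proof -
  have D: "(\<phi> has_derivative frechet_derivative \<phi> (at x)) (at x)"
    using assms frechet_derivative_works by blast
  then have lin: "linear (frechet_derivative \<phi> (at x))"
    by (rule has_derivative_linear)
  have "frechet_derivative \<phi> (at x) h = gradient \<phi> x \<bullet> h" for h
  proof -
    have "frechet_derivative \<phi> (at x) h = frechet_derivative \<phi> (at x) (\<Sum>i\<in>UNIV. h $ i *\<^sub>R axis i 1)"
      by (simp add: basis_expansion scalar_mult_eq_scaleR[symmetric])
    also have "\<dots> = gradient \<phi> x \<bullet> h"
      by (simp add: linear_sum[OF lin] linear_scale[OF lin] gradient_def partial_def inner_vec_def mult.commute)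
    finally show ?thesis .
  qed
  then have "frechet_derivative \<phi> (at x) = (\<lambda>h. gradient \<phi> x \<bullet> h)" by blast
  with D show ?thesis by simp
qed

lemma partial_unique:
  assumes "(\<phi> has_derivative (\<lambda>h. g \<bullet> h)) (at x)"
  shows "partial i \<phi> x = g $ i"
  using frechet_derivative_at[OF assms] unfolding partial_def
  by (metis cart_eq_inner_axis)

lemma gradient_unique:
  assumes "(\<phi> has_derivative (\<lambda>h. g \<bullet> h)) (at x)"
  shows "gradient \<phi> x = g"
  by (simp add: gradient_def partial_unique[OF assms])

section \<open>Restriction to lines and symmetry of second derivatives\<close>

lemma has_derivative_line:
  assumes "(\<phi> has_derivative (\<lambda>h. g \<bullet> h)) (at (x + t *\<^sub>R h))"
  shows "((\<lambda>t. \<phi> (x + t *\<^sub>R h)) has_real_derivative g \<bullet> h) (at t)"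
proof -
  have "((\<lambda>t. x + t *\<^sub>R h) has_derivative (\<lambda>s. s *\<^sub>R h)) (at t)"
    by (auto intro!: derivative_eq_intros)
  from has_derivative_compose[OF this assms]
  have "((\<lambda>t. \<phi> (x + t *\<^sub>R h)) has_derivative (\<lambda>s. (g \<bullet> h) * s)) (at t)"
    by (simp add: mult.commute)
  then show ?thesis by (simp add: has_field_derivative_def)
qed

text \<open>The second difference is symmetric in \<open>h\<close> and \<open>k\<close>, so
  computing its limit in both orders gives the symmetry of the Hessian. The mean value theorem is
  applied in direction \<open>k\<close> to the difference of \<open>u\<close> along two parallel
  segments; after that, differentiability of \<open>v \<bullet> k\<close> at the single point
  \<open>x\<close> suffices.\<close>

lemma second_difference_quotient_tendsto:
  fixes u :: "real^'n \<Rightarrow> real"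
  assumes "open S" "x \<in> S"
    and u: "\<And>y. y \<in> S \<Longrightarrow> (u has_derivative (\<lambda>h. v y \<bullet> h)) (at y)"
    and w: "((\<lambda>y. v y \<bullet> k) has_derivative (\<lambda>h. w \<bullet> h)) (at x)"
  shows "((\<lambda>s. (u (x + s *\<^sub>R k + s *\<^sub>R h) - u (x + s *\<^sub>R k) - u (x + s *\<^sub>R h) + u x) / s\<^sup>2)
           \<longlongrightarrow> w \<bullet> h) (at_right 0)"
proof (rule tendstoI)
  fix e :: real assume "e > 0"
  \<comment> \<open>Two linearization errors of size \<open>e' * s * (norm k + norm h + 1)\<close>
    are added below; the last \<open>+ 1\<close> in the denominator makes their sum strictly less
    than \<open>s * e\<close>.\<close>
  define e' where "e' = e / (2 * (norm k + norm h + 1) + 1)"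
  have K: "norm k + norm h + 1 > 0" using norm_ge_zero[of k] norm_ge_zero[of h] by linarith
  have e': "e' > 0" unfolding e'_def using \<open>e > 0\<close> K by simp
  obtain d1 where d1: "d1 > 0" "ball x d1 \<subseteq> S"
    using \<open>open S\<close> \<open>x \<in> S\<close> openE by blast
  obtain d2 where d2: "d2 > 0"
    "\<And>y. norm (y - x) < d2 \<Longrightarrow> \<bar>v y \<bullet> k - v x \<bullet> k - w \<bullet> (y - x)\<bar> \<le> e' * norm (y - x)"
    using w e' unfolding has_derivative_at_alt by (auto simp: real_norm_def)
  define d where "d = min d1 d2"
  have "d > 0" using d1 d2 by (simp add: d_def)
  have main: "\<bar>(u (x + s *\<^sub>R k + s *\<^sub>R h) - u (x + s *\<^sub>R k) - u (x + s *\<^sub>R h) + u x) / s\<^sup>2 - w \<bullet> h\<bar> < e"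
    if s: "0 < s" "s < d / (norm k + norm h + 1)" for s
  proof -
    have sd: "s * (norm k + norm h + 1) < d" using s K by (simp add: pos_less_divide_eq)
    have small: "norm (t *\<^sub>R k + r *\<^sub>R h) \<le> s * (norm k + norm h + 1)" if "0 \<le> t" "t \<le> s" "0 \<le> r" "r \<le> s" for t r
    proof -
      have "norm (t *\<^sub>R k + r *\<^sub>R h) \<le> t * norm k + r * norm h"
        using norm_triangle_ineq[of "t *\<^sub>R k" "r *\<^sub>R h"] that by simp
      also have "\<dots> \<le> s * norm k + s * norm h" using that by (intro add_mono mult_right_mono) auto
      also have "\<dots> \<le> s * (norm k + norm h + 1)" using s by (simp add: algebra_simps)
      finally show ?thesis .
    qed
    define \<phi> where "\<phi> t = u ((x + s *\<^sub>R h) + t *\<^sub>R k) - u (x + t *\<^sub>R k)" for t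
    have der: "(\<phi> has_real_derivative v (x + s *\<^sub>R h + t *\<^sub>R k) \<bullet> k - v (x + t *\<^sub>R k) \<bullet> k) (at t)"
      if "0 \<le> t" "t \<le> s" for t
    proof -
      have "x + s *\<^sub>R h + t *\<^sub>R k \<in> S" "x + t *\<^sub>R k \<in> S"
        using small[of t s] small[of t 0] sd that s d1(2) by (auto simp: d_def dist_norm subset_iff norm_minus_commute algebra_simps)
      then show ?thesis unfolding \<phi>_def
        by (intro DERIV_diff has_derivative_line u)
    qed
    obtain t where t: "0 < t" "t < s" "\<phi> s - \<phi> 0 = s * (v (x + s *\<^sub>R h + t *\<^sub>R k) \<bullet> k - v (x + t *\<^sub>R k) \<bullet> k)"
      using MVT2[of 0 s \<phi> "\<lambda>t. v (x + s *\<^sub>R h + t *\<^sub>R k) \<bullet> k - v (x + t *\<^sub>R k) \<bullet> k"] der s by auto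
    have D: "u (x + s *\<^sub>R k + s *\<^sub>R h) - u (x + s *\<^sub>R k) - u (x + s *\<^sub>R h) + u x = \<phi> s - \<phi> 0"
      by (simp add: \<phi>_def algebra_simps)
    let ?y = "x + s *\<^sub>R h + t *\<^sub>R k" and ?z = "x + t *\<^sub>R k"
    have n1: "norm (?y - x) \<le> s * (norm k + norm h + 1)" "norm (?z - x) \<le> s * (norm k + norm h + 1)"
      using small[of t s] small[of t 0] t s by (auto simp: algebra_simps)
    have a1: "\<bar>v ?y \<bullet> k - v x \<bullet> k - w \<bullet> (?y - x)\<bar> \<le> e' * (s * (norm k + norm h + 1))"
      using d2(2)[of ?y] n1 sd e' by (smt (verit) d_def mult_left_mono)
    have a2: "\<bar>v ?z \<bullet> k - v x \<bullet> k - w \<bullet> (?z - x)\<bar> \<le> e' * (s * (norm k + norm h + 1))"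
      using d2(2)[of ?z] n1 sd e' by (smt (verit) d_def mult_left_mono)
    have "w \<bullet> (?y - x) - w \<bullet> (?z - x) = s * (w \<bullet> h)" by (simp add: algebra_simps inner_add_right)
    then have "\<bar>v ?y \<bullet> k - v ?z \<bullet> k - s * (w \<bullet> h)\<bar> \<le> 2 * (e' * (s * (norm k + norm h + 1)))"
      using a1 a2 by linarith
    also have "\<dots> = s * (2 * e' * (norm k + norm h + 1))" by simp
    also have "\<dots> < s * e"
    proof (rule mult_strict_left_mono)
      have "2 * e' * (norm k + norm h + 1) < e' * (2 * (norm k + norm h + 1) + 1)"
        using e' by (simp add: algebra_simps)
      also have "\<dots> = e" unfolding e'_def using K by (simp add: field_simps)
      finally show "2 * e' * (norm k + norm h + 1) < e" .
    qed (use s in simp)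
    finally have b: "\<bar>v ?y \<bullet> k - v ?z \<bullet> k - s * (w \<bullet> h)\<bar> < s * e" .
    have "(u (x + s *\<^sub>R k + s *\<^sub>R h) - u (x + s *\<^sub>R k) - u (x + s *\<^sub>R h) + u x) / s\<^sup>2 - w \<bullet> h
         = (v ?y \<bullet> k - v ?z \<bullet> k - s * (w \<bullet> h)) / s"
      unfolding D t(3) using s by (simp add: field_simps power2_eq_square)
    then show ?thesis using b s by (simp add: abs_divide pos_divide_less_eq mult.commute)
  qed
  show "\<forall>\<^sub>F s in at_right 0. dist ((u (x + s *\<^sub>R k + s *\<^sub>R h) - u (x + s *\<^sub>R k) - u (x + s *\<^sub>R h) + u x) / s\<^sup>2) (w \<bullet> h) < e"
    unfolding eventually_at_right_field dist_real_def
    using main \<open>d > 0\<close> K by (intro exI[of _ "d / (norm k + norm h + 1)"]) auto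
qed

lemma symmetric_second_derivative:
  fixes u :: "real^'n \<Rightarrow> real"
  assumes "open S" "x \<in> S"
    and u: "\<And>y. y \<in> S \<Longrightarrow> (u has_derivative (\<lambda>h. v y \<bullet> h)) (at y)"
    and w: "\<And>i. ((\<lambda>y. v y $ i) has_derivative (\<lambda>h. w i \<bullet> h)) (at x)"
  shows "w i $ j = w j $ i"
proof -
  have w': "((\<lambda>y. v y \<bullet> axis i 1) has_derivative (\<lambda>h. w i \<bullet> h)) (at x)" for i
    using w[of i] by (simp add: inner_axis)
  have "((\<lambda>s. (u (x + s *\<^sub>R axis i 1 + s *\<^sub>R axis j 1) - u (x + s *\<^sub>R axis i 1) - u (x + s *\<^sub>R axis j 1) + u x) / s\<^sup>2)
           \<longlongrightarrow> w i \<bullet> axis j 1) (at_right 0)"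
    by (rule second_difference_quotient_tendsto[OF assms(1,2) u w'])
  moreover have "((\<lambda>s. (u (x + s *\<^sub>R axis i 1 + s *\<^sub>R axis j 1) - u (x + s *\<^sub>R axis i 1) - u (x + s *\<^sub>R axis j 1) + u x) / s\<^sup>2)
           \<longlongrightarrow> w j \<bullet> axis i 1) (at_right 0)"
    using second_difference_quotient_tendsto[OF assms(1,2) u w', of j "axis i 1"]
    by (simp add: algebra_simps)
  ultimately show ?thesis
    by (drule_tac tendsto_unique[OF trivial_limit_at_right_real, rotated]) (auto simp: inner_axis)
qed

section \<open>Normals of a smooth convex domain\<close>

lemma smooth_on_differentiable:
  assumes "smooth_on U \<rho>" "x \<in> U"
  shows "\<rho> differentiable (at x)" "partial i \<rho> differentiable (at x)"
  using assms(1)[unfolded smooth_on_def, rule_format, of "Suc (Suc 0)"] assms(2) by auto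

lemma differentiable_unit_normal:
  assumes "smooth_on U \<rho>" "x \<in> U" "gradient \<rho> x \<noteq> 0"
  shows "unit_normal \<rho> differentiable (at x)"
proof -
  have "(gradient \<rho> has_derivative (\<lambda>h. \<chi> i. gradient (partial i \<rho>) x \<bullet> h)) (at x)"
    using gradient_has_derivative[OF smooth_on_differentiable(2)[OF assms(1,2)]]
    by (intro vec_has_derivative) (simp add: gradient_def)
  then have D: "gradient \<rho> differentiable (at x)" by (auto simp: differentiable_def)
  have N: "(\<lambda>x. norm (gradient \<rho> x)) differentiable (at x)"
    using differentiable_compose[OF differentiable_norm_at[OF assms(3)] D] .
  have "(\<lambda>x. gradient \<rho> x /\<^sub>R norm (gradient \<rho> x)) differentiable (at x)"
    using assms(3) by (intro differentiable_scaleR differentiable_inverse D N) auto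
  then show ?thesis by (simp add: unit_normal_def[abs_def] sgn_div_norm)
qed

lemma frontier_open_iff: "open \<Omega> \<Longrightarrow> p \<in> frontier \<Omega> \<longleftrightarrow> p \<in> closure \<Omega> \<and> p \<notin> \<Omega>"
  by (simp add: frontier_def interior_open)

lemma convex_open_segment_mem:
  fixes \<Omega> :: "'a::euclidean_space set"
  assumes "convex \<Omega>" "open \<Omega>" "y \<in> \<Omega>" "q \<in> closure \<Omega>" "0 < t" "t \<le> 1"
  shows "q + t *\<^sub>R (y - q) \<in> \<Omega>"
  using mem_interior_closure_convex_shrink[of \<Omega> y q t] assms
  by (simp add: interior_open algebra_simps)

text \<open>If the normal \<open>m\<close> had a positive product with \<open>y - q\<close>, then
  \<rho> would increase along a segment that runs into \<Omega> by convexity. For uniqueness, a unit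
  vector \<open>n\<close> different from \<open>m\<close> satisfies
  \<open>m \<bullet> (n - m) < 0\<close>, so the direction \<open>n - m\<close> enters \<Omega>,
  whereas \<open>n \<bullet> (n - m) > 0\<close> contradicts support. Uniqueness is what makes the
  normal independent of the defining function.\<close>

lemma unit_normal_supporting:
  assumes bd: "boundary_defining \<Omega> p U \<rho>" and \<Omega>: "convex \<Omega>" "open \<Omega>"
    and q: "q \<in> frontier \<Omega>" "q \<in> U"
  shows "norm (unit_normal \<rho> q) = 1"
    and "y \<in> closure \<Omega> \<Longrightarrow> unit_normal \<rho> q \<bullet> (y - q) \<le> 0"
    and "norm n = 1 \<Longrightarrow> (\<And>y. y \<in> \<Omega> \<Longrightarrow> n \<bullet> (y - q) \<le> 0) \<Longrightarrow> n = unit_normal \<rho> q"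
proof -
  have U: "open U" "smooth_on U \<rho>" "gradient \<rho> q \<noteq> 0" "\<rho> q = 0"
    and in\<Omega>: "\<And>x. x \<in> U \<Longrightarrow> x \<in> \<Omega> \<longleftrightarrow> \<rho> x < 0"
    using bd q unfolding boundary_defining_def by auto
  let ?g = "gradient \<rho> q"
  show n1: "norm (unit_normal \<rho> q) = 1" using U(3) by (simp add: unit_normal_def norm_sgn)
  have G: "?g = norm ?g *\<^sub>R unit_normal \<rho> q"
    using U(3) by (simp add: unit_normal_def sgn_div_norm)
  have line: "((\<lambda>t. \<rho> (q + t *\<^sub>R h)) has_real_derivative ?g \<bullet> h) (at 0)" for h
    using gradient_has_derivative[OF smooth_on_differentiable(1)[OF U(2) q(2)]]
    by (intro has_derivative_line) simp
  have near: "\<exists>d>0. \<forall>t. 0 < t \<and> t < d \<longrightarrow> q + t *\<^sub>R h \<in> U" for h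
  proof -
    have "((\<lambda>t. q + t *\<^sub>R h) \<longlongrightarrow> q + 0 *\<^sub>R h) (at_right 0)"
      by (intro tendsto_intros)
    then have "\<forall>\<^sub>F t in at_right 0. q + t *\<^sub>R h \<in> U"
      using U(1) q(2) by (intro topological_tendstoD) auto
    then show ?thesis unfolding eventually_at_right_field by auto
  qed
  have interior_case: "unit_normal \<rho> q \<bullet> (y - q) \<le> 0" if "y \<in> \<Omega>" for y
  proof (rule ccontr)
    assume "\<not> unit_normal \<rho> q \<bullet> (y - q) \<le> 0"
    then have "?g \<bullet> (y - q) > 0" using U(3) by (subst G) simp
    from DERIV_pos_inc_right[OF line this] obtain d where d: "d > 0"
      "\<And>h. 0 < h \<Longrightarrow> h < d \<Longrightarrow> \<rho> q < \<rho> (q + h *\<^sub>R (y - q))" by auto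
    obtain d' where d': "d' > 0" "\<And>t. 0 < t \<Longrightarrow> t < d' \<Longrightarrow> q + t *\<^sub>R (y - q) \<in> U" using near by blast
    define t where "t = min 1 (min (d/2) (d'/2))"
    have t: "0 < t" "t \<le> 1" "t < d" "t < d'" using d d' by (auto simp: t_def min_def)
    have "q + t *\<^sub>R (y - q) \<in> \<Omega>"
      using convex_open_segment_mem[OF \<Omega> that _ t(1,2)] q(1) by (simp add: frontier_def)
    then have "\<rho> (q + t *\<^sub>R (y - q)) < 0" using in\<Omega>[OF d'(2)[OF t(1,4)]] by simp
    with d(2)[OF t(1,3)] U(4) show False by simp
  qed
  show "unit_normal \<rho> q \<bullet> (y - q) \<le> 0" if "y \<in> closure \<Omega>"
  proof -
    have "closure \<Omega> \<subseteq> {y. unit_normal \<rho> q \<bullet> (y - q) \<le> 0}"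
      by (rule closure_minimal) (auto intro!: closed_Collect_le continuous_intros interior_case)
    then show ?thesis using that by blast
  qed
  show "n = unit_normal \<rho> q" if n: "norm n = 1" and sup: "\<And>y. y \<in> \<Omega> \<Longrightarrow> n \<bullet> (y - q) \<le> 0"
  proof (rule ccontr)
    let ?m = "unit_normal \<rho> q"
    assume "n \<noteq> ?m"
    then have "0 < (n - ?m) \<bullet> (n - ?m)" by simp
    moreover have "n \<bullet> n = 1" "?m \<bullet> ?m = 1" using n n1 by (simp_all add: dot_square_norm)
    ultimately have lt: "n \<bullet> ?m < 1" "?m \<bullet> (n - ?m) < 0"
      by (auto simp: inner_diff_left inner_diff_right inner_commute)
    then have "?g \<bullet> (n - ?m) < 0" using U(3) by (subst G) (simp add: mult_pos_neg)
    from DERIV_neg_dec_right[OF line this] obtain d where d: "d > 0"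
      "\<And>h. 0 < h \<Longrightarrow> h < d \<Longrightarrow> \<rho> q > \<rho> (q + h *\<^sub>R (n - ?m))" by auto
    obtain d' where d': "d' > 0" "\<And>t. 0 < t \<Longrightarrow> t < d' \<Longrightarrow> q + t *\<^sub>R (n - ?m) \<in> U" using near by blast
    define t where "t = min (d/2) (d'/2)"
    have t: "0 < t" "t < d" "t < d'" using d d' by (auto simp: t_def min_def)
    have "q + t *\<^sub>R (n - ?m) \<in> \<Omega>" using in\<Omega>[OF d'(2)[OF t(1,3)]] d(2)[OF t(1,2)] U(4) by simp
    from sup[OF this] have "n \<bullet> (n - ?m) \<le> 0" using t by (simp add: mult_le_0_iff)
    then show False using lt \<open>n \<bullet> n = 1\<close> by (simp add: inner_diff_right)
  qed
qed

text \<open>A small step from \<open>y\<close> in the direction \<open>n\<close> stays in the open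
  set, so equality at \<open>y\<close> would violate the support inequality at the end of that
  step.\<close>

lemma strict_supporting_interior:
  assumes "open \<Omega>" "norm n = 1" "\<And>y. y \<in> \<Omega> \<Longrightarrow> n \<bullet> (y - q) \<le> 0" "y \<in> \<Omega>"
  shows "n \<bullet> (y - q) < 0"
proof -
  obtain e where e: "e > 0" "cball y e \<subseteq> \<Omega>" using assms open_contains_cball by blast
  have "y + e *\<^sub>R n \<in> \<Omega>" using e assms(2) by (auto simp: subset_iff dist_norm)
  from assms(3)[OF this] have "n \<bullet> (y - q) + e * (n \<bullet> n) \<le> 0" by (simp add: algebra_simps)
  then show ?thesis using e assms(2) by (simp add: dot_square_norm)
qed

text \<open>The interface through which the geometry enters: local defining functions are replaced
  by one global normal field. It is meaningful only on the frontier, hence differentiability within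
  the frontier, and positive curvature survives as strict support on the whole closure.\<close>

locale strictly_convex_domain =
  fixes \<Omega> :: "(real^'n::finite) set" and \<nu> :: "real^'n \<Rightarrow> real^'n"
  assumes op: "open \<Omega>" and bdd: "bounded \<Omega>" and conv: "convex \<Omega>" and nonempty: "\<Omega> \<noteq> {}"
    and norm_\<nu>: "p \<in> frontier \<Omega> \<Longrightarrow> norm (\<nu> p) = 1"
    and \<nu>_strict: "p \<in> frontier \<Omega> \<Longrightarrow> y \<in> closure \<Omega> \<Longrightarrow> y \<noteq> p \<Longrightarrow> \<nu> p \<bullet> (y - p) < 0"
    and \<nu>_differentiable: "p \<in> frontier \<Omega> \<Longrightarrow> \<nu> differentiable (at p within frontier \<Omega>)"

text \<open>If the hyperplane supporting at \<open>p\<close> met the closure in a second frontier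
  point \<open>q\<close>, the whole segment would lie in the frontier with constant normal. The
  derivative of the normal at the midpoint would then annihilate the tangent vector
  \<open>q - p\<close>, so 0 would be a principal curvature there.\<close>

lemma strictly_convex_domain_exists:
  fixes \<Omega> :: "(real^'n::finite) set"
  assumes \<Omega>: "open \<Omega>" "bounded \<Omega>" "convex \<Omega>" "\<Omega> \<noteq> {}"
    and sm: "smooth_boundary \<Omega>"
    and curv: "\<And>p \<kappa>. p \<in> frontier \<Omega> \<Longrightarrow> principal_curvature \<Omega> p \<kappa> \<Longrightarrow> \<kappa> > 0"
  shows "\<exists>\<nu>. strictly_convex_domain \<Omega> \<nu>"
proof -
  define F where "F = frontier \<Omega>"
  have "\<forall>p\<in>F. \<exists>U \<rho>. boundary_defining \<Omega> p U \<rho>" using sm by (simp add: smooth_boundary_def F_def)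
  then obtain U \<rho> where bd: "\<And>p. p \<in> F \<Longrightarrow> boundary_defining \<Omega> p (U p) (\<rho> p)" by metis
  have inU: "p \<in> U p" "open (U p)" if "p \<in> F" for p using bd[OF that] by (auto simp: boundary_defining_def)
  define \<nu> where "\<nu> p = unit_normal (\<rho> p) p" for p
  note sup = unit_normal_supporting[OF _ \<Omega>(3,1)]
  have n1: "norm (\<nu> p) = 1" and le: "\<And>y. y \<in> closure \<Omega> \<Longrightarrow> \<nu> p \<bullet> (y - p) \<le> 0" if "p \<in> F" for p
    using sup(1,2)[OF bd[OF that]] that inU unfolding \<nu>_def F_def by auto
  have uniq: "n = unit_normal \<rho>' q"
    if "boundary_defining \<Omega> p U' \<rho>'" "q \<in> F" "q \<in> U'" "norm n = 1" "\<And>y. y \<in> \<Omega> \<Longrightarrow> n \<bullet> (y - q) \<le> 0"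
    for p U' \<rho>' q n
    using sup(3)[OF that(1)] that(2-) by (auto simp: F_def)
  \<comment> \<open>All local defining functions give the same normal on overlaps, so \<nu>,
    although defined by a pointwise choice, coincides on the frontier near each point with one
    differentiable field.\<close>
  have eq: "\<nu> q = unit_normal \<rho>' q" if "boundary_defining \<Omega> p U' \<rho>'" "q \<in> F" "q \<in> U'" for p U' \<rho>' q
    using uniq[OF that n1[OF that(2)]] le[OF that(2)] closure_subset by blast
  have lt: "\<nu> p \<bullet> (y - p) < 0" if "p \<in> F" "y \<in> \<Omega>" for p y
    by (rule strict_supporting_interior[OF \<Omega>(1) n1[OF that(1)] _ that(2)])
      (use le[OF that(1)] closure_subset in blast)
  have strict: "\<nu> p \<bullet> (q - p) < 0" if p: "p \<in> F" and q: "q \<in> F" and ne: "q \<noteq> p" for p q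
  proof (rule ccontr)
    assume "\<not> \<nu> p \<bullet> (q - p) < 0"
    moreover have cl: "p \<in> closure \<Omega>" "q \<in> closure \<Omega>" using p q by (auto simp: F_def frontier_def)
    ultimately have z: "\<nu> p \<bullet> (q - p) = 0" using le[OF p, of q] by simp
    \<comment> \<open>The segment is parametrized from its midpoint, so that \<open>t = 0\<close> is
      interior to the parameter range and a two-sided derivative can be taken there.\<close>
    define r where "r t = p + (1/2) *\<^sub>R (q - p) + t *\<^sub>R (q - p)" for t :: real
    have rF: "r t \<in> F" if "\<bar>t\<bar> \<le> 1/2" for t
    proof -
      have "r t = (1 - (1/2 + t)) *\<^sub>R p + (1/2 + t) *\<^sub>R q"
        by (simp add: r_def vec_eq_iff field_simps)
      moreover have "0 \<le> 1/2 + t" "1/2 + t \<le> 1" using that by auto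
      ultimately have "r t \<in> closure \<Omega>"
        by (metis convexD_alt[OF convex_closure[OF \<Omega>(3)] cl])
      moreover have "\<nu> p \<bullet> (r t - p) = 0"
        using z by (simp add: r_def algebra_simps inner_add_right)
      then have "r t \<notin> \<Omega>" using lt[OF p] by fastforce
      ultimately show ?thesis using \<Omega>(1) by (simp add: F_def frontier_open_iff)
    qed
    define V \<rho>' where "V = U (r 0)" and "\<rho>' = \<rho> (r 0)"
    have r0: "r 0 \<in> F" using rF by simp
    have bd': "boundary_defining \<Omega> (r 0) V \<rho>'" using bd[OF r0] by (simp add: V_def \<rho>'_def)
    have V: "open V" "r 0 \<in> V" using inU[OF r0] by (auto simp: V_def)
    \<comment> \<open>The hyperplane supporting at \<open>p\<close> contains the segment and so
      supports at each of its points; uniqueness of the supporting normal does the rest.\<close>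
    have const: "unit_normal \<rho>' (r t) = \<nu> p" if "\<bar>t\<bar> \<le> 1/2" "r t \<in> V" for t
    proof (rule uniq[symmetric, OF bd' rF[OF that(1)] that(2) n1[OF p]])
      fix y assume "y \<in> \<Omega>"
      have "\<nu> p \<bullet> (y - r t) = \<nu> p \<bullet> (y - p)"
        using z by (simp add: r_def algebra_simps inner_add_right)
      then show "\<nu> p \<bullet> (y - r t) \<le> 0" using lt[OF p \<open>y \<in> \<Omega>\<close>] by simp
    qed
    have "unit_normal \<rho>' differentiable (at (r 0))"
      by (rule differentiable_unit_normal[of V]) (use bd' in \<open>auto simp: boundary_defining_def\<close>)
    then have fd: "(unit_normal \<rho>' has_derivative frechet_derivative (unit_normal \<rho>') (at (r 0))) (at (r 0))"
      using frechet_derivative_works by blast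
    have rd: "(r has_derivative (\<lambda>t. t *\<^sub>R (q - p))) (at 0)"
      unfolding r_def by (auto intro!: derivative_eq_intros)
    have D1: "((\<lambda>t. unit_normal \<rho>' (r t)) has_derivative (\<lambda>t. frechet_derivative (unit_normal \<rho>') (at (r 0)) (t *\<^sub>R (q - p)))) (at 0)"
      using has_derivative_compose[OF rd fd] .
    have "(r \<longlongrightarrow> r 0) (at 0)" using has_derivative_continuous[OF rd] by (simp add: continuous_within)
    then have "\<forall>\<^sub>F t in at 0. r t \<in> V" using V by (intro topological_tendstoD) auto
    moreover have "\<forall>\<^sub>F t in at 0. \<bar>t\<bar> \<le> (1/2::real)"
      unfolding eventually_at by (intro exI[of _ "1/2"]) auto
    ultimately have ev: "\<forall>\<^sub>F t in at 0. \<nu> p = unit_normal \<rho>' (r t)"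
      by eventually_elim (use const in auto)
    have "((\<lambda>t. unit_normal \<rho>' (r t)) has_derivative (\<lambda>t::real. 0)) (at 0)"
      by (rule has_derivative_transform_eventually[OF has_derivative_const ev])
         (use const V in auto)
    from has_derivative_unique[OF D1 this] have "frechet_derivative (unit_normal \<rho>') (at (r 0)) (1 *\<^sub>R (q - p)) = 0"
      by metis
    then have "principal_curvature \<Omega> (r 0) 0"
      unfolding principal_curvature_def using bd' ne z const[of 0] V
      by (intro exI[of _ V] exI[of _ \<rho>'] exI[of _ "q - p"]) (auto simp: inner_commute)
    from curv[OF _ this] r0 show False by (simp add: F_def)
  qed
  have "strictly_convex_domain \<Omega> \<nu>"
  proof
    fix p assume p: "p \<in> frontier \<Omega>"
    show "norm (\<nu> p) = 1" using n1 p by (simp add: F_def)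
    show "\<nu> p \<bullet> (y - p) < 0" if "y \<in> closure \<Omega>" "y \<noteq> p" for y
      using lt[of p y] strict[of p y] that p \<Omega>(1) by (auto simp: F_def frontier_open_iff)
    have pF: "p \<in> F" using p by (simp add: F_def)
    have "unit_normal (\<rho> p) differentiable (at p)"
      by (rule differentiable_unit_normal[of "U p"]) (use bd[OF pF] in \<open>auto simp: boundary_defining_def\<close>)
    then have "unit_normal (\<rho> p) differentiable (at p within frontier \<Omega>)"
      by (rule differentiable_at_withinI)
    moreover have "\<forall>\<^sub>F q in at p within frontier \<Omega>. unit_normal (\<rho> p) q = \<nu> q"
    proof -
      have "\<forall>\<^sub>F q in at p within frontier \<Omega>. q \<in> U p"
        using inU[OF pF] by (meson eventually_at_topological)
      moreover have "\<forall>\<^sub>F q in at p within frontier \<Omega>. q \<in> frontier \<Omega>"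
        by (simp add: eventually_at_filter)
      ultimately show ?thesis by eventually_elim (use eq[OF bd[OF pF]] in \<open>auto simp: F_def\<close>)
    qed
    ultimately show "\<nu> differentiable (at p within frontier \<Omega>)"
      unfolding differentiable_def
      using has_derivative_transform_eventually p eq[OF bd[OF pF] pF inU(1)[OF pF]] by metis
  qed (use \<Omega> in auto)
  then show ?thesis by blast
qed

section \<open>The square of the gauge function\<close>

lemma has_derivative_scaleR_tendsto:
  fixes f :: "real \<Rightarrow> 'a::real_normed_vector"
  assumes "(f has_derivative (\<lambda>t. t *\<^sub>R e)) (at 0)"
  shows "((\<lambda>t. (f t - f 0) /\<^sub>R t) \<longlongrightarrow> e) (at 0)"
proof (rule LIM_zero_cancel, rule tendsto_norm_zero_cancel)
  have "((\<lambda>t. norm (f (0 + t) - f 0 - t *\<^sub>R e) / norm t) \<longlongrightarrow> 0) (at 0)"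
    using assms unfolding has_derivative_at by blast
  moreover have "\<forall>\<^sub>F t in at 0. norm (f (0 + t) - f 0 - t *\<^sub>R e) / norm t = norm ((f t - f 0) /\<^sub>R t - e)"
  proof -
    have "\<forall>\<^sub>F t in at 0. t \<noteq> (0::real)" by (simp add: eventually_at_filter)
    then show ?thesis
    proof eventually_elim
      case (elim t)
      then have "(f t - f 0) /\<^sub>R t - e = (f (0 + t) - f 0 - t *\<^sub>R e) /\<^sub>R t"
        by (simp add: scaleR_diff_right)
      then show ?case by (simp only: norm_scaleR) (simp add: divide_inverse mult.commute)
    qed
  qed
  ultimately show "((\<lambda>t. norm ((f t - f 0) /\<^sub>R t - e)) \<longlongrightarrow> 0) (at 0)"
    by (rule Lim_transform_eventually)
qed

section \<open>Conormals and the gauge of a strictly convex domain\<close>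

context strictly_convex_domain
begin

lemma frontier_closure: "p \<in> frontier \<Omega> \<Longrightarrow> p \<in> closure \<Omega>"
  by (simp add: frontier_def)

lemma compact_closure_dom: "compact (closure \<Omega>)"
  using bdd by simp

lemma \<nu>_le: "p \<in> frontier \<Omega> \<Longrightarrow> y \<in> closure \<Omega> \<Longrightarrow> \<nu> p \<bullet> (y - p) \<le> 0"
  using \<nu>_strict[of p y] by (cases "y = p") auto

text \<open>The sum of the support inequalities at \<open>p\<close> and at \<open>q\<close>.\<close>

lemma \<nu>_monotone:
  assumes "p \<in> frontier \<Omega>" "q \<in> frontier \<Omega>"
  shows "0 \<le> (q - p) \<bullet> (\<nu> q - \<nu> p)"
  using \<nu>_le[OF assms(1) frontier_closure[OF assms(2)]] \<nu>_le[OF assms(2) frontier_closure[OF assms(1)]]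
  by (simp add: inner_diff_left inner_diff_right inner_commute)

lemma continuous_on_\<nu>: "continuous_on (frontier \<Omega>) \<nu>"
  by (rule differentiable_imp_continuous_on) (simp add: differentiable_on_def \<nu>_differentiable)

text \<open>The normal is scaled so that the supporting half-space at \<open>p\<close> reads
  \<open>conormal c p \<bullet> (y - c) \<le> 1\<close>; this is the point of the polar body of
  \<Omega> about \<open>c\<close> that is dual to \<open>p\<close>.\<close>

definition conormal :: "real^'n \<Rightarrow> real^'n \<Rightarrow> real^'n" where
  "conormal c p = \<nu> p /\<^sub>R (\<nu> p \<bullet> (p - c))"

lemma \<nu>_center_pos: "c \<in> \<Omega> \<Longrightarrow> p \<in> frontier \<Omega> \<Longrightarrow> 0 < \<nu> p \<bullet> (p - c)"
  using \<nu>_strict[of p c] closure_subset frontier_open_iff[OF op]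
  by (force simp: inner_diff_right)

lemma conormal_le:
  assumes "c \<in> \<Omega>" "p \<in> frontier \<Omega>" "y \<in> closure \<Omega>"
  shows "conormal c p \<bullet> (y - c) \<le> 1"
proof -
  have "\<nu> p \<bullet> (y - c) \<le> \<nu> p \<bullet> (p - c)"
    using \<nu>_le[OF assms(2,3)] by (simp add: inner_diff_right)
  then show ?thesis
    using \<nu>_center_pos[OF assms(1,2)] by (simp add: conormal_def divide_simps)
qed

lemma conormal_eq: "c \<in> \<Omega> \<Longrightarrow> p \<in> frontier \<Omega> \<Longrightarrow> conormal c p \<bullet> (p - c) = 1"
  using \<nu>_center_pos[of c p] by (simp add: conormal_def)

text \<open>The normalized support inequality is tested at the point of the inscribed ball lying
  farthest in the direction \<open>\<nu> p\<close>. The bound becomes the Lipschitz constant of the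
  gauge.\<close>

lemma conormal_bound:
  assumes "c \<in> \<Omega>" "0 < r" "cball c r \<subseteq> \<Omega>" "p \<in> frontier \<Omega>"
  shows "norm (conormal c p) \<le> 1 / r"
proof -
  have "c + r *\<^sub>R \<nu> p \<in> closure \<Omega>"
    using assms norm_\<nu>[OF assms(4)] closure_subset by (force simp: dist_norm)
  from conormal_le[OF assms(1,4) this] have "r * (conormal c p \<bullet> \<nu> p) \<le> 1" by simp
  moreover have "conormal c p \<bullet> \<nu> p = norm (conormal c p)"
    using \<nu>_center_pos[OF assms(1,4)] norm_\<nu>[OF assms(4)]
    by (simp add: conormal_def dot_square_norm)
  ultimately show ?thesis using \<open>0 < r\<close> by (simp add: field_simps)
qed

lemma continuous_on_conormal: "c \<in> \<Omega> \<Longrightarrow> continuous_on (frontier \<Omega>) (conormal c)"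
  unfolding conormal_def[abs_def]
  using \<nu>_center_pos[of c] by (intro continuous_intros continuous_on_\<nu>) (auto simp: less_le)

text \<open>\<open>\<sigma>\<close> is the square of the Minkowski gauge of \<open>\<Omega>\<close> about \<open>c\<close>; squaring removes the
  singularity at \<open>c\<close>. The gauge is the maximum of the affine functions \<open>x \<mapsto> conormal c p \<bullet> (x - c)\<close>,
  and is differentiable because the maximizer depends continuously on \<open>x\<close>.\<close>

lemma square_gauge_exists:
  assumes c: "c \<in> \<Omega>"
  obtains \<sigma> :: "real^'n \<Rightarrow> real" and G :: "real^'n \<Rightarrow> real^'n" where
    "continuous_on UNIV G"
    "\<And>x. (\<sigma> has_derivative (\<lambda>h. (2 *\<^sub>R G x) \<bullet> h)) (at x)"
    "\<And>x. x \<in> \<Omega> \<longleftrightarrow> \<sigma> x < 1"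
    "\<And>x. x \<in> closure \<Omega> \<longleftrightarrow> \<sigma> x \<le> 1"
    "\<And>p. p \<in> frontier \<Omega> \<Longrightarrow> \<exists>k>0. G p = k *\<^sub>R \<nu> p"
    "\<And>x k. 0 < k \<Longrightarrow> \<sigma> (c + k *\<^sub>R x) = k\<^sup>2 * \<sigma> (c + x)"
    "\<And>x. 0 \<le> \<sigma> x"
proof -
  have "\<exists>d>0. c + d *\<^sub>R (x - c) \<in> frontier \<Omega> \<and> (\<forall>e. 0 \<le> e \<and> e < d \<longrightarrow> c + e *\<^sub>R (x - c) \<in> \<Omega>)"
    if "x \<noteq> c" for x
    using ray_to_frontier[OF bdd, of c "x - c"] c that op by (metis interior_open right_minus_eq)
  then obtain D where D: "\<And>x. x \<noteq> c \<Longrightarrow> 0 < D x"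
    and DF: "\<And>x. x \<noteq> c \<Longrightarrow> c + D x *\<^sub>R (x - c) \<in> frontier \<Omega>"
    and D\<Omega>: "\<And>x e. x \<noteq> c \<Longrightarrow> 0 \<le> e \<Longrightarrow> e < D x \<Longrightarrow> c + e *\<^sub>R (x - c) \<in> \<Omega>" by metis
  \<comment> \<open>\<open>P\<close> is the radial projection to the frontier, \<open>s\<close> the
    gauge and \<open>N x\<close> the conormal at \<open>P x\<close>. No ray is determined by the
    centre itself; the default 0 for \<open>s\<close> and \<open>N\<close> keeps the inequalities
    below valid there.\<close>
  define P where "P x = c + D x *\<^sub>R (x - c)" for x
  define s where "s x = (if x = c then 0 else 1 / D x)" for x
  define N where "N x = (if x = c then 0 else conormal c (P x))" for x
  have PF: "P x \<in> frontier \<Omega>" if "x \<noteq> c" for x using DF[OF that] by (simp add: P_def)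
  have sc [simp]: "s c = 0" "N c = 0" by (simp_all add: s_def N_def)
  have spos: "0 < s x" if "x \<noteq> c" for x using D[OF that] that by (simp add: s_def)
  have s0: "0 \<le> s x" for x using spos[of x] by (cases "x = c") auto
  have xP: "x - c = s x *\<^sub>R (P x - c)" if "x \<noteq> c" for x
    using D[OF that] that by (simp add: s_def P_def)
  have sN: "N x \<bullet> (x - c) = s x" for x
  proof (cases "x = c")
    case False
    have "N x \<bullet> (s x *\<^sub>R (P x - c)) = s x" using conormal_eq[OF c PF[OF False]] False by (simp add: N_def)
    then show ?thesis using xP[OF False] by simp
  qed simp
  have Ns: "N x \<bullet> (y - c) \<le> s y" for x y
  proof (cases "x = c \<or> y = c")
    case True then show ?thesis using s0 by auto
  next
    case False
    have "N x \<bullet> (P y - c) \<le> 1"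
      using conormal_le[OF c PF frontier_closure[OF PF]] False by (simp add: N_def)
    then have "N x \<bullet> (s y *\<^sub>R (P y - c)) \<le> s y" using s0[of y] by (simp add: mult_left_le)
    then show ?thesis using xP[of y] False by simp
  qed
  \<comment> \<open>\<open>N x\<close> is a subgradient of \<open>s\<close> at \<open>x\<close>.
    Used at both \<open>x\<close> and \<open>y\<close>, this squeezes the increment of
    \<open>s\<close>: it gives the Lipschitz bound, and differentiability as soon as
    \<open>N\<close> is known to be continuous.\<close>
  have sub: "N x \<bullet> (y - x) \<le> s y - s x" for x y
    using Ns[of x y] sN[of x] by (simp add: inner_diff_right)
  obtain r where r: "0 < r" "cball c r \<subseteq> \<Omega>" using op c open_contains_cball by blast
  have Nb: "norm (N x) \<le> 1 / r" for x
    using conormal_bound[OF c r PF] r(1) by (cases "x = c") (auto simp: N_def)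
  have lip: "s y - s x \<le> norm (y - x) / r" for x y
  proof -
    have "s y - s x \<le> N y \<bullet> (y - x)" using sub[of y x] by (simp add: inner_diff_right)
    also have "\<dots> \<le> norm (N y) * norm (y - x)" by (rule norm_cauchy_schwarz)
    also have "\<dots> \<le> 1 / r * norm (y - x)" by (intro mult_right_mono Nb) auto
    finally show ?thesis by simp
  qed
  have "(1/r)-lipschitz_on UNIV s"
  proof (rule lipschitz_onI)
    show "dist (s x) (s y) \<le> 1 / r * dist x y" for x y
      using lip[of x y] lip[of y x] by (auto simp: dist_norm norm_minus_commute abs_le_iff)
  qed (use r in simp)
  then have s_cont: "continuous_on UNIV s" by (rule lipschitz_on_continuous_on)
  have P_cont: "continuous_on (- {c}) P"
  proof -
    have "continuous_on (- {c}) (\<lambda>x. c + (x - c) /\<^sub>R s x)"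
      using spos by (intro continuous_intros continuous_on_subset[OF s_cont]) (auto simp: less_le)
    then show ?thesis
      by (rule continuous_on_eq) (use D in \<open>auto simp: P_def s_def\<close>)
  qed
  have N_cont: "continuous_on (- {c}) N"
  proof -
    have "continuous_on (- {c}) (\<lambda>x. conormal c (P x))"
      by (rule continuous_on_compose2[OF continuous_on_conormal[OF c] P_cont]) (use PF in auto)
    then show ?thesis by (rule continuous_on_eq) (auto simp: N_def)
  qed
  have N_at: "isCont N x" if "x \<noteq> c" for x
    using N_cont that by (simp add: continuous_on_eq_continuous_at open_Compl)
  have s_at: "isCont s x" for x
    using s_cont by (simp add: continuous_on_eq_continuous_at)
  have s_der: "(s has_derivative (\<lambda>h. N x \<bullet> h)) (at x)" if ne: "x \<noteq> c" for x
    unfolding has_derivative_at_alt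
  proof (intro conjI allI impI)
    show "bounded_linear (\<lambda>h. N x \<bullet> h)" by (rule bounded_linear_inner_right)
    fix e :: real assume "0 < e"
    then obtain d where d: "d > 0" "\<And>y. dist y x < d \<Longrightarrow> dist (N y) (N x) < e"
      using N_at[OF ne] unfolding continuous_at_eps_delta by blast
    show "\<exists>d>0. \<forall>y. norm (y - x) < d \<longrightarrow> norm (s y - s x - N x \<bullet> (y - x)) \<le> e * norm (y - x)"
    proof (intro exI[of _ d] conjI allI impI d(1))
      fix y assume y: "norm (y - x) < d"
      have "s y - s x - N x \<bullet> (y - x) \<le> (N y - N x) \<bullet> (y - x)"
        using sub[of y x] by (simp add: inner_diff_right inner_diff_left)
      also have "\<dots> \<le> norm (N y - N x) * norm (y - x)" by (rule norm_cauchy_schwarz)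
      also have "\<dots> \<le> e * norm (y - x)"
        using d(2)[of y] y by (intro mult_right_mono) (auto simp: dist_norm)
      finally show "norm (s y - s x - N x \<bullet> (y - x)) \<le> e * norm (y - x)"
        using sub[of x y] by simp
    qed
  qed
  define \<sigma> where "\<sigma> x = (s x)\<^sup>2" for x
  define G where "G x = s x *\<^sub>R N x" for x
  show thesis
  proof
    have "isCont G x" for x
    proof (cases "x = c")
      case False then show ?thesis unfolding G_def by (intro continuous_intros N_at s_at)
    next
      case True
      have "(G \<longlongrightarrow> 0) (at c)"
      proof (rule Lim_null_comparison)
        show "\<forall>\<^sub>F x in at c. norm (G x) \<le> s x * (1 / r)"
          unfolding G_def using s0 Nb by (intro always_eventually allI) (auto intro!: mult_left_mono simp del: times_divide_eq_right)
        have "((\<lambda>x. s x * (1 / r)) \<longlongrightarrow> s c * (1/r)) (at c)"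
          using s_at[of c] by (intro tendsto_intros) (simp add: isCont_def)
        then show "((\<lambda>x. s x * (1 / r)) \<longlongrightarrow> 0) (at c)" by simp
      qed
      then show ?thesis using True by (simp add: isCont_def G_def)
    qed
    then show "continuous_on UNIV G" by (simp add: continuous_at_imp_continuous_on)
    show "(\<sigma> has_derivative (\<lambda>h. (2 *\<^sub>R G x) \<bullet> h)) (at x)" for x
    proof (cases "x = c")
      case False
      show ?thesis unfolding \<sigma>_def G_def
        using s_der[OF False] by (auto intro!: derivative_eq_intros simp: mult_ac)
    next
      case True
      have "(\<sigma> has_derivative (\<lambda>h. 0)) (at c)"
        unfolding has_derivative_at_alt
      proof (intro conjI allI impI)
        fix e :: real assume "0 < e"
        \<comment> \<open>The radius \<open>e * r\<^sup>2\<close> comes from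
          \<open>s y \<le> norm (y - c) / r\<close>, whose square is quadratically small at the
          centre.\<close>
        show "\<exists>d>0. \<forall>y. norm (y - c) < d \<longrightarrow> norm (\<sigma> y - \<sigma> c - 0) \<le> e * norm (y - c)"
        proof (intro exI[of _ "e * r\<^sup>2"] conjI allI impI)
          show "0 < e * r\<^sup>2" using \<open>0 < e\<close> r by simp
          fix y assume y: "norm (y - c) < e * r\<^sup>2"
          have "(s y)\<^sup>2 \<le> (norm (y - c) / r)\<^sup>2" using lip[of y c] s0[of y] by (intro power_mono) auto
          also have "\<dots> = norm (y - c) * (norm (y - c) / r\<^sup>2)" by (simp add: power2_eq_square)
          also have "\<dots> \<le> norm (y - c) * e"
            using y r by (intro mult_left_mono) (auto simp: field_simps)
          finally show "norm (\<sigma> y - \<sigma> c - 0) \<le> e * norm (y - c)" by (simp add: \<sigma>_def mult.commute)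
        qed
      qed simp
      then show ?thesis using True by (simp add: G_def)
    qed
    have in\<Omega>: "x \<in> \<Omega> \<longleftrightarrow> s x < 1" for x
    proof (cases "x = c")
      case False
      have "x \<in> \<Omega>" if "s x < 1"
        using D\<Omega>[OF False, of 1] that D[OF False] False by (simp add: s_def)
      moreover have "s x < 1" if "x \<in> \<Omega>"
      proof (rule ccontr)
        assume "\<not> s x < 1"
        then have "D x \<le> 1" using D[OF False] False by (simp add: s_def field_simps)
        then have "(1 - D x) *\<^sub>R c + D x *\<^sub>R x \<in> \<Omega>"
          using convexD_alt[OF conv c that, of "D x"] D[OF False] by simp
        then have "P x \<in> \<Omega>" by (simp add: P_def algebra_simps)
        with PF[OF False] show False by (simp add: frontier_open_iff[OF op])
      qed
      ultimately show ?thesis by blast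
    qed (use c in simp)
    show "x \<in> \<Omega> \<longleftrightarrow> \<sigma> x < 1" for x
      using in\<Omega>[of x] s0[of x] by (simp add: \<sigma>_def power_less_one_iff abs_square_less_1)
    have incl: "x \<in> closure \<Omega> \<longleftrightarrow> s x \<le> 1" for x
    proof
      assume "x \<in> closure \<Omega>"
      then show "s x \<le> 1"
        using conormal_le[OF c PF, of x x] sN[of x] by (cases "x = c") (auto simp: N_def)
    next
      assume "s x \<le> 1"
      then consider "s x < 1" | "s x = 1" by linarith
      then show "x \<in> closure \<Omega>"
      proof cases
        case 1 then show ?thesis using in\<Omega> closure_subset by blast
      next
        case 2
        then have "x \<noteq> c" by auto
        with xP[OF this] 2 PF[OF this] show ?thesis by (simp add: frontier_closure)
      qed
    qed
    show "x \<in> closure \<Omega> \<longleftrightarrow> \<sigma> x \<le> 1" for x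
      using incl[of x] s0[of x] by (simp add: \<sigma>_def abs_square_le_1)
    show "\<exists>k>0. G p = k *\<^sub>R \<nu> p" if p: "p \<in> frontier \<Omega>" for p
    proof -
      have "s p = 1" using p in\<Omega>[of p] incl[of p] frontier_open_iff[OF op, of p] by auto
      moreover from this have "p \<noteq> c" by auto
      ultimately have "P p = p" using xP[of p] by simp
      with \<open>s p = 1\<close> \<open>p \<noteq> c\<close> show ?thesis
        using \<nu>_center_pos[OF c p] by (intro exI[of _ "inverse (\<nu> p \<bullet> (p - c))"]) (simp add: G_def N_def conormal_def)
    qed
    show "\<sigma> (c + k *\<^sub>R x) = k\<^sup>2 * \<sigma> (c + x)" if k: "0 < k" for k x
    proof -
      have "k * s (c + x) \<le> s (c + k *\<^sub>R x)"
        using Ns[of "c + x" "c + k *\<^sub>R x"] sN[of "c + x"] by simp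
      moreover have "s (c + k *\<^sub>R x) \<le> k * s (c + x)"
        using Ns[of "c + k *\<^sub>R x" "c + x"] sN[of "c + k *\<^sub>R x"] k
        by simp (smt (verit, ccfv_SIG) mult_left_mono)
      ultimately have "s (c + k *\<^sub>R x) = k * s (c + x)" by simp
      then show ?thesis by (simp add: \<sigma>_def power_mult_distrib)
    qed
    show "0 \<le> \<sigma> x" for x by (simp add: \<sigma>_def)
  qed
qed

text \<open>Differentiate \<open>v \<bullet> \<nu> = 0\<close> along a boundary curve with velocity \<open>v p\<close>; the term containing the
  derivative of \<open>\<nu>\<close> has a sign because \<open>\<nu>\<close> is monotone.\<close>

lemma boundary_derivative_sign:
  fixes v :: "real^'n \<Rightarrow> real^'n"
  assumes p: "p \<in> frontier \<Omega>"
    and H: "(v has_derivative H) (at p within closure \<Omega>)"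
    and tan: "\<And>q. q \<in> frontier \<Omega> \<Longrightarrow> v q \<bullet> \<nu> q = 0"
  shows "H (v p) \<bullet> \<nu> p \<le> 0"
proof -
  obtain c where c: "c \<in> \<Omega>" using nonempty by blast
  obtain \<sigma> G where \<sigma>: "\<And>x. (\<sigma> has_derivative (\<lambda>h. (2 *\<^sub>R G x) \<bullet> h)) (at x)"
    "\<And>x. x \<in> \<Omega> \<longleftrightarrow> \<sigma> x < 1" "\<And>x. x \<in> closure \<Omega> \<longleftrightarrow> \<sigma> x \<le> 1"
    "\<And>p. p \<in> frontier \<Omega> \<Longrightarrow> \<exists>k>0. G p = k *\<^sub>R \<nu> p"
    "\<And>x k. 0 < k \<Longrightarrow> \<sigma> (c + k *\<^sub>R x) = k\<^sup>2 * \<sigma> (c + x)" "\<And>x. 0 \<le> \<sigma> x"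
    by (rule square_gauge_exists[OF c]) blast
  have F: "x \<in> frontier \<Omega> \<longleftrightarrow> \<sigma> x = 1" for x
    using \<sigma>(2,3)[of x] by (auto simp: frontier_open_iff[OF op])
  define e where "e = v p"
  define f where "f t = \<sigma> (p + t *\<^sub>R e)" for t :: real
  define T where "T = {t. 0 < f t}"
  \<comment> \<open>The tangent line through \<open>p\<close> is projected radially to the frontier;
    \<open>sqrt (f t)\<close> is the gauge of its point at time \<open>t\<close>.\<close>
  define q where "q t = c + (1 / sqrt (f t)) *\<^sub>R (p + t *\<^sub>R e - c)" for t
  have f0: "f 0 = 1" using F p by (simp add: f_def)
  have "continuous_on UNIV f"
    unfolding f_def
    by (intro continuous_on_compose2[OF has_derivative_continuous_on[of UNIV \<sigma>]] continuous_intros)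
       (use \<sigma>(1) in auto)
  then have T: "open T" "0 \<in> T"
    unfolding T_def using f0 by (auto intro!: open_Collect_less continuous_intros)
  have qF: "q t \<in> frontier \<Omega>" if "t \<in> T" for t
  proof -
    have "\<sigma> (q t) = (1 / sqrt (f t))\<^sup>2 * \<sigma> (c + (p + t *\<^sub>R e - c))"
      unfolding q_def using that by (intro \<sigma>(5)) (simp add: T_def)
    also have "\<dots> = 1" using that by (simp add: T_def power_divide f_def)
    finally show ?thesis by (simp add: F)
  qed
  have q0: "q 0 = p" by (simp add: q_def f0)
  obtain k where k: "G p = k *\<^sub>R \<nu> p" using \<sigma>(4)[OF p] by blast
  have "(f has_real_derivative (2 *\<^sub>R G p) \<bullet> e) (at 0)"
    unfolding f_def by (intro has_derivative_line) (use \<sigma>(1) in simp)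
  \<comment> \<open>The gradient of \<sigma> at \<open>p\<close> is normal and \<open>e\<close> is
    tangential, so the gauge is stationary along the line and the projection leaves the initial
    velocity \<open>e\<close> unchanged.\<close>
  then have fd: "(f has_real_derivative 0) (at 0)"
    using tan[OF p] by (simp add: k e_def inner_commute)
  have "(q has_derivative (\<lambda>t. t *\<^sub>R e)) (at 0)"
  proof -
    have fd': "(f has_derivative (\<lambda>t. 0)) (at 0)"
      by (rule has_derivative_eq_rhs[OF fd[unfolded has_field_derivative_def]]) auto
    show ?thesis unfolding q_def
      by (auto intro!: derivative_eq_intros fd' simp: f0)
  qed
  then have qd: "(q has_derivative (\<lambda>t. t *\<^sub>R e)) (at 0 within T)"
    by (rule has_derivative_at_withinI)
  obtain B where B: "(\<nu> has_derivative B) (at p within frontier \<Omega>)"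
    using \<nu>_differentiable[OF p] by (auto simp: differentiable_def)
  have B': "(\<nu> has_derivative B) (at (q 0) within q ` T)"
    using B qF by (auto simp: q0 intro: has_derivative_subset)
  have H': "(v has_derivative H) (at (q 0) within q ` T)"
    using H qF frontier_closure by (auto simp: q0 intro: has_derivative_subset)
  have lin: "linear B" "linear H" using B H has_derivative_linear by blast+
  have \<nu>q: "((\<lambda>t. \<nu> (q t)) has_derivative (\<lambda>t. t *\<^sub>R B e)) (at 0)"
    using diff_chain_within[OF qd B'] at_within_open[OF T(2,1)]
    by (simp add: o_def linear_scale[OF lin(1)])
  have vq: "((\<lambda>t. v (q t)) has_derivative (\<lambda>t. t *\<^sub>R H e)) (at 0)"
    using diff_chain_within[OF qd H'] at_within_open[OF T(2,1)]
    by (simp add: o_def linear_scale[OF lin(2)])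
  have "((\<lambda>t. v (q t) \<bullet> \<nu> (q t)) has_derivative (\<lambda>t. v (q 0) \<bullet> (t *\<^sub>R B e) + (t *\<^sub>R H e) \<bullet> \<nu> (q 0))) (at 0)"
    by (rule has_derivative_inner[OF vq \<nu>q])
  moreover have "((\<lambda>t. v (q t) \<bullet> \<nu> (q t)) has_derivative (\<lambda>t. 0)) (at 0)"
    by (rule has_derivative_transform_within_open[OF has_derivative_const[of 0] T])
       (use qF tan in auto)
  ultimately have "(\<lambda>t. v (q 0) \<bullet> (t *\<^sub>R B e) + (t *\<^sub>R H e) \<bullet> \<nu> (q 0)) = (\<lambda>t. 0)"
    by (rule has_derivative_unique)
  from fun_cong[OF this, of 1] have sum0: "e \<bullet> B e + H e \<bullet> \<nu> p = 0"
    by (simp add: q0 e_def)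
  have Dq: "((\<lambda>t. (q t - p) /\<^sub>R t) \<longlongrightarrow> e) (at 0)"
    using has_derivative_scaleR_tendsto[OF \<open>(q has_derivative (\<lambda>t. t *\<^sub>R e)) (at 0)\<close>] by (simp add: q0)
  have D\<nu>: "((\<lambda>t. (\<nu> (q t) - \<nu> p) /\<^sub>R t) \<longlongrightarrow> B e) (at 0)"
    using has_derivative_scaleR_tendsto[OF \<nu>q] by (simp add: q0)
  have "((\<lambda>t. ((q t - p) /\<^sub>R t) \<bullet> ((\<nu> (q t) - \<nu> p) /\<^sub>R t)) \<longlongrightarrow> e \<bullet> B e) (at 0)"
    by (intro tendsto_inner Dq D\<nu>)
  moreover have "\<forall>\<^sub>F t in at 0. 0 \<le> ((q t - p) /\<^sub>R t) \<bullet> ((\<nu> (q t) - \<nu> p) /\<^sub>R t)"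
  proof -
    have "\<forall>\<^sub>F t in at 0. t \<in> T" using T by (meson eventually_at_topological)
    then show ?thesis
    proof eventually_elim
      case (elim t)
      have "((q t - p) /\<^sub>R t) \<bullet> ((\<nu> (q t) - \<nu> p) /\<^sub>R t)
            = ((q t - p) \<bullet> (\<nu> (q t) - \<nu> p)) * (inverse t)\<^sup>2"
        by (simp add: power2_eq_square)
      also have "0 \<le> \<dots>" using \<nu>_monotone[OF p qF[OF elim]] by (intro mult_nonneg_nonneg) auto
      finally show ?case .
    qed
  qed
  ultimately have "0 \<le> e \<bullet> B e" by (intro tendsto_lowerbound) auto
  with sum0 show ?thesis by (simp add: e_def)
qed

end

section \<open>Test functions and integrals\<close>

text \<open>Values on the boundary of \<open>\<Omega>\<close> are part of the data here, in contrast to \<open>Ck_closure 1\<close>.\<close>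

definition C1_pair :: "(real^'n::finite) set \<Rightarrow> (real^'n \<Rightarrow> real) \<Rightarrow> (real^'n \<Rightarrow> real^'n) \<Rightarrow> bool" where
  "C1_pair \<Omega> \<phi> g \<longleftrightarrow> continuous_on (closure \<Omega>) \<phi> \<and> continuous_on (closure \<Omega>) g \<and>
     (\<forall>x\<in>\<Omega>. (\<phi> has_derivative (\<lambda>h. g x \<bullet> h)) (at x))"

lemma C1_pairD:
  assumes "C1_pair \<Omega> \<phi> g"
  shows "continuous_on (closure \<Omega>) \<phi>" "continuous_on (closure \<Omega>) g"
    "x \<in> \<Omega> \<Longrightarrow> (\<phi> has_derivative (\<lambda>h. g x \<bullet> h)) (at x)"
  using assms unfolding C1_pair_def by auto

lemma C1_pair_Ck_closure:
  assumes "C1_pair \<Omega> \<phi> g"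
  shows "Ck_closure 1 \<Omega> \<phi>" "x \<in> \<Omega> \<Longrightarrow> gradient \<phi> x = g x"
proof -
  note g = C1_pairD[OF assms]
  show "x \<in> \<Omega> \<Longrightarrow> gradient \<phi> x = g x" using gradient_unique[OF g(3)] .
  have "extends_to_closure \<Omega> \<phi>" using g(1) by (auto simp: extends_to_closure_def)
  moreover have "extends_to_closure \<Omega> (partial i \<phi>)" for i
    unfolding extends_to_closure_def
    by (intro exI[of _ "\<lambda>x. g x $ i"] conjI ballI continuous_intros g(2))
       (simp add: partial_unique[OF g(3)])
  moreover have "\<forall>x\<in>\<Omega>. \<phi> differentiable (at x)" using g(3) by (auto simp: differentiable_def)
  ultimately show "Ck_closure 1 \<Omega> \<phi>" by simp
qed

lemma C1_pair_extension:
  assumes "open \<Omega>" "Ck_closure 1 \<Omega> \<phi>"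
  shows "\<exists>\<psi> g. C1_pair \<Omega> \<psi> g \<and> (\<forall>x\<in>\<Omega>. \<psi> x = \<phi> x \<and> g x = gradient \<phi> x)"
proof -
  have E: "extends_to_closure \<Omega> \<phi>" "\<And>i. extends_to_closure \<Omega> (partial i \<phi>)"
    and D: "\<And>x. x \<in> \<Omega> \<Longrightarrow> \<phi> differentiable (at x)"
    using assms(2) by auto
  obtain \<psi> where \<psi>: "continuous_on (closure \<Omega>) \<psi>" "\<And>x. x \<in> \<Omega> \<Longrightarrow> \<psi> x = \<phi> x"
    using E(1) unfolding extends_to_closure_def by blast
  obtain g where g: "\<And>i. continuous_on (closure \<Omega>) (g i)" "\<And>i x. x \<in> \<Omega> \<Longrightarrow> g i x = partial i \<phi> x"
    using E(2) unfolding extends_to_closure_def by metis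
  define G where "G x = (\<chi> i. g i x)" for x
  have G: "G x = gradient \<phi> x" if "x \<in> \<Omega>" for x using g(2)[OF that] by (simp add: G_def gradient_def)
  have "C1_pair \<Omega> \<psi> G"
    unfolding C1_pair_def
  proof (intro conjI ballI \<psi>(1))
    show "continuous_on (closure \<Omega>) G" unfolding G_def by (intro continuous_on_vec_lambda g(1))
    fix x assume x: "x \<in> \<Omega>"
    show "(\<psi> has_derivative (\<lambda>h. G x \<bullet> h)) (at x)"
      by (rule has_derivative_transform_within_open[OF gradient_has_derivative[OF D[OF x], folded G[OF x]] \<open>open \<Omega>\<close> x])
         (use \<psi>(2) in auto)
  qed
  with \<psi>(2) G show ?thesis by blast
qed

text \<open>On the convex set \<Omega> \<inter> \<open>ball x d\<close> the mean value inequality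
  makes \<phi> minus its candidate linear part Lipschitz with constant \<open>e\<close>, and this
  passes to the closure by continuity. It supplies the derivative of \<open>v\<close> at frontier
  points, where the sign of the boundary term is computed.\<close>

lemma C1_pair_has_derivative_closure:
  assumes "open \<Omega>" "convex \<Omega>" and P: "C1_pair \<Omega> \<phi> g" and x: "x \<in> closure \<Omega>"
  shows "(\<phi> has_derivative (\<lambda>h. g x \<bullet> h)) (at x within closure \<Omega>)"
  unfolding has_derivative_within_alt
proof (intro conjI allI impI)
  show "bounded_linear (\<lambda>h. g x \<bullet> h)" by (rule bounded_linear_inner_right)
  fix e :: real assume "0 < e"
  note g = C1_pairD[OF P]
  obtain d where d: "d > 0" "\<And>y. y \<in> closure \<Omega> \<Longrightarrow> dist y x < d \<Longrightarrow> dist (g y) (g x) < e"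
    using g(2) x \<open>0 < e\<close> unfolding continuous_on_iff by metis
  define S where "S = \<Omega> \<inter> ball x d"
  have S: "convex S" "open S" "S \<subseteq> \<Omega>" using assms by (auto simp: S_def convex_Int)
  define k where "k y = \<phi> y - g x \<bullet> y" for y
  have "e-lipschitz_on S k"
  proof (rule lipschitz_onI)
    fix y z assume yz: "y \<in> S" "z \<in> S"
    have "norm (k y - k z) \<le> e * norm (y - z)"
    proof (rule differentiable_bound[OF S(1) _ _ yz])
      fix w assume w: "w \<in> S"
      then have "w \<in> \<Omega>" using S by blast
      show "(k has_derivative (\<lambda>h. (g w - g x) \<bullet> h)) (at w within S)"
        unfolding k_def inner_diff_left
        by (rule has_derivative_at_withinI)
          (intro has_derivative_diff g(3)[OF \<open>w \<in> \<Omega>\<close>] has_derivative_inner_right has_derivative_ident)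
      have gw: "norm (g w - g x) \<le> e"
        using d(2)[of w] w \<open>w \<in> \<Omega>\<close> closure_subset[of \<Omega>]
        by (auto simp: S_def dist_norm norm_minus_commute)
      show "onorm (\<lambda>h. (g w - g x) \<bullet> h) \<le> e"
      proof (rule onorm_le)
        fix h
        have "norm ((g w - g x) \<bullet> h) \<le> norm (g w - g x) * norm h" by (simp add: Cauchy_Schwarz_ineq2)
        also have "\<dots> \<le> e * norm h"
          by (intro mult_right_mono gw) simp
        finally show "norm ((g w - g x) \<bullet> h) \<le> e * norm h" .
      qed
    qed
    then show "dist (k y) (k z) \<le> e * dist y z" by (simp add: dist_norm)
  qed (use \<open>0 < e\<close> in simp)
  moreover have "continuous_on (closure S) k"
    unfolding k_def using closure_mono[OF S(3)]
    by (intro continuous_intros continuous_on_subset[OF g(1)]) auto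
  ultimately have lip: "e-lipschitz_on (closure S) k" by (rule lipschitz_on_closure)
  have cl: "y \<in> closure S" if "y \<in> closure \<Omega>" "dist y x < d" for y
    using open_Int_closure_subset[of "ball x d" \<Omega>] that by (auto simp: S_def Int_commute dist_commute)
  show "\<exists>d>0. \<forall>y\<in>closure \<Omega>. norm (y - x) < d \<longrightarrow> norm (\<phi> y - \<phi> x - g x \<bullet> (y - x)) \<le> e * norm (y - x)"
  proof (intro exI[of _ d] conjI ballI impI d(1))
    fix y assume y: "y \<in> closure \<Omega>" "norm (y - x) < d"
    have "dist (k y) (k x) \<le> e * dist y x"
      using y x d(1) by (intro lipschitz_onD[OF lip] cl) (auto simp: dist_norm)
    then show "norm (\<phi> y - \<phi> x - g x \<bullet> (y - x)) \<le> e * norm (y - x)"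
      by (simp add: k_def dist_norm algebra_simps)
  qed
qed

section \<open>Integrals of functions continuous up to the boundary\<close>

lemma set_integrable_continuous_closure:
  fixes h :: "real^'n \<Rightarrow> real"
  assumes "open \<Omega>" "bounded \<Omega>" "continuous_on (closure \<Omega>) h"
  shows "set_integrable lebesgue \<Omega> h"
proof -
  have "integrable lborel (\<lambda>x. indicator (closure \<Omega>) x *\<^sub>R h x)"
    using assms by (intro borel_integrable_compact) auto
  then have "set_integrable lebesgue (closure \<Omega>) h"
    unfolding set_integrable_def by (simp add: integrable_completion)
  then show ?thesis
    by (rule set_integrable_subset) (use assms closure_subset in auto)
qed

lemma set_integral_lebesgue_lborel:
  fixes h :: "real^'n \<Rightarrow> real"
  assumes "open \<Omega>" "continuous_on (closure \<Omega>) h"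
  shows "(LINT x:\<Omega>|lebesgue. h x) = (LINT x|lborel. indicator \<Omega> x *\<^sub>R h x)"
  unfolding set_lebesgue_integral_def
  using borel_measurable_continuous_on_indicator[OF _ continuous_on_subset[OF assms(2) closure_subset]] assms(1)
  by (intro integral_completion) simp

text \<open>By continuity a positive value persists, up to a factor 1/2, on a ball of positive
  measure. This is the passage from integral inequalities to pointwise identities.\<close>

lemma set_integral_nonpos_imp_zero:
  fixes h :: "real^'n \<Rightarrow> real"
  assumes "open \<Omega>" "bounded \<Omega>" and h: "continuous_on (closure \<Omega>) h"
    and nonneg: "\<And>x. x \<in> \<Omega> \<Longrightarrow> 0 \<le> h x"
    and int: "(LINT x:\<Omega>|lebesgue. h x) \<le> 0" and x: "x \<in> \<Omega>"
  shows "h x = 0"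
proof (rule ccontr)
  assume "h x \<noteq> 0"
  with nonneg[OF x] have pos: "0 < h x" by simp
  have "continuous_on \<Omega> h" using continuous_on_subset[OF h closure_subset] .
  then have "isCont h x" using x \<open>open \<Omega>\<close> continuous_on_eq_continuous_at by blast
  then obtain d where d: "d > 0" "\<And>y. dist y x < d \<Longrightarrow> dist (h y) (h x) < h x / 2"
    using pos unfolding continuous_at_eps_delta by (meson half_gt_zero)
  obtain r where r: "r > 0" "ball x r \<subseteq> \<Omega>" using x \<open>open \<Omega>\<close> openE by blast
  define B where "B = ball x (min d r)"
  have B: "B \<subseteq> \<Omega>" "\<And>y. y \<in> B \<Longrightarrow> h x / 2 \<le> h y"
    using r d(2) by (auto simp: B_def dist_real_def dist_commute abs_less_iff) (smt (verit) d(2) dist_commute dist_real_def field_sum_of_halves)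
  have Bm: "B \<in> lmeasurable" by (simp add: B_def)
  have iB: "set_integrable lebesgue \<Omega> (\<lambda>y. h x / 2 * indicator B y)"
  proof -
    have "integrable lebesgue (\<lambda>y. h x / 2 * indicator B y)"
      using Bm by (intro integrable_mult_right integrable_real_indicator) (auto simp: fmeasurable_def)
    then show ?thesis unfolding set_integrable_def using \<open>open \<Omega>\<close>
      by (intro integrable_mult_indicator) auto
  qed
  have "(LINT y:\<Omega>|lebesgue. h x / 2 * indicator B y) \<le> (LINT y:\<Omega>|lebesgue. h y)"
    using B nonneg
    by (intro set_integral_mono iB set_integrable_continuous_closure assms) (auto simp: indicator_def)
  moreover have "(LINT y:\<Omega>|lebesgue. h x / 2 * indicator B y) = h x / 2 * measure lebesgue B"
  proof -
    have "(\<lambda>y. indicator \<Omega> y *\<^sub>R (h x / 2 * indicator B y)) = (\<lambda>y. h x / 2 * indicator B y)"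
      using B by (auto simp: indicator_def fun_eq_iff)
    then show ?thesis unfolding set_lebesgue_integral_def by simp
  qed
  moreover have "0 < measure lebesgue B"
    unfolding B_def using content_ball_pos[of "min d r" x] d(1) r(1) by (simp add: measure_completion)
  ultimately show False using int pos by (smt (verit) mult_pos_pos half_gt_zero)
qed

text \<open>A discrete integration by parts. Since \<open>k\<close> is only continuous, its
  difference quotients need not converge; translating the variable moves them onto \<open>F\<close>,
  where they converge to a directional derivative. The support \<open>K\<close> keeps distance
  \<open>d\<close> from the complement of \<Omega>, so the translation produces no boundary
  term.\<close>

lemma translation_quotient_tendsto:
  fixes F k :: "real^'n \<Rightarrow> real" and t :: "nat \<Rightarrow> real"
  assumes \<Omega>: "open \<Omega>" "bounded \<Omega>" and F: "C1_pair \<Omega> F F'"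
    and k: "continuous_on UNIV k" "\<And>x. x \<notin> K \<Longrightarrow> k x = 0" and K: "compact K"
    and d: "\<And>x. x \<in> K \<Longrightarrow> cball x d \<subseteq> \<Omega>"
    and t: "\<And>n. 0 < t n" "\<And>n. t n * norm e \<le> d" "t \<longlonglongrightarrow> 0"
  shows "(\<lambda>n. (LINT x:\<Omega>|lebesgue. F x * ((k (x - t n *\<^sub>R e) - k x) / t n)))
           \<longlonglongrightarrow> (LINT x:\<Omega>|lebesgue. (F' x \<bullet> e) * k x)"
proof -
  note FD = C1_pairD[OF F]
  have d0: "0 \<le> d" using t(1,2)[of 0] by (meson less_imp_le mult_nonneg_nonneg norm_ge_zero order_trans)
  have KO: "K \<subseteq> \<Omega>" using d d0 by fastforce
  have cF: "continuous_on \<Omega> F" using continuous_on_subset[OF FD(1) closure_subset] .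
  have cF': "continuous_on \<Omega> F'" using continuous_on_subset[OF FD(2) closure_subset] .
  have KB [measurable]: "K \<in> sets borel" and OB [measurable]: "\<Omega> \<in> sets borel"
    using K \<Omega> by (auto intro: borel_compact)
  have "bounded (F' ` closure \<Omega>)"
    using compact_imp_bounded[OF compact_continuous_image[OF FD(2)]] \<Omega>(2) by simp
  then obtain M where M: "\<And>x. x \<in> closure \<Omega> \<Longrightarrow> norm (F' x) \<le> M"
    unfolding bounded_iff by blast
  have shiftO: "y + t n *\<^sub>R e \<in> \<Omega>" "norm (F (y + t n *\<^sub>R e) - F y) \<le> M * (t n * norm e)" if "y \<in> K" for y n
  proof -
    have m: "y + t n *\<^sub>R e \<in> cball y d" using t(1,2)[of n] by (simp add: dist_norm less_imp_le)
    then show "y + t n *\<^sub>R e \<in> \<Omega>" using d[OF that] by blast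
    have "norm (F (y + t n *\<^sub>R e) - F y) \<le> M * norm (y + t n *\<^sub>R e - y)"
    proof (rule differentiable_bound[OF convex_cball[of y d] _ _ m])
      show "y \<in> cball y d" using d0 by simp
      fix w assume "w \<in> cball y d"
      then have w: "w \<in> \<Omega>" using d[OF that] by blast
      show "(F has_derivative (\<lambda>h. F' w \<bullet> h)) (at w within cball y d)"
        using FD(3)[OF w] by (rule has_derivative_at_withinI)
      have wc: "w \<in> closure \<Omega>" using w closure_subset by blast
      show "onorm (\<lambda>h. F' w \<bullet> h) \<le> M"
      proof (rule onorm_le)
        fix h
        have "norm (F' w \<bullet> h) \<le> norm (F' w) * norm h" by (simp add: Cauchy_Schwarz_ineq2)
        also have "\<dots> \<le> M * norm h" by (intro mult_right_mono M wc) auto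
        finally show "norm (F' w \<bullet> h) \<le> M * norm h" .
      qed
    qed
    then show "norm (F (y + t n *\<^sub>R e) - F y) \<le> M * (t n * norm e)" using t(1)[of n] by simp
  qed
  \<comment> \<open>The integrand after the translation: the quotient now falls on \<open>F\<close>,
    and the indicator of \<open>K\<close> hides points whose translate may leave \<Omega>.\<close>
  define q where "q n y = indicator K y *\<^sub>R (((F (y + t n *\<^sub>R e) - F y) / t n) * k y)" for n y
  have kK: "continuous_on K k" using k(1) continuous_on_subset by blast
  have int1: "integrable lborel (\<lambda>y. indicator K y *\<^sub>R (F (y + t n *\<^sub>R e) * k y))" for n
    by (rule borel_integrable_compact[OF K])
       (use shiftO in \<open>auto intro!: continuous_intros kK continuous_on_compose2[OF cF]\<close>)
  have int2: "integrable lborel (\<lambda>y. indicator K y *\<^sub>R (F y * k y))"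
    by (rule borel_integrable_compact[OF K])
       (auto intro!: continuous_intros kK continuous_on_subset[OF cF KO])
  have eq: "(LINT x:\<Omega>|lebesgue. F x * ((k (x - t n *\<^sub>R e) - k x) / t n)) = (LINT y|lborel. q n y)" for n
  proof -
    have ck: "continuous_on (closure \<Omega>) (\<lambda>x. k (x - t n *\<^sub>R e))" "continuous_on (closure \<Omega>) k"
      by (auto intro!: continuous_on_compose2[OF k(1)] continuous_intros continuous_on_subset[OF k(1)])
    have "(LINT x:\<Omega>|lebesgue. F x * ((k (x - t n *\<^sub>R e) - k x) / t n))
        = (LINT x:\<Omega>|lebesgue. (F x * k (x - t n *\<^sub>R e) - F x * k x) / t n)"
      by (simp add: algebra_simps diff_divide_distrib)
    also have "\<dots> = ((LINT x:\<Omega>|lebesgue. F x * k (x - t n *\<^sub>R e)) - (LINT x:\<Omega>|lebesgue. F x * k x)) / t n"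
      unfolding set_integral_divide_zero
      by (subst set_integral_diff(2)) (auto intro!: set_integrable_continuous_closure[OF \<Omega>] continuous_intros FD(1) ck)
    also have "(LINT x:\<Omega>|lebesgue. F x * k x) = (LINT y|lborel. indicator K y *\<^sub>R (F y * k y))"
      by (subst set_integral_lebesgue_lborel[OF \<Omega>(1)])
         (use KO k(2) in \<open>auto intro!: Bochner_Integration.integral_cong continuous_intros FD(1) ck simp: indicator_def\<close>)
    also have "(LINT x:\<Omega>|lebesgue. F x * k (x - t n *\<^sub>R e)) = (LINT x|lborel. indicator \<Omega> x *\<^sub>R (F x * k (x - t n *\<^sub>R e)))"
      by (rule set_integral_lebesgue_lborel[OF \<Omega>(1)]) (intro continuous_intros FD(1) ck)
    \<comment> \<open>Translation invariance of Lebesgue measure, that is, the substitution of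
      \<open>t n *\<^sub>R e + y\<close> for \<open>x\<close>.\<close>
    also have "\<dots> = (LINT x|distr lborel borel ((+) (t n *\<^sub>R e)). indicator \<Omega> x *\<^sub>R (F x * k (x - t n *\<^sub>R e)))"
      by (simp add: lborel_distr_plus)
    also have "\<dots> = (LINT y|lborel. indicator \<Omega> (t n *\<^sub>R e + y) *\<^sub>R (F (t n *\<^sub>R e + y) * k (t n *\<^sub>R e + y - t n *\<^sub>R e)))"
    proof (rule integral_distr)
      show "(\<lambda>x. indicator \<Omega> x *\<^sub>R (F x * k (x - t n *\<^sub>R e))) \<in> borel_measurable borel"
        by (rule borel_measurable_continuous_on_indicator[OF OB])
           (intro continuous_intros cF continuous_on_subset[OF ck(1) closure_subset])
    qed simp
    also have "\<dots> = (LINT y|lborel. indicator K y *\<^sub>R (F (y + t n *\<^sub>R e) * k y))"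
      using shiftO(1) k(2) by (intro Bochner_Integration.integral_cong) (auto simp: indicator_def add.commute)
    also have "(\<dots> - (LINT y|lborel. indicator K y *\<^sub>R (F y * k y))) / t n
        = (LINT y|lborel. (indicator K y *\<^sub>R (F (y + t n *\<^sub>R e) * k y) - indicator K y *\<^sub>R (F y * k y)) / t n)"
      using int1 int2 by simp
    also have "\<dots> = (LINT y|lborel. q n y)"
      unfolding q_def by (intro Bochner_Integration.integral_cong) (auto simp: algebra_simps diff_divide_distrib)
    finally show ?thesis .
  qed
  have lim: "(LINT x:\<Omega>|lebesgue. (F' x \<bullet> e) * k x) = (LINT y|lborel. indicator K y *\<^sub>R ((F' y \<bullet> e) * k y))"
    by (subst set_integral_lebesgue_lborel[OF \<Omega>(1)])
       (use KO k(2) in \<open>auto intro!: Bochner_Integration.integral_cong continuous_intros FD(2) continuous_on_subset[OF k(1)] simp: indicator_def\<close>)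
  show ?thesis
    unfolding eq lim
  \<comment> \<open>The quotients of \<open>F\<close> on \<open>K\<close> are bounded by
    \<open>M * norm e\<close>, by the mean value inequality in balls of radius
    \<open>d\<close>.\<close>
  proof (rule integral_dominated_convergence[where w = "\<lambda>y. indicator K y *\<^sub>R (M * norm e * \<bar>k y\<bar>)"])
    show "(\<lambda>y. indicator K y *\<^sub>R ((F' y \<bullet> e) * k y)) \<in> borel_measurable lborel"
      using borel_measurable_continuous_on_indicator[OF KB, of "\<lambda>y. (F' y \<bullet> e) * k y"]
      by (simp add: continuous_intros kK continuous_on_subset[OF cF' KO])
    show "q n \<in> borel_measurable lborel" for n
    proof -
      have "continuous_on K (\<lambda>y. (F (y + t n *\<^sub>R e) - F y) / t n * k y)"
        by (intro continuous_intros kK continuous_on_compose2[OF cF] continuous_on_subset[OF cF KO])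
          (use shiftO(1) t(1)[of n] in auto)
      from borel_measurable_continuous_on_indicator[OF KB this] show ?thesis
        by (simp add: q_def[abs_def])
    qed
    show "integrable lborel (\<lambda>y. indicator K y *\<^sub>R (M * norm e * \<bar>k y\<bar>))"
      by (rule borel_integrable_compact[OF K]) (intro continuous_intros kK)
    show "AE y in lborel. norm (q n y) \<le> indicator K y *\<^sub>R (M * norm e * \<bar>k y\<bar>)" for n
    proof (intro AE_I2)
      fix y
      show "norm (q n y) \<le> indicator K y *\<^sub>R (M * norm e * \<bar>k y\<bar>)"
      proof (cases "y \<in> K")
        case True
        have "\<bar>(F (y + t n *\<^sub>R e) - F y) / t n\<bar> \<le> M * norm e"
          using shiftO(2)[OF True, of n] t(1)[of n] by (simp add: abs_divide field_simps)
        then have "\<bar>(F (y + t n *\<^sub>R e) - F y) / t n\<bar> * \<bar>k y\<bar> \<le> M * norm e * \<bar>k y\<bar>"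
          by (rule mult_right_mono) simp
        then show ?thesis using True by (simp add: q_def abs_mult)
      qed (simp add: q_def)
    qed
    show "AE y in lborel. (\<lambda>n. q n y) \<longlonglongrightarrow> indicator K y *\<^sub>R ((F' y \<bullet> e) * k y)"
    proof (intro AE_I2)
      fix y
      show "(\<lambda>n. q n y) \<longlonglongrightarrow> indicator K y *\<^sub>R ((F' y \<bullet> e) * k y)"
      proof (cases "y \<in> K")
        case True
        have "((\<lambda>s. F (y + s *\<^sub>R e)) has_real_derivative F' y \<bullet> e) (at 0)"
          by (rule has_derivative_line) (use True KO FD(3) in auto)
        then have "((\<lambda>s. (F (y + s *\<^sub>R e) - F y) / s) \<longlongrightarrow> F' y \<bullet> e) (at 0)"
          by (simp add: has_field_derivative_iff)
        moreover have "filterlim t (at 0) sequentially"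
          using t(1,3) by (auto simp: filterlim_at less_le eventually_sequentially)
        ultimately have "(\<lambda>n. (F (y + t n *\<^sub>R e) - F y) / t n) \<longlonglongrightarrow> F' y \<bullet> e"
          by (rule filterlim_compose)
        then show ?thesis unfolding q_def by (intro tendsto_intros)
      qed (simp add: q_def)
    qed
  qed
qed

section \<open>Normal flux and boundary layers\<close>

definition pos_square :: "real \<Rightarrow> real" where
  "pos_square z = (max 0 z)\<^sup>2"

lemma pos_square_has_derivative: "(pos_square has_real_derivative 2 * max 0 z) (at z)"
proof -
  consider "z > 0" | "z < 0" | "z = 0" by linarith
  then show ?thesis
  proof cases
    case 1
    have "((\<lambda>z. z\<^sup>2) has_real_derivative 2 * max 0 z) (at z)"
      using 1 by (auto intro!: derivative_eq_intros)
    then show ?thesis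
      by (rule has_field_derivative_transform_within_open[where S = "{0<..}"]) (use 1 in \<open>auto simp: pos_square_def\<close>)
  next
    case 2
    have "((\<lambda>z. 0) has_real_derivative 2 * max 0 z) (at z)"
      using 2 by (auto intro!: derivative_eq_intros)
    then show ?thesis
      by (rule has_field_derivative_transform_within_open[where S = "{..<0}"]) (use 2 in \<open>auto simp: pos_square_def\<close>)
  next
    case 3
    have "((\<lambda>h. (pos_square (0 + h) - pos_square 0) / h) \<longlongrightarrow> 0) (at 0)"
    proof (rule Lim_null_comparison)
      show "\<forall>\<^sub>F h in at 0. norm ((pos_square (0 + h) - pos_square 0) / h) \<le> \<bar>h\<bar>"
        by (intro always_eventually) (auto simp: pos_square_def max_def power2_eq_square)
      show "((\<lambda>h::real. \<bar>h\<bar>) \<longlongrightarrow> 0) (at 0)" by (auto intro!: tendsto_eq_intros)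
    qed
    then show ?thesis using 3 by (simp add: DERIV_def)
  qed
qed

lemma continuous_on_pos_square [continuous_intros]:
  "continuous_on S h \<Longrightarrow> continuous_on S (\<lambda>x. pos_square (h x))"
  unfolding pos_square_def by (intro continuous_intros)

text \<open>A C^1 transition from 0 on t \<le> 1 to 1 on t \<ge> 2. Squaring the positive part makes
  truncation C^1; the inner truncation produces the flat piece on the left, the outer one the flat
  piece on the right.\<close>

definition cutoff :: "real \<Rightarrow> real" where
  "cutoff t = 1 - pos_square (1 - pos_square (t - 1))"

definition cutoff' :: "real \<Rightarrow> real" where
  "cutoff' t = 4 * max 0 (1 - pos_square (t - 1)) * max 0 (t - 1)"

lemma cutoff_has_derivative: "(cutoff has_real_derivative cutoff' t) (at t)"
  unfolding cutoff_def[abs_def] cutoff'_def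
  by (auto intro!: derivative_eq_intros DERIV_chain2[OF pos_square_has_derivative])

lemma cutoff_bounds: "0 \<le> cutoff t" "cutoff t \<le> 1" "0 \<le> cutoff' t" "cutoff' t \<le> 4"
proof -
  have *: "0 \<le> pos_square z" for z by (simp add: pos_square_def)
  have "pos_square (1 - pos_square (t - 1)) \<le> 1"
    using *[of "t - 1"] unfolding pos_square_def[of "1 - _"] by (intro power_le_one) auto
  then show "0 \<le> cutoff t" by (simp add: cutoff_def)
  show "cutoff t \<le> 1" "0 \<le> cutoff' t" using * by (simp_all add: cutoff_def cutoff'_def)
  show "cutoff' t \<le> 4"
  proof (cases "t \<le> 2")
    case True
    have "max 0 (1 - pos_square (t - 1)) * max 0 (t - 1) \<le> 1 * 1"
      using *[of "t - 1"] True by (intro mult_mono) auto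
    then show ?thesis by (simp add: cutoff'_def)
  next
    case False
    then have "1 \<le> pos_square (t - 1)" by (simp add: pos_square_def one_le_power)
    then show ?thesis by (simp add: cutoff'_def max_def)
  qed
qed

lemma cutoff_low: "t \<le> 1 \<Longrightarrow> cutoff t = 0" "t \<le> 1 \<Longrightarrow> cutoff' t = 0"
  by (simp_all add: cutoff_def cutoff'_def pos_square_def max_def)

lemma cutoff_high: "2 \<le> t \<Longrightarrow> cutoff t = 1" "2 \<le> t \<Longrightarrow> cutoff' t = 0"
proof -
  assume "2 \<le> t"
  then have "1 \<le> pos_square (t - 1)" by (simp add: pos_square_def one_le_power)
  then show "cutoff t = 1" "cutoff' t = 0"
    by (simp_all add: cutoff_def cutoff'_def pos_square_def[of "1 - _"] max_def)
qed

lemma continuous_on_cutoff: "continuous_on UNIV cutoff" "continuous_on UNIV cutoff'"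
  unfolding cutoff_def[abs_def] cutoff'_def[abs_def] by (intro continuous_intros)+

lemma set_integral_le_layer:
  fixes h :: "real^'n \<Rightarrow> real"
  assumes \<Omega>: "open \<Omega>" "bounded \<Omega>" and h: "continuous_on (closure \<Omega>) h"
    and L: "L \<in> sets lebesgue" "L \<subseteq> \<Omega>"
    and on: "\<And>x. x \<in> L \<Longrightarrow> h x \<le> B" and off: "\<And>x. x \<in> \<Omega> - L \<Longrightarrow> h x \<le> 0"
  shows "(LINT x:\<Omega>|lebesgue. h x) \<le> B * measure lebesgue L"
proof -
  have Lm: "L \<in> lmeasurable"
    by (rule bounded_set_imp_lmeasurable[OF bounded_subset[OF \<Omega>(2) L(2)] L(1)])
  have int: "integrable lebesgue (\<lambda>y. B * indicator L y)"
    using Lm by (intro integrable_mult_right integrable_real_indicator) (auto simp: fmeasurable_def)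
  have eq: "indicator \<Omega> y *\<^sub>R (B * indicator L y) = B * indicator L y" for y
    using L by (auto simp: indicator_def)
  have "(LINT x:\<Omega>|lebesgue. h x) \<le> (LINT x:\<Omega>|lebesgue. B * indicator L x)"
  proof (rule set_integral_mono)
    show "set_integrable lebesgue \<Omega> h" by (rule set_integrable_continuous_closure[OF \<Omega> h])
    show "set_integrable lebesgue \<Omega> (\<lambda>x. B * indicator L x)"
      unfolding set_integrable_def eq by (rule int)
  qed (use on off in \<open>auto simp: indicator_def\<close>)
  also have "\<dots> = B * measure lebesgue L"
    unfolding set_lebesgue_integral_def eq by simp
  finally show ?thesis .
qed

section \<open>Weak equations near the boundary: normal flux and thin layers\<close>

context strictly_convex_domain
begin

text \<open>Test with the squared distance to a hyperplane that cuts off a small cap at \<open>p\<close>: on a cap of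
  height \<open>d\<close> the right-hand side is smaller by a factor \<open>d\<close>.\<close>

lemma normal_flux_nonpos:
  fixes X :: "real^'n \<Rightarrow> real^'n" and F :: "real^'n \<Rightarrow> real"
  assumes X: "continuous_on (closure \<Omega>) X" and F: "continuous_on (closure \<Omega>) F"
    and weak: "\<And>\<phi> g. C1_pair \<Omega> \<phi> g \<Longrightarrow>
       (LINT x:\<Omega>|lebesgue. X x \<bullet> g x) = (LINT x:\<Omega>|lebesgue. F x * \<phi> x)"
    and p: "p \<in> frontier \<Omega>"
  shows "X p \<bullet> \<nu> p \<le> 0"
proof (rule ccontr)
  assume "\<not> X p \<bullet> \<nu> p \<le> 0"
  \<comment> \<open>Half of the supposed positive flux: by continuity
    \<open>X x \<bullet> \<nu> p\<close> stays above \<open>c\<close> near \<open>p\<close>.\<close>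
  define c where "c = (X p \<bullet> \<nu> p) / 2"
  have c: "0 < c" "c < X p \<bullet> \<nu> p" using \<open>\<not> _\<close> by (auto simp: c_def)
  have pc: "p \<in> closure \<Omega>" using frontier_closure[OF p] .
  have "continuous_on (closure \<Omega>) (\<lambda>x. X x \<bullet> \<nu> p)" by (intro continuous_intros X)
  then obtain r where r: "r > 0"
    "\<And>x. x \<in> closure \<Omega> \<Longrightarrow> dist x p < r \<Longrightarrow> dist (X x \<bullet> \<nu> p) (X p \<bullet> \<nu> p) < c"
    using pc c(1) unfolding continuous_on_iff by metis
  have Xc: "c \<le> X x \<bullet> \<nu> p" if "x \<in> closure \<Omega>" "dist x p < r" for x
    using r(2)[OF that] unfolding dist_real_def c_def by linarith
  have "bounded (F ` closure \<Omega>)"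
    using compact_imp_bounded[OF compact_continuous_image[OF F compact_closure_dom]] .
  then obtain M where M: "M > 0" "\<And>x. x \<in> closure \<Omega> \<Longrightarrow> \<bar>F x\<bar> \<le> M"
    unfolding bounded_pos by (auto simp: real_norm_def)
  \<comment> \<open>Strict convexity and compactness: the caps cut off by hyperplanes parallel to
    the supporting one shrink to \<open>p\<close>.\<close>
  have "\<exists>d>0. \<forall>x\<in>closure \<Omega>. - d < \<nu> p \<bullet> (x - p) \<longrightarrow> dist x p < r"
  proof -
    define S where "S = closure \<Omega> \<inter> {x. r \<le> dist x p}"
    have "closed {x. r \<le> dist x p}" by (intro closed_Collect_le continuous_intros)
    then have S: "compact S" unfolding S_def by (rule compact_Int_closed[OF compact_closure_dom])
    show ?thesis
    proof (cases "S = {}")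
      case True
      then have "\<forall>x\<in>closure \<Omega>. dist x p < r" by (auto simp: S_def not_le)
      then show ?thesis by (intro exI[of _ 1]) auto
    next
      case False
      have "continuous_on S (\<lambda>x. \<nu> p \<bullet> (x - p))" by (intro continuous_intros)
      from continuous_attains_sup[OF S False this] obtain z where z: "z \<in> S" "\<And>x. x \<in> S \<Longrightarrow> \<nu> p \<bullet> (x - p) \<le> \<nu> p \<bullet> (z - p)"
        by blast
      have "\<nu> p \<bullet> (z - p) < 0" using z(1) r(1) by (intro \<nu>_strict[OF p]) (auto simp: S_def)
      then show ?thesis using z(2)
        by (intro exI[of _ "- (\<nu> p \<bullet> (z - p))"]) (force simp: S_def not_le)
    qed
  qed
  then obtain d0 where d0: "d0 > 0" "\<And>x. x \<in> closure \<Omega> \<Longrightarrow> - d0 < \<nu> p \<bullet> (x - p) \<Longrightarrow> dist x p < r" by blast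
  \<comment> \<open>On the cap the left integrand is at least \<open>2 * c * \<tau> x\<close>. The
    bound \<open>M * d \<le> c\<close> limits the right one to \<open>c * \<tau> x\<close>, so a
    surplus of \<open>c * \<tau> x\<close> remains.\<close>
  define d where "d = min d0 (c / M)"
  have d: "0 < d" "d \<le> d0" "M * d \<le> c" using d0(1) c M(1) by (auto simp: d_def min_def field_simps)
  define \<tau> where "\<tau> x = max 0 (\<nu> p \<bullet> (x - p) + d)" for x
  define \<phi> where "\<phi> x = pos_square (\<nu> p \<bullet> (x - p) + d)" for x
  define g where "g x = (2 * \<tau> x) *\<^sub>R \<nu> p" for x
  have \<tau>c: "continuous_on S \<tau>" for S unfolding \<tau>_def by (intro continuous_intros)
  have "C1_pair \<Omega> \<phi> g"
    unfolding C1_pair_def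
  proof (intro conjI ballI)
    show "continuous_on (closure \<Omega>) \<phi>" unfolding \<phi>_def by (intro continuous_intros)
    show "continuous_on (closure \<Omega>) g" unfolding g_def by (intro continuous_intros \<tau>c)
    fix x
    have "((\<lambda>x. \<nu> p \<bullet> (x - p) + d) has_derivative (\<lambda>h. \<nu> p \<bullet> h)) (at x)"
      by (auto intro!: derivative_eq_intros)
    from has_derivative_compose[OF this pos_square_has_derivative[unfolded has_field_derivative_def]]
    show "(\<phi> has_derivative (\<lambda>h. g x \<bullet> h)) (at x)" by (simp add: \<phi>_def[abs_def] g_def \<tau>_def)
  qed
  from weak[OF this] have w: "(LINT x:\<Omega>|lebesgue. X x \<bullet> g x) = (LINT x:\<Omega>|lebesgue. F x * \<phi> x)" .
  have \<phi>\<tau>: "\<phi> x = (\<tau> x)\<^sup>2" for x by (simp add: \<phi>_def \<tau>_def pos_square_def)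
  have \<tau>0: "0 \<le> \<tau> x" for x by (simp add: \<tau>_def)
  have i1: "set_integrable lebesgue \<Omega> (\<lambda>x. X x \<bullet> g x)"
    unfolding g_def by (intro set_integrable_continuous_closure[OF op bdd] continuous_intros X \<tau>c)
  have i2: "set_integrable lebesgue \<Omega> (\<lambda>x. F x * \<phi> x)"
    unfolding \<phi>\<tau> by (intro set_integrable_continuous_closure[OF op bdd] continuous_intros F \<tau>c)
  have low: "c * \<tau> x \<le> X x \<bullet> g x - F x * \<phi> x" if x: "x \<in> \<Omega>" for x
  proof (cases "\<tau> x = 0")
    case False
    have xc: "x \<in> closure \<Omega>" using x closure_subset by blast
    have "- d < \<nu> p \<bullet> (x - p)" using False by (simp add: \<tau>_def split: if_splits)
    then have "c \<le> X x \<bullet> \<nu> p" using d by (intro Xc xc d0(2)) auto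
    moreover have "F x * \<tau> x \<le> c"
    proof -
      have "\<tau> x \<le> d" using \<nu>_le[OF p xc] d(1) by (simp add: \<tau>_def)
      then have "\<bar>F x\<bar> * \<tau> x \<le> M * d" using M(2)[OF xc] \<tau>0[of x] M(1) by (intro mult_mono) auto
      moreover have "F x * \<tau> x \<le> \<bar>F x\<bar> * \<tau> x" using \<tau>0[of x] by (intro mult_right_mono) auto
      ultimately show ?thesis using d(3) by linarith
    qed
    ultimately have "c \<le> 2 * (X x \<bullet> \<nu> p) - F x * \<tau> x" by linarith
    then have "\<tau> x * c \<le> \<tau> x * (2 * (X x \<bullet> \<nu> p) - F x * \<tau> x)" using \<tau>0[of x] by (rule mult_left_mono)
    then show ?thesis by (simp add: g_def \<phi>\<tau> power2_eq_square algebra_simps)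
  qed (simp add: g_def \<phi>\<tau>)
  have "(LINT x:\<Omega>|lebesgue. c * \<tau> x) \<le> (LINT x:\<Omega>|lebesgue. X x \<bullet> g x - F x * \<phi> x)"
    by (intro set_integral_mono low set_integral_diff(1) i1 i2 set_integrable_continuous_closure[OF op bdd] continuous_intros \<tau>c)
  also have "\<dots> = 0" using set_integral_diff(2)[OF i1 i2] w by simp
  finally have le0: "(LINT x:\<Omega>|lebesgue. c * \<tau> x) \<le> 0" .
  have z: "c * \<tau> x = 0" if "x \<in> \<Omega>" for x
    by (rule set_integral_nonpos_imp_zero[OF op bdd _ _ le0 that]) (use c(1) \<tau>0 in \<open>auto intro!: continuous_intros \<tau>c\<close>)
  \<comment> \<open>Such a point lies in the open cap because \<open>\<nu> p\<close> is a unit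
    vector; \<tau> is positive there.\<close>
  obtain x where x: "x \<in> \<Omega>" "dist x p < d" using pc d(1) closure_approachable by blast
  have "\<bar>\<nu> p \<bullet> (x - p)\<bar> \<le> norm (\<nu> p) * norm (x - p)" by (rule Cauchy_Schwarz_ineq2)
  then have "\<nu> p \<bullet> (x - p) + d > 0" using x(2) norm_\<nu>[OF p] by (auto simp: dist_norm)
  then show False using z[OF x(1)] c(1) by (simp add: \<tau>_def max_def split: if_splits)
qed

text \<open>The weak equation is invariant under changing the sign of both \<open>X\<close> and
  \<open>F\<close>, so the one-sided bound applies twice.\<close>

lemma normal_flux_zero:
  fixes X :: "real^'n \<Rightarrow> real^'n" and F :: "real^'n \<Rightarrow> real"
  assumes X: "continuous_on (closure \<Omega>) X" and F: "continuous_on (closure \<Omega>) F"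
    and weak: "\<And>\<phi> g. C1_pair \<Omega> \<phi> g \<Longrightarrow>
       (LINT x:\<Omega>|lebesgue. X x \<bullet> g x) = (LINT x:\<Omega>|lebesgue. F x * \<phi> x)"
    and p: "p \<in> frontier \<Omega>"
  shows "X p \<bullet> \<nu> p = 0"
proof (rule antisym)
  show "X p \<bullet> \<nu> p \<le> 0" by (rule normal_flux_nonpos[OF assms])
  have "(- X p) \<bullet> \<nu> p \<le> 0"
    by (rule normal_flux_nonpos[of "\<lambda>x. - X x" "\<lambda>x. - F x"])
       (use X F weak p in \<open>auto intro!: continuous_intros simp: set_lebesgue_integral_def\<close>)
  then show "0 \<le> X p \<bullet> \<nu> p" by simp
qed

text \<open>By homogeneity the copy of \<Omega> shrunk about \<open>c\<close> by the factor 1 -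
  2\<delta> avoids the layer, so the layer has at most the volume lost in shrinking; Bernoulli's
  inequality makes this linear in \<delta>.\<close>

lemma layer_measure:
  fixes \<sigma> :: "real^'n \<Rightarrow> real"
  assumes c: "c \<in> \<Omega>" and in\<Omega>: "\<And>x. x \<in> \<Omega> \<longleftrightarrow> \<sigma> x < 1"
    and hom: "\<And>x k. 0 < k \<Longrightarrow> \<sigma> (c + k *\<^sub>R x) = k\<^sup>2 * \<sigma> (c + x)"
    and L: "{x \<in> \<Omega>. 1 - 2 * \<delta> \<le> \<sigma> x} \<in> sets lebesgue" and \<delta>: "0 < \<delta>" "\<delta> < 1/2"
  shows "measure lebesgue {x \<in> \<Omega>. 1 - 2 * \<delta> \<le> \<sigma> x} \<le> 2 * real CARD('n) * measure lebesgue \<Omega> * \<delta>"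
proof -
  define \<theta> where "\<theta> = 1 - 2 * \<delta>"
  have \<theta>: "0 < \<theta>" "\<theta> < 1" using \<delta> by (auto simp: \<theta>_def)
  define T where "T = (\<lambda>x. \<theta> *\<^sub>R x + (c - \<theta> *\<^sub>R c)) ` \<Omega>"
  have \<Omega>m: "\<Omega> \<in> lmeasurable" using op bdd by (simp add: bounded_set_imp_lmeasurable)
  have Tm: "measure lebesgue T = \<theta> ^ CARD('n) * measure lebesgue \<Omega>"
    unfolding T_def using measure_lebesgue_affine[of \<theta> "c - \<theta> *\<^sub>R c" \<Omega>] \<theta> by simp
  have "open T"
    unfolding T_def using open_affinity[OF op, of \<theta> "c - \<theta> *\<^sub>R c"] \<theta> by (simp add: add.commute)
  then have Ts: "T \<in> sets lebesgue" by simp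
  have \<sigma>T: "\<sigma> x < \<theta>" if xT: "x \<in> T" for x
  proof -
    obtain y where "y \<in> \<Omega>" "x = \<theta> *\<^sub>R y + (c - \<theta> *\<^sub>R c)" using xT unfolding T_def by blast
    then have y: "y \<in> \<Omega>" "x = c + \<theta> *\<^sub>R (y - c)" by (simp_all add: algebra_simps)
    have "\<sigma> x = \<theta>\<^sup>2 * \<sigma> y" using hom[OF \<theta>(1), of "y - c"] y(2) by simp
    also have "\<dots> < \<theta>\<^sup>2 * 1" using in\<Omega>[of y] y(1) \<theta> by (intro mult_strict_left_mono) auto
    also have "\<dots> \<le> \<theta>" using \<theta> by (simp add: power2_eq_square mult_left_le)
    finally show ?thesis .
  qed
  have TO: "T \<subseteq> \<Omega>" using \<sigma>T \<theta> in\<Omega> by force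
  have "measure lebesgue {x \<in> \<Omega>. 1 - 2 * \<delta> \<le> \<sigma> x} \<le> measure lebesgue (\<Omega> - T)"
  proof (rule measure_mono_fmeasurable[OF _ L])
    show "{x \<in> \<Omega>. 1 - 2 * \<delta> \<le> \<sigma> x} \<subseteq> \<Omega> - T" using \<sigma>T by (force simp: \<theta>_def)
    show "\<Omega> - T \<in> lmeasurable"
      using Ts op by (intro bounded_set_imp_lmeasurable bounded_subset[OF bdd] sets.Diff) auto
  qed
  also have "\<dots> = measure lebesgue \<Omega> - measure lebesgue T"
    using \<Omega>m Ts TO by (intro measurable_measure_Diff) auto
  also have "\<dots> = (1 - \<theta> ^ CARD('n)) * measure lebesgue \<Omega>" by (simp add: Tm algebra_simps)
  also have "\<dots> \<le> (2 * real CARD('n) * \<delta>) * measure lebesgue \<Omega>"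
  proof (rule mult_right_mono)
    have "1 + real CARD('n) * (- 2 * \<delta>) \<le> (1 + (- 2 * \<delta>)) ^ CARD('n)"
      by (rule Bernoulli_inequality) (use \<delta> in auto)
    then show "1 - \<theta> ^ CARD('n) \<le> 2 * real CARD('n) * \<delta>" by (simp add: \<theta>_def)
  qed simp
  finally show ?thesis by (simp add: mult_ac)
qed

text \<open>The gradient of the cutoff is a nonpositive multiple of \<open>G\<close>, of size
  O(1/\<delta>) and supported in a layer of volume O(\<delta>). Since \<open>W \<bullet> G\<close>
  is at most \<kappa> in a thin enough layer, the right-hand side of \<open>ident\<close> is at most
  a constant times \<kappa>, and \<kappa> is arbitrary. Only an upper bound is obtained, which is
  all that the sign condition can give.\<close>

lemma boundary_layer_limit:
  fixes E :: "real^'n \<Rightarrow> real" and W :: "real^'n \<Rightarrow> real^'n"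
  assumes E: "continuous_on (closure \<Omega>) E" and W: "continuous_on (closure \<Omega>) W"
    and sign: "\<And>p. p \<in> frontier \<Omega> \<Longrightarrow> W p \<bullet> \<nu> p \<le> 0"
    and ident: "\<And>\<eta> g K. (\<And>x. (\<eta> has_derivative (\<lambda>h. g x \<bullet> h)) (at x)) \<Longrightarrow> continuous_on UNIV g \<Longrightarrow>
        compact K \<Longrightarrow> K \<subseteq> \<Omega> \<Longrightarrow> (\<And>x. x \<notin> K \<Longrightarrow> \<eta> x = 0 \<and> g x = 0) \<Longrightarrow>
        (LINT x:\<Omega>|lebesgue. \<eta> x * E x) = - (LINT x:\<Omega>|lebesgue. W x \<bullet> g x)"
  shows "(LINT x:\<Omega>|lebesgue. E x) \<le> 0"
proof -
  obtain c where c: "c \<in> \<Omega>" using nonempty by blast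
  obtain \<sigma> G where Gc: "continuous_on UNIV G"
    and \<sigma>d: "\<And>x. (\<sigma> has_derivative (\<lambda>h. (2 *\<^sub>R G x) \<bullet> h)) (at x)"
    and in\<Omega>: "\<And>x. x \<in> \<Omega> \<longleftrightarrow> \<sigma> x < 1" and incl: "\<And>x. x \<in> closure \<Omega> \<longleftrightarrow> \<sigma> x \<le> 1"
    and G\<nu>: "\<And>p. p \<in> frontier \<Omega> \<Longrightarrow> \<exists>k>0. G p = k *\<^sub>R \<nu> p"
    and hom: "\<And>x k. 0 < k \<Longrightarrow> \<sigma> (c + k *\<^sub>R x) = k\<^sup>2 * \<sigma> (c + x)"
    by (rule square_gauge_exists[OF c]) blast
  have \<sigma>c: "continuous_on S \<sigma>" for S
    by (rule has_derivative_continuous_on) (use \<sigma>d has_derivative_at_withinI in blast)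
  have Gc': "continuous_on S G" for S using Gc continuous_on_subset by blast
  define J where "J = (\<lambda>x. W x \<bullet> G x)"
  have Jc: "continuous_on (closure \<Omega>) J" unfolding J_def by (intro continuous_intros W Gc')
  have Jfr: "J p \<le> 0" if p: "p \<in> frontier \<Omega>" for p
  proof -
    obtain k where "k > 0" "G p = k *\<^sub>R \<nu> p" using G\<nu>[OF p] by blast
    then show ?thesis using sign[OF p] by (simp add: J_def mult_le_0_iff)
  qed
  have "bounded (E ` closure \<Omega>)"
    using compact_imp_bounded[OF compact_continuous_image[OF E compact_closure_dom]] .
  then obtain M where M: "M > 0" "\<And>x. x \<in> closure \<Omega> \<Longrightarrow> \<bar>E x\<bar> \<le> M"
    unfolding bounded_pos by (auto simp: real_norm_def)
  define C where "C = 2 * real CARD('n) * measure lebesgue \<Omega>"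
  have C0: "0 \<le> C" by (simp add: C_def)
  \<comment> \<open>The 8 is 2 from the gradient \<open>2 *\<^sub>R G\<close> of \<sigma> times the
    bound 4 for \<open>cutoff'\<close>; the term \<open>C * M\<close> pays for replacing \<eta> by 1
    in the layer.\<close>
  have key: "(LINT x:\<Omega>|lebesgue. E x) \<le> (8 * C + C * M) * \<kappa>" if \<kappa>: "0 < \<kappa>" for \<kappa>
  proof -
    \<comment> \<open>The points with \<open>J x \<ge> \<kappa>\<close> form a compact set that
      misses the frontier, so \<sigma> stays below 1 on it.\<close>
    have "\<exists>s<1. \<forall>x\<in>closure \<Omega>. s < \<sigma> x \<longrightarrow> J x \<le> \<kappa>"
    proof -
      define S where "S = closure \<Omega> \<inter> J -` {\<kappa>..}"
      have "closed S" unfolding S_def by (rule continuous_closed_preimage[OF Jc]) auto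
      then have S: "compact S"
        using compact_Int_closed[OF compact_closure_dom, of S] by (simp add: S_def Int_assoc[symmetric])
      show ?thesis
      proof (cases "S = {}")
        case True
        then have "\<forall>x\<in>closure \<Omega>. J x \<le> \<kappa>" by (force simp: S_def not_le)
        then show ?thesis by (intro exI[of _ 0]) auto
      next
        case False
        from continuous_attains_sup[OF S False \<sigma>c] obtain z where z: "z \<in> S" "\<And>x. x \<in> S \<Longrightarrow> \<sigma> x \<le> \<sigma> z" by blast
        have "z \<notin> frontier \<Omega>" using Jfr[of z] z(1) \<kappa> by (auto simp: S_def)
        then have "\<sigma> z < 1" using z(1) in\<Omega> by (auto simp: S_def frontier_open_iff[OF op])
        then show ?thesis using z(2) by (intro exI[of _ "\<sigma> z"]) (force simp: S_def not_le)
      qed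
    qed
    then obtain s where s: "s < 1" "\<And>x. x \<in> closure \<Omega> \<Longrightarrow> s < \<sigma> x \<Longrightarrow> J x \<le> \<kappa>" by blast
    \<comment> \<open>The three bounds give in turn \<open>\<delta> \<le> \<kappa>\<close> for the
      error term, \<open>\<delta> < 1/2\<close> for the volume estimate, and a layer contained in
      the region \<open>s < \<sigma> x\<close>.\<close>
    define \<delta> where "\<delta> = min \<kappa> (min (1/4) ((1 - s) / 4))"
    have \<delta>: "0 < \<delta>" "\<delta> < 1/2" "\<delta> \<le> \<kappa>" "s < 1 - 2 * \<delta>"
      using \<kappa> s(1) by (auto simp: \<delta>_def min_def field_simps)
    \<comment> \<open>\<eta> vanishes where \<sigma> \<ge> 1 - \<delta> and equals 1 where \<sigma>
      \<le> 1 - 2\<delta>, so it has compact support in \<Omega> and varies only in the layer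
      \<open>L\<close>.\<close>
    define \<eta> where "\<eta> x = cutoff ((1 - \<sigma> x) / \<delta>)" for x
    define g where "g x = (- 2 * cutoff' ((1 - \<sigma> x) / \<delta>) / \<delta>) *\<^sub>R G x" for x
    define L where "L = {x \<in> \<Omega>. 1 - 2 * \<delta> \<le> \<sigma> x}"
    have argc: "continuous_on S (\<lambda>x. (1 - \<sigma> x) / \<delta>)" for S
      using \<delta> by (intro continuous_intros \<sigma>c) auto
    have \<eta>c: "continuous_on S \<eta>" for S
      unfolding \<eta>_def by (rule continuous_on_compose2[OF continuous_on_cutoff(1) argc]) simp
    have gc: "continuous_on S g" for S
      unfolding g_def using \<delta>
      by (intro continuous_intros Gc' continuous_on_compose2[OF continuous_on_cutoff(2) argc]) auto
    have \<eta>d: "(\<eta> has_derivative (\<lambda>h. g x \<bullet> h)) (at x)" for x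
    proof -
      have "((\<lambda>x. (1 - \<sigma> x) / \<delta>) has_derivative (\<lambda>h. - ((2 *\<^sub>R G x) \<bullet> h) / \<delta>)) (at x)"
        using \<delta> by (auto intro!: derivative_eq_intros \<sigma>d)
      from has_derivative_compose[OF this cutoff_has_derivative[unfolded has_field_derivative_def]]
      show ?thesis by (simp add: \<eta>_def[abs_def] g_def mult_ac)
    qed
    define K where "K = closure \<Omega> \<inter> \<sigma> -` {..1 - \<delta>}"
    have "closed K" unfolding K_def by (rule continuous_closed_preimage[OF \<sigma>c]) auto
    then have K: "compact K"
      using compact_Int_closed[OF compact_closure_dom, of K] by (simp add: K_def Int_assoc[symmetric])
    have KO: "K \<subseteq> \<Omega>" using in\<Omega> \<delta>(1) by (force simp: K_def)
    have off: "\<eta> x = 0 \<and> g x = 0" if "x \<notin> K" for x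
    proof -
      have "1 - \<delta> \<le> \<sigma> x" using that incl[of x] \<delta>(1) by (auto simp: K_def)
      then have "(1 - \<sigma> x) / \<delta> \<le> 1" using \<delta>(1) by (simp add: field_simps)
      then show ?thesis by (simp add: \<eta>_def g_def cutoff_low)
    qed
    have id: "(LINT x:\<Omega>|lebesgue. \<eta> x * E x) = - (LINT x:\<Omega>|lebesgue. W x \<bullet> g x)"
      by (rule ident[OF \<eta>d gc K KO off])
    have high: "(1 - \<sigma> x) / \<delta> \<ge> 2" if "x \<in> \<Omega> - L" for x
      using that \<delta>(1) by (auto simp: L_def field_simps)
    have LO: "L \<subseteq> \<Omega>" by (auto simp: L_def)
    have "L = \<Omega> \<inter> {x. 1 - 2 * \<delta> \<le> \<sigma> x}" by (auto simp: L_def)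
    moreover have "closed {x. 1 - 2 * \<delta> \<le> \<sigma> x}" by (intro closed_Collect_le continuous_intros \<sigma>c)
    ultimately have Ls: "L \<in> sets lebesgue" using op by auto
    have mL: "measure lebesgue L \<le> C * \<delta>"
      using layer_measure[OF c in\<Omega> hom _ \<delta>(1,2)] Ls by (simp add: L_def C_def)
    have Wg: "- (W x \<bullet> g x) = 2 * cutoff' ((1 - \<sigma> x) / \<delta>) / \<delta> * J x" for x
      by (simp add: g_def J_def)
    have b1: "(LINT x:\<Omega>|lebesgue. - (W x \<bullet> g x)) \<le> (8 / \<delta> * \<kappa>) * measure lebesgue L"
    proof (rule set_integral_le_layer[OF op bdd _ Ls LO])
      show "continuous_on (closure \<Omega>) (\<lambda>x. - (W x \<bullet> g x))" by (intro continuous_intros W gc)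
      show "- (W x \<bullet> g x) \<le> 8 / \<delta> * \<kappa>" if "x \<in> L" for x
      proof -
        have "x \<in> closure \<Omega>" "s < \<sigma> x" using that \<delta>(4) closure_subset by (auto simp: L_def)
        then have "J x \<le> \<kappa>" by (rule s(2))
        then have "2 * cutoff' ((1 - \<sigma> x) / \<delta>) / \<delta> * J x \<le> 2 * cutoff' ((1 - \<sigma> x) / \<delta>) / \<delta> * \<kappa>"
          using cutoff_bounds(3) \<delta>(1) by (intro mult_left_mono) auto
        also have "\<dots> \<le> 8 / \<delta> * \<kappa>"
          using cutoff_bounds(4)[of "(1 - \<sigma> x) / \<delta>"] \<delta>(1) \<kappa> by (intro mult_right_mono divide_right_mono) auto
        finally show ?thesis unfolding Wg .
      qed
      show "- (W x \<bullet> g x) \<le> 0" if "x \<in> \<Omega> - L" for x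
        unfolding Wg using cutoff_high(2)[OF high[OF that]] by simp
    qed
    have b2: "(LINT x:\<Omega>|lebesgue. (1 - \<eta> x) * E x) \<le> M * measure lebesgue L"
    proof (rule set_integral_le_layer[OF op bdd _ Ls LO])
      show "continuous_on (closure \<Omega>) (\<lambda>x. (1 - \<eta> x) * E x)" by (intro continuous_intros E \<eta>c)
      show "(1 - \<eta> x) * E x \<le> M" if "x \<in> L" for x
      proof -
        have xc: "x \<in> closure \<Omega>" using that closure_subset by (auto simp: L_def)
        have "(1 - \<eta> x) * E x \<le> (1 - \<eta> x) * M"
          using M(2)[OF xc] cutoff_bounds(2)[of "(1 - \<sigma> x) / \<delta>"]
          by (intro mult_left_mono) (auto simp: \<eta>_def)
        also have "\<dots> \<le> 1 * M"
          using M(1) cutoff_bounds(1)[of "(1 - \<sigma> x) / \<delta>"] by (intro mult_right_mono) (auto simp: \<eta>_def)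
        finally show ?thesis by simp
      qed
      show "(1 - \<eta> x) * E x \<le> 0" if "x \<in> \<Omega> - L" for x
        unfolding \<eta>_def using cutoff_high(1)[OF high[OF that]] by simp
    qed
    have "(LINT x:\<Omega>|lebesgue. E x) = (LINT x:\<Omega>|lebesgue. \<eta> x * E x + (1 - \<eta> x) * E x)"
      by (simp add: algebra_simps)
    also have "\<dots> = (LINT x:\<Omega>|lebesgue. \<eta> x * E x) + (LINT x:\<Omega>|lebesgue. (1 - \<eta> x) * E x)"
      by (intro set_integral_add(2) set_integrable_continuous_closure[OF op bdd] continuous_intros E \<eta>c)
    also have "(LINT x:\<Omega>|lebesgue. \<eta> x * E x) = (LINT x:\<Omega>|lebesgue. - (W x \<bullet> g x))"
      using id by (simp add: set_lebesgue_integral_def)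
    also have "\<dots> + (LINT x:\<Omega>|lebesgue. (1 - \<eta> x) * E x)
        \<le> (8 / \<delta> * \<kappa> + M) * measure lebesgue L"
      using b1 b2 by (simp add: distrib_right)
    also have "\<dots> \<le> (8 / \<delta> * \<kappa> + M) * (C * \<delta>)"
      using mL \<delta>(1) \<kappa> M(1) by (intro mult_left_mono) auto
    also have "\<dots> = 8 * C * \<kappa> + C * M * \<delta>" using \<delta>(1) by (simp add: field_simps)
    also have "\<dots> \<le> 8 * C * \<kappa> + C * M * \<kappa>"
      using \<delta>(3) C0 M(1) by (intro add_left_mono mult_left_mono) auto
    finally show ?thesis by (simp add: algebra_simps)
  qed
  show ?thesis
  proof (rule ccontr)
    assume "\<not> ?thesis"
    then have pos: "0 < (LINT x:\<Omega>|lebesgue. E x)" by simp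
    define B where "B = 8 * C + C * M"
    have B: "0 \<le> B" using C0 M(1) by (simp add: B_def)
    \<comment> \<open>This choice of \<kappa> bounds the positive integral by less than half of
      itself.\<close>
    have "(LINT x:\<Omega>|lebesgue. E x) \<le> B * ((LINT x:\<Omega>|lebesgue. E x) / (2 * (B + 1)))"
      unfolding B_def by (rule key) (use pos C0 M(1) in \<open>auto intro!: divide_pos_pos add_nonneg_pos\<close>)
    also have "\<dots> = (LINT x:\<Omega>|lebesgue. E x) * (B / (2 * (B + 1)))" by simp
    also have "\<dots> < (LINT x:\<Omega>|lebesgue. E x) * 1"
      using pos B by (intro mult_strict_left_mono) (auto simp: field_simps)
    finally show False by simp
  qed
qed

end

section \<open>The flux and its linearization\<close>

lemma A_matrix_component:
  "A_matrix a \<xi> $ h $ k = deriv a (norm \<xi>) / norm \<xi> * \<xi> $ h * \<xi> $ k + a (norm \<xi>) * (if h = k then 1 else 0)"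
  by (simp add: A_matrix_def mat_def)

lemma A_matrix_mult:
  "A_matrix a \<xi> *v h = a (norm \<xi>) *\<^sub>R h + (deriv a (norm \<xi>) / norm \<xi> * (\<xi> \<bullet> h)) *\<^sub>R \<xi>"
proof -
  have "(\<Sum>j\<in>UNIV. (deriv a (norm \<xi>) / norm \<xi> * \<xi> $ i * \<xi> $ j + a (norm \<xi>) * (if i = j then 1 else 0)) * h $ j)
      = a (norm \<xi>) * h $ i + deriv a (norm \<xi>) / norm \<xi> * (\<Sum>j\<in>UNIV. \<xi> $ j * h $ j) * \<xi> $ i" for i
  proof -
    have "(\<Sum>j\<in>UNIV. (deriv a (norm \<xi>) / norm \<xi> * \<xi> $ i * \<xi> $ j + a (norm \<xi>) * (if i = j then 1 else 0)) * h $ j)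
      = (\<Sum>j\<in>UNIV. deriv a (norm \<xi>) / norm \<xi> * \<xi> $ i * (\<xi> $ j * h $ j))
        + (\<Sum>j\<in>UNIV. if i = j then a (norm \<xi>) * h $ j else 0)"
      by (subst sum.distrib[symmetric], rule sum.cong) (auto simp: algebra_simps)
    then show ?thesis by (simp add: sum_distrib_left sum_distrib_right sum_divide_distrib mult_ac)
  qed
  then show ?thesis
    by (simp add: vec_eq_iff matrix_vector_mult_def A_matrix_component inner_vec_def)
qed

lemma A_matrix_inner:
  "(A_matrix a \<xi> *v h) \<bullet> k = a (norm \<xi>) * (h \<bullet> k) + deriv a (norm \<xi>) / norm \<xi> * (\<xi> \<bullet> h) * (\<xi> \<bullet> k)"
  by (simp add: A_matrix_mult inner_add_left)

lemma A_matrix_inner_commute: "(A_matrix a \<xi> *v h) \<bullet> k = (A_matrix a \<xi> *v k) \<bullet> h"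
  unfolding A_matrix_inner by (simp add: inner_commute[of h k] mult_ac)

text \<open>\<open>A_matrix a \<xi>\<close> has the eigenvalue a + a' |\<xi>| along \<xi> and a on
  the orthogonal complement. The bound discards the nonnegative orthogonal part, which is
  Cauchy-Schwarz, and thus brings in the second ellipticity condition.\<close>

lemma A_matrix_lower_bound:
  assumes "\<xi> \<noteq> 0" "a (norm \<xi>) > 0"
  shows "(a (norm \<xi>) + deriv a (norm \<xi>) * norm \<xi>) * (\<xi> \<bullet> h)\<^sup>2 \<le> (norm \<xi>)\<^sup>2 * ((A_matrix a \<xi> *v h) \<bullet> h)"
proof -
  let ?t = "norm \<xi>"
  have t: "?t > 0" using assms by simp
  have "(\<xi> \<bullet> h)\<^sup>2 \<le> ?t\<^sup>2 * (h \<bullet> h)"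
    using Cauchy_Schwarz_ineq[of \<xi> h] by (simp add: power2_norm_eq_inner)
  then have "a ?t * (\<xi> \<bullet> h)\<^sup>2 \<le> a ?t * (?t\<^sup>2 * (h \<bullet> h))" using assms by (intro mult_left_mono) auto
  moreover have "?t\<^sup>2 * ((A_matrix a \<xi> *v h) \<bullet> h) = a ?t * (?t\<^sup>2 * (h \<bullet> h)) + deriv a ?t * ?t * (\<xi> \<bullet> h)\<^sup>2"
    unfolding A_matrix_inner using t by (simp add: field_simps power2_eq_square)
  ultimately show ?thesis by (simp add: algebra_simps)
qed

lemma A_matrix_nonneg:
  assumes "\<xi> \<noteq> 0 \<Longrightarrow> a (norm \<xi>) > 0" "\<xi> \<noteq> 0 \<Longrightarrow> a (norm \<xi>) + deriv a (norm \<xi>) * norm \<xi> > 0"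
    and "\<xi> = 0 \<Longrightarrow> 0 \<le> a 0"
  shows "0 \<le> (A_matrix a \<xi> *v h) \<bullet> h"
proof (cases "\<xi> = 0")
  case True then show ?thesis using assms(3) by (simp add: A_matrix_inner)
next
  case False
  have "0 \<le> (a (norm \<xi>) + deriv a (norm \<xi>) * norm \<xi>) * (\<xi> \<bullet> h)\<^sup>2"
    using assms(2)[OF False] by simp
  also note A_matrix_lower_bound[where a = a, OF False assms(1)[OF False], of h]
  finally show ?thesis using False by (simp add: zero_le_mult_iff)
qed

text \<open>The lower bound first forces \<open>h\<close> to be orthogonal to \<xi>; on such vectors
  the form is a(|\<xi>|) |h|^2.\<close>

lemma A_matrix_definite:
  assumes "\<xi> \<noteq> 0" "a (norm \<xi>) > 0" "a (norm \<xi>) + deriv a (norm \<xi>) * norm \<xi> > 0"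
    and "(A_matrix a \<xi> *v h) \<bullet> h = 0"
  shows "h = 0"
proof -
  have "(\<xi> \<bullet> h)\<^sup>2 \<le> 0"
    using A_matrix_lower_bound[where a = a, OF assms(1,2), of h] assms(3,4) by (simp add: mult_le_0_iff)
  then have "\<xi> \<bullet> h = 0" by simp
  then show ?thesis using assms(2,4) by (simp add: A_matrix_inner)
qed

section \<open>Regularity of the flux, including at the origin\<close>

lemma C11_loc_pos_isCont_deriv:
  assumes "C11_loc_pos a" "0 < t"
  shows "isCont (deriv a) t"
proof -
  have "compact {t/2..2*t} \<and> {t/2..2*t} \<subseteq> {0<..}" using assms(2) by auto
  then obtain L where "L-lipschitz_on {t/2..2*t} (deriv a)"
    using assms(1) unfolding C11_loc_pos_def by blast
  then have "continuous_on {t/2..2*t} (deriv a)" by (rule lipschitz_on_continuous_on)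
  then show ?thesis
    by (rule continuous_on_interior) (use assms(2) in auto)
qed

lemma C11_loc_pos_DERIV:
  assumes "C11_loc_pos a" "0 < t"
  shows "(a has_real_derivative deriv a t) (at t)"
  using assms unfolding C11_loc_pos_def by (simp add: DERIV_deriv_iff_real_differentiable)

text \<open>The derivative of t a(t) is a(t) + t a'(t) for t > 0. It is continuous at 0, with value
  the limit of t a(t) / t, namely a(0), so the second summand must vanish in the limit.\<close>

lemma condition_A2_limit:
  assumes "C11_loc_pos a" "condition_A2 a"
  shows "((\<lambda>t. deriv a t * t) \<longlongrightarrow> 0) (at_right 0)"
proof -
  have ca: "continuous_on {0..} a" using assms(2) by (simp add: condition_A2_def)
  obtain g where g: "continuous_on {0..} g"
    "\<And>t. t \<ge> 0 \<Longrightarrow> ((\<lambda>t. t * a t) has_real_derivative g t) (at t within {0..})"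
    using assms(2) unfolding condition_A2_def C1_halfline_def by blast
  have a0: "(a \<longlongrightarrow> a 0) (at_right 0)" and g0: "(g \<longlongrightarrow> g 0) (at_right 0)"
    using ca g(1) by (auto simp: continuous_on_def intro: tendsto_within_subset)
  have "((\<lambda>t. t * a t) has_real_derivative g 0) (at 0 within {0<..})"
    using g(2)[of 0] by (auto intro: has_field_derivative_subset)
  then have "((\<lambda>t. t * a t / t) \<longlongrightarrow> g 0) (at_right 0)"
    by (simp add: has_field_derivative_iff)
  moreover have "\<forall>\<^sub>F t in at_right 0. t * a t / t = a t"
    by (auto simp: eventually_at_filter)
  ultimately have "(a \<longlongrightarrow> g 0) (at_right 0)" by (rule Lim_transform_eventually)
  then have ga: "g 0 = a 0" using a0 tendsto_unique trivial_limit_at_right_real by blast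
  have gt: "g t - a t = deriv a t * t" if t: "0 < t" for t
  proof -
    have "((\<lambda>t. t * a t) has_real_derivative g t) (at t within {0<..})"
      using g(2)[of t] t by (auto intro: has_field_derivative_subset)
    then have 1: "((\<lambda>t. t * a t) has_real_derivative g t) (at t)"
      using t by (simp add: at_within_open[of t "{0<..}"])
    have 2: "((\<lambda>t. t * a t) has_real_derivative 1 * a t + deriv a t * t) (at t)"
      by (intro DERIV_mult DERIV_ident C11_loc_pos_DERIV assms t)
    show ?thesis using DERIV_unique[OF 1 2] by simp
  qed
  have "((\<lambda>t. g t - a t) \<longlongrightarrow> g 0 - a 0) (at_right 0)" by (intro tendsto_intros g0 a0)
  then have "((\<lambda>t. g t - a t) \<longlongrightarrow> 0) (at_right 0)" by (simp add: ga)
  moreover have "\<forall>\<^sub>F t in at_right 0. g t - a t = deriv a t * t"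
    by (auto simp: eventually_at_filter gt)
  ultimately show ?thesis by (rule Lim_transform_eventually)
qed

text \<open>Under (A1) the origin is excluded from \<open>D\<close>, under (A2) it may belong to \<open>D\<close>.\<close>

definition flux_domain :: "(real \<Rightarrow> real) \<Rightarrow> (real^'n::finite) set \<Rightarrow> bool" where
  "flux_domain a D \<longleftrightarrow> (0 \<in> D \<longrightarrow> condition_A2 a)"

context
  fixes a :: "real \<Rightarrow> real" and D :: "(real^'n::finite) set"
  assumes a: "C11_loc_pos a" "\<And>t. t > 0 \<Longrightarrow> a t > 0" and D: "flux_domain a D"
begin

lemma norm_tendsto_at_right: "filterlim norm (at_right 0) (at (0::real^'n))"
  unfolding filterlim_at
  by (auto simp: eventually_at_filter intro!: tendsto_eq_intros)

lemma flux_zero_limit: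
  assumes "0 \<in> D"
  shows "((\<lambda>\<xi>::real^'n. a (norm \<xi>)) \<longlongrightarrow> a 0) (at 0)"
proof -
  have "continuous_on {0..} a" using D assms by (simp add: flux_domain_def condition_A2_def)
  then have "(a \<longlongrightarrow> a 0) (at_right 0)"
    by (auto simp: continuous_on_def intro: tendsto_within_subset)
  from filterlim_compose[OF this norm_tendsto_at_right] show ?thesis .
qed

lemma flux_zero_nonneg:
  assumes "0 \<in> D"
  shows "0 \<le> a 0"
proof -
  have "continuous_on {0..} a" using D assms by (simp add: flux_domain_def condition_A2_def)
  then have "(a \<longlongrightarrow> a 0) (at_right 0)"
    by (auto simp: continuous_on_def intro: tendsto_within_subset)
  then show ?thesis
    by (rule tendsto_lowerbound) (auto simp: eventually_at_filter less_imp_le a(2))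
qed

lemma isCont_a_norm:
  assumes "\<xi> \<in> D"
  shows "isCont (\<lambda>\<xi>. a (norm \<xi>)) \<xi>"
proof (cases "\<xi> = 0")
  case True
  then show ?thesis using flux_zero_limit assms by (simp add: isCont_def)
next
  case False
  have "isCont a (norm \<xi>)" using DERIV_isCont[OF C11_loc_pos_DERIV[OF a(1)]] False by simp
  then show ?thesis by (intro continuous_intros isCont_o2[where f = norm and g = a]) auto
qed

text \<open>Only the origin is delicate: there the rank-one part is dominated by |a'(|\<xi>|)|
  |\<xi>|, which tends to 0 under (A2).\<close>

lemma isCont_A_matrix:
  assumes "\<xi> \<in> D"
  shows "isCont (\<lambda>\<xi>. A_matrix a \<xi> $ h $ k) \<xi>"
proof -
  have c1: "isCont (\<lambda>\<xi>. deriv a (norm \<xi>) / norm \<xi> * \<xi> $ h * \<xi> $ k) \<xi>"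
  proof (cases "\<xi> = 0")
    case True
    have A2: "condition_A2 a" using D assms True by (simp add: flux_domain_def)
    have "((\<lambda>\<xi>::real^'n. deriv a (norm \<xi>) * norm \<xi>) \<longlongrightarrow> 0) (at 0)"
      using filterlim_compose[OF condition_A2_limit[OF a(1) A2] norm_tendsto_at_right] .
    then have lim: "((\<lambda>\<xi>::real^'n. \<bar>deriv a (norm \<xi>) * norm \<xi>\<bar>) \<longlongrightarrow> 0) (at 0)"
      by (rule tendsto_rabs_zero)
    have "((\<lambda>\<xi>. deriv a (norm \<xi>) / norm \<xi> * \<xi> $ h * \<xi> $ k) \<longlongrightarrow> 0) (at 0)"
    proof (rule Lim_null_comparison[OF _ lim], intro always_eventually allI)
      fix \<xi> :: "real^'n"
      show "norm (deriv a (norm \<xi>) / norm \<xi> * \<xi> $ h * \<xi> $ k) \<le> \<bar>deriv a (norm \<xi>) * norm \<xi>\<bar>"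
      proof (cases "\<xi> = 0")
        case False
        have "\<bar>\<xi> $ h\<bar> * \<bar>\<xi> $ k\<bar> \<le> norm \<xi> * norm \<xi>"
          by (intro mult_mono component_le_norm_cart) auto
        then have "\<bar>deriv a (norm \<xi>)\<bar> / norm \<xi> * (\<bar>\<xi> $ h\<bar> * \<bar>\<xi> $ k\<bar>) \<le> \<bar>deriv a (norm \<xi>)\<bar> / norm \<xi> * (norm \<xi> * norm \<xi>)"
          by (intro mult_left_mono) auto
        also have "\<dots> = \<bar>deriv a (norm \<xi>) * norm \<xi>\<bar>" using False by (simp add: abs_mult)
        finally show ?thesis by (simp add: abs_mult mult_ac)
      qed simp
    qed
    then show ?thesis using True by (simp add: isCont_def)
  next
    case False
    have "isCont (deriv a) (norm \<xi>)" using C11_loc_pos_isCont_deriv[OF a(1)] False by simp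
    then have "isCont (\<lambda>\<xi>. deriv a (norm \<xi>)) \<xi>"
      by (intro isCont_o2[where f = norm and g = "deriv a"]) auto
    then show ?thesis using False by (intro continuous_intros) auto
  qed
  have c2: "isCont (\<lambda>\<xi>. a (norm \<xi>) * (if h = k then 1 else 0)) \<xi>"
    by (intro continuous_mult isCont_a_norm assms continuous_const)
  show ?thesis unfolding A_matrix_component by (rule continuous_add[OF c1 c2])
qed

lemma continuous_on_flux:
  assumes "continuous_on S v" "v ` S \<subseteq> D"
  shows "continuous_on S (\<lambda>x. a (norm (v x)))"
proof -
  have "continuous_on D (\<lambda>\<xi>. a (norm \<xi>))"
    using isCont_a_norm by (simp add: continuous_at_imp_continuous_on)
  from continuous_on_compose2[OF this assms] show ?thesis .
qed

lemma continuous_on_A_matrix_mult: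
  assumes "continuous_on S v" "v ` S \<subseteq> D" "continuous_on S w"
  shows "continuous_on S (\<lambda>x. A_matrix a (v x) *v w x)"
proof -
  have "continuous_on D (\<lambda>\<xi>. A_matrix a \<xi> $ h $ k)" for h k
    using isCont_A_matrix by (simp add: continuous_at_imp_continuous_on)
  from continuous_on_compose2[OF this assms(1,2)]
  have cA: "continuous_on S (\<lambda>x. A_matrix a (v x) $ h $ k)" for h k .
  show ?thesis
    unfolding matrix_vector_mult_def
    by (intro continuous_on_vec_lambda continuous_on_sum continuous_on_mult cA continuous_on_component assms(3))
qed

text \<open>Identifies A as the Jacobian of the flux, so that the differentiated weak equation and
  the stability inequality involve the same quadratic form. At the origin the remainder is (a(|h|) -
  a(0)) h, hence o(|h|).\<close>

lemma flux_has_derivative: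
  assumes "\<xi> \<in> D"
  shows "((\<lambda>\<xi>. a (norm \<xi>) *\<^sub>R \<xi>) has_derivative (\<lambda>h. A_matrix a \<xi> *v h)) (at \<xi>)"
proof (cases "\<xi> = 0")
  case True
  have "((\<lambda>h. norm (a (norm (0 + h)) *\<^sub>R (0 + h) - a (norm (0::real^'n)) *\<^sub>R 0 - a 0 *\<^sub>R h) / norm h) \<longlongrightarrow> 0) (at (0::real^'n))"
  proof (rule Lim_transform_eventually)
    have "((\<lambda>h::real^'n. a (norm h) - a 0) \<longlongrightarrow> a 0 - a 0) (at 0)"
      using flux_zero_limit assms True by (intro tendsto_intros) auto
    then show "((\<lambda>h::real^'n. \<bar>a (norm h) - a 0\<bar>) \<longlongrightarrow> 0) (at 0)"
      by (intro tendsto_rabs_zero) simp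
    have eq: "\<bar>a (norm h) - a 0\<bar> = norm (a (norm (0 + h)) *\<^sub>R (0 + h) - a (norm (0::real^'n)) *\<^sub>R 0 - a 0 *\<^sub>R h) / norm h"
      if "h \<noteq> 0" for h :: "real^'n"
    proof -
      have "a (norm h) *\<^sub>R h - a 0 *\<^sub>R h = (a (norm h) - a 0) *\<^sub>R h" by (simp add: scaleR_diff_left)
      then show ?thesis using that by simp
    qed
    show "\<forall>\<^sub>F h in at (0::real^'n). \<bar>a (norm h) - a 0\<bar> = norm (a (norm (0 + h)) *\<^sub>R (0 + h) - a (norm (0::real^'n)) *\<^sub>R 0 - a 0 *\<^sub>R h) / norm h"
      unfolding eventually_at_filter by (intro always_eventually allI impI eq)
  qed
  then have "((\<lambda>\<xi>. a (norm \<xi>) *\<^sub>R \<xi>) has_derivative (\<lambda>h. a 0 *\<^sub>R h)) (at (0::real^'n))"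
    unfolding has_derivative_at by (simp add: bounded_linear_scaleR_right)
  then show ?thesis using True by (simp add: A_matrix_mult)
next
  case False
  have "(norm has_derivative (\<lambda>h. h \<bullet> sgn \<xi>)) (at \<xi>)"
    using has_derivative_norm[OF False] .
  from has_derivative_compose[OF this C11_loc_pos_DERIV[OF a(1), unfolded has_field_derivative_def]]
  have "((\<lambda>\<xi>. a (norm \<xi>)) has_derivative (\<lambda>h. deriv a (norm \<xi>) * (h \<bullet> sgn \<xi>))) (at \<xi>)"
    using False by simp
  from has_derivative_scaleR[OF this has_derivative_ident]
  show ?thesis
    by (rule has_derivative_eq_rhs)
       (simp add: A_matrix_mult fun_eq_iff sgn_div_norm inner_commute divide_inverse mult_ac)
qed

end

section \<open>Fields with one-dimensional derivative\<close>

lemma gradient_field_has_derivative: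
  fixes v :: "real^'n \<Rightarrow> real^'n"
  assumes "\<And>i. C1_pair \<Omega> (\<lambda>x. v x $ i) (w i)" "x \<in> \<Omega>"
  shows "(v has_derivative (\<lambda>h. \<chi> i. w i x \<bullet> h)) (at x)"
  by (rule vec_has_derivative) (use C1_pairD(3)[OF assms(1) assms(2)] in simp)

lemma gradient_field_continuous:
  fixes v :: "real^'n \<Rightarrow> real^'n"
  assumes "\<And>i. C1_pair \<Omega> (\<lambda>x. v x $ i) (w i)"
  shows "continuous_on (closure \<Omega>) v"
proof -
  have "continuous_on (closure \<Omega>) (\<lambda>x. \<chi> i. v x $ i)"
    by (intro continuous_on_vec_lambda C1_pairD(1)[OF assms])
  then show ?thesis by simp
qed

section \<open>Propagation along hyperplane slices\<close>

context
  fixes \<Omega> :: "(real^'n::finite) set" and v :: "real^'n \<Rightarrow> real^'n" and l :: "real^'n \<Rightarrow> real"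
  assumes \<Omega>: "open \<Omega>" "convex \<Omega>"
    and dv: "\<And>x. x \<in> \<Omega> \<Longrightarrow> v x \<noteq> 0 \<Longrightarrow> (v has_derivative (\<lambda>h. (l x * (v x \<bullet> h)) *\<^sub>R v x)) (at x)"
    and cv: "continuous_on \<Omega> v"
begin

lemma nonvanishing_ball:
  assumes "x \<in> \<Omega>" "v x \<noteq> 0"
  obtains r where "r > 0" "ball x r \<subseteq> \<Omega>" "\<And>y. y \<in> ball x r \<Longrightarrow> v y \<noteq> 0"
proof -
  have "open (\<Omega> \<inter> v -` (- {0}))" by (rule continuous_open_preimage[OF cv \<Omega>(1)]) auto
  moreover have "x \<in> \<Omega> \<inter> v -` (- {0})" using assms by simp
  ultimately obtain r where "r > 0" "ball x r \<subseteq> \<Omega> \<inter> v -` (- {0})" using openE by blast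
  then show thesis by (intro that) auto
qed

text \<open>The derivative of \<open>v\<close> takes values in the line spanned by \<open>v\<close>:
  the length of \<open>v\<close> may change, but the derivative of its direction is zero.\<close>

lemma sgn_constant_on_ball:
  assumes "ball x r \<subseteq> \<Omega>" "\<And>y. y \<in> ball x r \<Longrightarrow> v y \<noteq> 0" "y \<in> ball x r" "z \<in> ball x r"
  shows "sgn (v y) = sgn (v z)"
proof (rule has_derivative_zero_unique[OF convex_ball _ assms(3,4)])
  fix y assume y: "y \<in> ball x r"
  then have y': "y \<in> \<Omega>" "v y \<noteq> 0" using assms by auto
  have D: "(v has_derivative (\<lambda>h. (l y * (v y \<bullet> h)) *\<^sub>R v y)) (at y)" by (rule dv[OF y'])
  have N: "((\<lambda>y. inverse (norm (v y))) has_derivative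
      (\<lambda>h. - (inverse (norm (v y)) * (((l y * (v y \<bullet> h)) *\<^sub>R v y) \<bullet> sgn (v y)) * inverse (norm (v y))))) (at y)"
    using y'(2) by (intro Deriv.has_derivative_inverse has_derivative_compose[OF D has_derivative_norm]) auto
  have "((\<lambda>y. inverse (norm (v y)) *\<^sub>R v y) has_derivative (\<lambda>h. 0)) (at y)"
  proof (rule has_derivative_eq_rhs[OF has_derivative_scaleR[OF N D]], rule ext)
    fix h
    have "v y \<bullet> sgn (v y) = norm (v y)"
      using y'(2) by (simp add: sgn_div_norm dot_square_norm power2_eq_square)
    then show "inverse (norm (v y)) *\<^sub>R (l y * (v y \<bullet> h)) *\<^sub>R v y
       + (- (inverse (norm (v y)) * (((l y * (v y \<bullet> h)) *\<^sub>R v y) \<bullet> sgn (v y)) * inverse (norm (v y)))) *\<^sub>R v y = 0"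
      using y'(2) left_inverse[of "norm (v y)"] by (simp add: mult_ac)
  qed
  then show "((\<lambda>y. sgn (v y)) has_derivative (\<lambda>h. 0)) (at y within ball x r)"
    unfolding sgn_div_norm by (rule has_derivative_at_withinI)
qed

text \<open>Near a point of the slice where \<open>v = v z\<close>, the direction of
  \<open>v\<close> is that of \<open>v z\<close>, so the derivative of \<open>v\<close> along the
  slice vanishes. Hence the set where \<open>v = v z\<close> is open in the slice; it is also closed
  there, and the slice of a convex set is connected. This carries the nonvanishing of
  \<open>v\<close> across the whole slice.\<close>

lemma constant_on_orthogonal_slice:
  assumes z: "z \<in> \<Omega>" "v z \<noteq> 0" and y: "y \<in> \<Omega>" "(y - z) \<bullet> v z = 0"
  shows "v y = v z"
proof -
  define T where "T = \<Omega> \<inter> {x. v z \<bullet> x = v z \<bullet> z}"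
  have "convex T" unfolding T_def by (intro convex_Int \<Omega>(2) convex_hyperplane)
  then have T: "connected T" by (rule convex_connected)
  have near: "\<exists>r>0. \<forall>b\<in>T. dist b a < r \<longrightarrow> v b = v z" if a: "a \<in> T" "v a = v z" for a
  proof -
    have a': "a \<in> \<Omega>" "v a \<noteq> 0" using a z by (auto simp: T_def)
    obtain r where r: "r > 0" "ball a r \<subseteq> \<Omega>" "\<And>y. y \<in> ball a r \<Longrightarrow> v y \<noteq> 0"
      using nonvanishing_ball[OF a'] by blast
    have "v b = v z" if b: "b \<in> T" "dist b a < r" for b
    proof -
      have "v (a + 1 *\<^sub>R (b - a)) = v (a + 0 *\<^sub>R (b - a))"
      proof (rule has_derivative_zero_unique[of "{0..1}" "\<lambda>s. v (a + s *\<^sub>R (b - a))"])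
        fix s :: real assume s: "s \<in> {0..1}"
        let ?x = "a + s *\<^sub>R (b - a)"
        have "norm (s *\<^sub>R (b - a)) \<le> norm (b - a)" using s by (simp add: mult_left_le_one_le)
        then have x: "?x \<in> ball a r" using b(2) by (simp add: dist_norm)
        then have x': "?x \<in> \<Omega>" "v ?x \<noteq> 0" using r by auto
        have "sgn (v ?x) = sgn (v z)"
          using sgn_constant_on_ball[OF r(2,3) x, of a] r(1) a(2) by simp
        then have "v ?x = (norm (v ?x) / norm (v z)) *\<^sub>R v z"
          using x'(2) z(2) by (simp add: sgn_div_norm divide_inverse) (metis (no_types, lifting) norm_eq_zero right_inverse scaleR_one scaleR_scaleR)
        moreover have "v z \<bullet> (b - a) = 0" using a(1) b(1) by (simp add: T_def inner_diff_right)
        ultimately have orth: "v ?x \<bullet> (b - a) = 0" by (metis inner_scaleR_left mult_zero_right)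
        have "((\<lambda>s. a + s *\<^sub>R (b - a)) has_derivative (\<lambda>t. t *\<^sub>R (b - a))) (at s)"
          by (auto intro!: derivative_eq_intros)
        from has_derivative_compose[OF this dv[OF x']]
        have "((\<lambda>s. v (a + s *\<^sub>R (b - a))) has_derivative (\<lambda>t. 0)) (at s)"
          by (simp add: orth)
        then show "((\<lambda>s. v (a + s *\<^sub>R (b - a))) has_derivative (\<lambda>t. 0)) (at s within {0..1})"
          by (rule has_derivative_at_withinI)
      qed auto
      then show ?thesis using a(2) by simp
    qed
    then show ?thesis using r(1) by blast
  qed
  have cT: "continuous_on T v" using cv by (rule continuous_on_subset) (auto simp: T_def)
  have "(v y = v z) = (v z = v z)"
  proof (rule connected_local_const[where f = "\<lambda>x. v x = v z" and a = y and b = z, OF T])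
    have "v z \<bullet> y = v z \<bullet> z" using y(2) by (simp add: inner_diff_left inner_commute[of "v z"])
    then show "y \<in> T" "z \<in> T" using z y by (auto simp: T_def)
    show "\<forall>a\<in>T. \<forall>\<^sub>F b in at a within T. (v a = v z) = (v b = v z)"
    proof
      fix a assume a: "a \<in> T"
      show "\<forall>\<^sub>F b in at a within T. (v a = v z) = (v b = v z)"
      proof (cases "v a = v z")
        case True
        with near[OF a True] show ?thesis unfolding eventually_at by auto
      next
        case False
        have "(v \<longlongrightarrow> v a) (at a within T)" using cT a by (simp add: continuous_on_def)
        then have "\<forall>\<^sub>F b in at a within T. v b \<noteq> v z" using False by (rule tendsto_imp_eventually_ne)
        then show ?thesis by eventually_elim (use False in simp)
      qed
    qed
  qed
  then show ?thesis by simp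
qed

end

context strictly_convex_domain
begin

text \<open>Two nearby parallel slices are left along a common direction \<open>d\<close>. Where they meet the
  boundary, the normal is orthogonal to the vector \<open>e\<close> separating the slices, so strict convexity
  makes each of the two exit times smaller than the other.\<close>

lemma one_dimensional_field_zero:
  fixes v :: "real^'n \<Rightarrow> real^'n"
  assumes dim: "CARD('n) \<ge> 2"
    and dv: "\<And>x. x \<in> \<Omega> \<Longrightarrow> v x \<noteq> 0 \<Longrightarrow> (v has_derivative (\<lambda>h. (l x * (v x \<bullet> h)) *\<^sub>R v x)) (at x)"
    and cv: "continuous_on (closure \<Omega>) v"
    and tan: "\<And>q. q \<in> frontier \<Omega> \<Longrightarrow> v q \<bullet> \<nu> q = 0"
    and x: "x \<in> \<Omega>"
  shows "v x = 0"
proof (rule ccontr)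
  assume vx: "v x \<noteq> 0"
  have cv\<Omega>: "continuous_on \<Omega> v" using cv closure_subset by (rule continuous_on_subset)
  have slice: "v y = v z" if "z \<in> \<Omega>" "v z \<noteq> 0" "y \<in> \<Omega>" "(y - z) \<bullet> v z = 0" for y z
    using constant_on_orthogonal_slice[of \<Omega> v l] op conv dv cv\<Omega> that by blast
  define e where "e = sgn (v x)"
  have e: "norm e = 1" using vx by (simp add: e_def norm_sgn)
  \<comment> \<open>Dimension at least two enters here: a direction within the slices is
    needed.\<close>
  obtain d where d: "d \<noteq> 0" "e \<bullet> d = 0"
    using orthogonal_to_vector_exists[of e] dim by (auto simp: orthogonal_def)
  obtain r where r: "r > 0" "ball x r \<subseteq> \<Omega>" "\<And>y. y \<in> ball x r \<Longrightarrow> v y \<noteq> 0"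
    using nonvanishing_ball[of \<Omega> v l x thesis] op conv dv cv\<Omega> x vx by blast
  \<comment> \<open>The second slice passes through the same ball, so that the field has the same
    direction \<open>e\<close> on both slices.\<close>
  define z where "z = x + (r/2) *\<^sub>R e"
  have zb: "z \<in> ball x r" using e r(1) by (simp add: z_def dist_norm)
  have ez: "sgn (v z) = e"
    unfolding e_def
    by (rule sgn_constant_on_ball[of \<Omega> v l x r]) (use op conv dv cv\<Omega> r zb in auto)
  \<comment> \<open>Along the ray \<open>v\<close> is constant and, by continuity, keeps its value
    at the exit point; tangency there makes \<nu> orthogonal to \<open>e\<close>. Strict support,
    with the starting point inside, makes the ray leave transversally.\<close>
  have exit: "\<exists>t>0. y + t *\<^sub>R d \<in> frontier \<Omega> \<and> \<nu> (y + t *\<^sub>R d) \<bullet> e = 0 \<and> 0 < \<nu> (y + t *\<^sub>R d) \<bullet> d"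
    if y: "y \<in> \<Omega>" "v y \<noteq> 0" "sgn (v y) = e" for y
  proof -
    have vy: "v y = norm (v y) *\<^sub>R e" using y(2) by (simp add: y(3)[symmetric] sgn_div_norm)
    obtain t where t: "t > 0" "y + t *\<^sub>R d \<in> frontier \<Omega>"
        "\<And>s. 0 \<le> s \<Longrightarrow> s < t \<Longrightarrow> y + s *\<^sub>R d \<in> \<Omega>"
      using ray_to_frontier[OF bdd, of y d] y(1) d(1) op by (metis interior_open)
    let ?q = "y + t *\<^sub>R d"
    have o: "d \<bullet> v y = 0" by (subst vy) (simp add: d(2) inner_commute[of d])
    have const: "v (y + s *\<^sub>R d) = v y" if "0 \<le> s" "s < t" for s
      by (rule slice[OF y(1,2) t(3)[OF that]]) (simp add: o)
    have "((\<lambda>s. v (y + s *\<^sub>R d)) \<longlongrightarrow> v ?q) (at t within {0..<t})"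
    proof -
      have "continuous_on {0..t} (\<lambda>s. v (y + s *\<^sub>R d))"
      proof (rule continuous_on_compose2[OF cv])
        show "(\<lambda>s. y + s *\<^sub>R d) ` {0..t} \<subseteq> closure \<Omega>"
        proof clarify
          fix s assume "s \<in> {0..t}"
          then show "y + s *\<^sub>R d \<in> closure \<Omega>"
            using t(2,3) closure_subset frontier_closure by (cases "s = t") (auto simp: less_le subset_iff)
        qed
      qed (intro continuous_intros)
      then have "((\<lambda>s. v (y + s *\<^sub>R d)) \<longlongrightarrow> v ?q) (at t within {0..t})"
        using t(1) by (simp add: continuous_on_def)
      then show ?thesis by (rule tendsto_within_subset) auto
    qed
    moreover have "\<forall>\<^sub>F s in at t within {0..<t}. v (y + s *\<^sub>R d) = v y"
      using const by (auto simp: eventually_at_filter)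
    ultimately have "((\<lambda>s. v y) \<longlongrightarrow> v ?q) (at t within {0..<t})"
      by (rule Lim_transform_eventually)
    moreover have "at t within {0..<t} \<noteq> bot"
      using t(1) by (simp add: at_within_eq_bot_iff islimpt_def[symmetric] trivial_limit_within[symmetric])
    ultimately have vq: "v ?q = v y" by (metis tendsto_const tendsto_unique)
    have "norm (v y) * (e \<bullet> \<nu> ?q) = 0" using tan[OF t(2)] vy unfolding vq by (metis inner_scaleR_left)
    then have "\<nu> ?q \<bullet> e = 0" using y(2) by (simp add: inner_commute)
    moreover have "0 < \<nu> ?q \<bullet> d"
    proof -
      have "y \<noteq> ?q" using y(1) t(2) by (auto simp: frontier_open_iff[OF op])
      then have "\<nu> ?q \<bullet> (y - ?q) < 0" using y(1) closure_subset by (intro \<nu>_strict[OF t(2)]) auto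
      then show ?thesis using t(1) by (simp add: mult_less_0_iff zero_less_mult_iff)
    qed
    ultimately show ?thesis using t(1,2) by blast
  qed
  obtain t where t: "x + t *\<^sub>R d \<in> frontier \<Omega>" "\<nu> (x + t *\<^sub>R d) \<bullet> e = 0" "0 < \<nu> (x + t *\<^sub>R d) \<bullet> d"
    using exit[OF x vx] by (auto simp: e_def)
  have "z \<in> \<Omega>" "v z \<noteq> 0" using r zb by auto
  from exit[OF this ez] obtain s
    where s: "z + s *\<^sub>R d \<in> frontier \<Omega>" "\<nu> (z + s *\<^sub>R d) \<bullet> e = 0" "0 < \<nu> (z + s *\<^sub>R d) \<bullet> d" by blast
  define p q where "p = x + t *\<^sub>R d" and "q = z + s *\<^sub>R d"
  have diff: "q - p = (r/2) *\<^sub>R e + (s - t) *\<^sub>R d" by (simp add: p_def q_def z_def algebra_simps)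
  have "e \<bullet> (q - p) = r / 2" unfolding diff using d(2) e by (simp add: inner_add_right dot_square_norm)
  then have ne: "q \<noteq> p" using r(1) by auto
  have "\<nu> p \<bullet> (q - p) < 0" using t(1) s(1) ne by (intro \<nu>_strict frontier_closure) (auto simp: p_def q_def)
  then have "(s - t) * (\<nu> p \<bullet> d) < 0" unfolding diff using t(2) by (simp add: p_def inner_add_right)
  then have "s < t" using t(3) by (simp add: p_def mult_less_0_iff)
  moreover have "\<nu> q \<bullet> (p - q) < 0" using t(1) s(1) ne by (intro \<nu>_strict frontier_closure) (auto simp: p_def q_def)
  then have "0 < \<nu> q \<bullet> (q - p)" by (simp add: inner_diff_right)
  then have "0 < (s - t) * (\<nu> q \<bullet> d)" unfolding diff using s(2) by (simp add: q_def inner_add_right)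
  then have "t < s" using s(3) by (simp add: q_def zero_less_mult_iff)
  ultimately show False by simp
qed

end

section \<open>The stability argument\<close>

lemma set_integral_sum:
  fixes h :: "'i \<Rightarrow> 'a \<Rightarrow> real"
  assumes "\<And>i. i \<in> I \<Longrightarrow> set_integrable M A (h i)"
  shows "(LINT x:A|M. \<Sum>i\<in>I. h i x) = (\<Sum>i\<in>I. LINT x:A|M. h i x)"
  using assms unfolding set_integrable_def set_lebesgue_integral_def scaleR_sum_right
  by (rule Bochner_Integration.integral_sum)

text \<open>The test functions are difference quotients of \<psi> along \<open>- e\<close>. Their
  gradients are difference quotients of \<open>k\<close>, and translation moves both onto
  \<open>V\<close> and \<open>F\<close>, which do have derivatives; \<psi> need not be C^2.\<close>

lemma weak_form_differentiated:
  fixes V :: "real^'n \<Rightarrow> real^'n" and \<psi> F :: "real^'n \<Rightarrow> real"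
  assumes \<Omega>: "open \<Omega>" "bounded \<Omega>"
    and V: "\<And>j. C1_pair \<Omega> (\<lambda>x. V x $ j) (Z j)" and F: "C1_pair \<Omega> F F'"
    and weak: "\<And>\<phi> g. C1_pair \<Omega> \<phi> g \<Longrightarrow>
       (LINT x:\<Omega>|lebesgue. V x \<bullet> g x) = (LINT x:\<Omega>|lebesgue. F x * \<phi> x)"
    and \<psi>: "\<And>x. (\<psi> has_derivative (\<lambda>h. k x \<bullet> h)) (at x)" and k: "continuous_on UNIV k"
    and K: "compact K" "K \<subseteq> \<Omega>" and off: "\<And>x. x \<notin> K \<Longrightarrow> \<psi> x = 0 \<and> k x = 0"
  shows "(LINT x:\<Omega>|lebesgue. \<Sum>j\<in>UNIV. (Z j x \<bullet> e) * k x $ j) = (LINT x:\<Omega>|lebesgue. (F' x \<bullet> e) * \<psi> x)"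
proof -
  obtain d where d: "d > 0" "(\<Union>x\<in>K. cball x d) \<subseteq> \<Omega>"
    using compact_subset_open_imp_cball_epsilon_subset[OF K(1) \<Omega>(1) K(2)] by blast
  \<comment> \<open>The factor \<open>d\<close> keeps all translates of \<open>K\<close> inside
    \<Omega>; adding 1 to the norm covers \<open>e = 0\<close>.\<close>
  define t where "t n = d / (norm e + 1) * inverse (real (Suc n))" for n
  have ne: "norm e + 1 > 0" using norm_ge_zero[of e] by linarith
  have t0: "0 < t n" for n using d(1) ne by (simp add: t_def)
  have td: "t n * norm e \<le> d" for n
  proof -
    have "inverse (real (Suc n)) * (norm e / (norm e + 1)) \<le> 1 * 1"
      using ne by (intro mult_mono) (auto simp: inverse_le_1_iff)
    then have "d * (inverse (real (Suc n)) * (norm e / (norm e + 1))) \<le> d * 1"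
      using d(1) by (intro mult_left_mono) auto
    then show ?thesis by (simp add: t_def mult_ac)
  qed
  have tl: "t \<longlonglongrightarrow> 0"
    unfolding t_def using tendsto_mult_right_zero[OF LIMSEQ_inverse_real_of_nat] .
  have kc: "continuous_on S k" for S using k continuous_on_subset by blast
  have kjc: "continuous_on UNIV (\<lambda>x. k x $ j)" for j by (intro continuous_intros k)
  have \<psi>c: "continuous_on S \<psi>" for S
    by (rule has_derivative_continuous_on) (use \<psi> has_derivative_at_withinI in blast)
  have Vc: "continuous_on (closure \<Omega>) (\<lambda>x. V x $ j)" for j by (rule C1_pairD(1)[OF V])
  have dK: "cball x d \<subseteq> \<Omega>" if "x \<in> K" for x using d(2) that by auto
  have ZL: "(\<lambda>n. LINT x:\<Omega>|lebesgue. V x $ j * ((k (x - t n *\<^sub>R e) $ j - k x $ j) / t n))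
      \<longlonglongrightarrow> (LINT x:\<Omega>|lebesgue. (Z j x \<bullet> e) * k x $ j)" for j
    by (rule translation_quotient_tendsto[OF \<Omega> V kjc _ K(1) dK t0 td tl]) (use off in auto)
  have FL: "(\<lambda>n. LINT x:\<Omega>|lebesgue. F x * ((\<psi> (x - t n *\<^sub>R e) - \<psi> x) / t n))
      \<longlonglongrightarrow> (LINT x:\<Omega>|lebesgue. (F' x \<bullet> e) * \<psi> x)"
    by (rule translation_quotient_tendsto[OF \<Omega> F \<psi>c _ K(1) dK t0 td tl]) (use off in auto)
  have eq: "(\<Sum>j\<in>UNIV. LINT x:\<Omega>|lebesgue. V x $ j * ((k (x - t n *\<^sub>R e) $ j - k x $ j) / t n))
      = (LINT x:\<Omega>|lebesgue. F x * ((\<psi> (x - t n *\<^sub>R e) - \<psi> x) / t n))" for n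
  proof -
    have sh: "continuous_on S (\<lambda>x. k (x - t n *\<^sub>R e))" "continuous_on S (\<lambda>x. \<psi> (x - t n *\<^sub>R e))" for S
      by (auto intro!: continuous_on_compose2[OF k] continuous_on_compose2[OF \<psi>c[of UNIV]] continuous_intros)
    define \<phi> where "\<phi> x = (\<psi> (x - t n *\<^sub>R e) - \<psi> x) / t n" for x
    define g where "g x = (k (x - t n *\<^sub>R e) - k x) /\<^sub>R t n" for x
    have "C1_pair \<Omega> \<phi> g"
      unfolding C1_pair_def
    proof (intro conjI ballI)
      show "continuous_on (closure \<Omega>) \<phi>"
        unfolding \<phi>_def using t0[of n] by (intro continuous_intros sh \<psi>c) auto
      show "continuous_on (closure \<Omega>) g" unfolding g_def by (intro continuous_intros sh kc)
      fix x
      have "((\<lambda>x. x - t n *\<^sub>R e) has_derivative (\<lambda>h. h)) (at x)" by (auto intro!: derivative_eq_intros)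
      from has_derivative_compose[OF this \<psi>]
      have 1: "((\<lambda>x. \<psi> (x - t n *\<^sub>R e)) has_derivative (\<lambda>h. k (x - t n *\<^sub>R e) \<bullet> h)) (at x)" .
      have "(\<phi> has_derivative (\<lambda>h. (k (x - t n *\<^sub>R e) \<bullet> h - k x \<bullet> h) / t n)) (at x)"
        unfolding \<phi>_def divide_inverse by (intro has_derivative_mult_left has_derivative_diff 1 \<psi>)
      then show "(\<phi> has_derivative (\<lambda>h. g x \<bullet> h)) (at x)"
        by (simp add: g_def inner_diff_left divide_inverse_commute)
    qed
    from weak[OF this]
    have w: "(LINT x:\<Omega>|lebesgue. V x \<bullet> g x) = (LINT x:\<Omega>|lebesgue. F x * \<phi> x)" .
    have "(LINT x:\<Omega>|lebesgue. V x \<bullet> g x)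
        = (LINT x:\<Omega>|lebesgue. \<Sum>j\<in>UNIV. V x $ j * ((k (x - t n *\<^sub>R e) $ j - k x $ j) / t n))"
      by (simp add: inner_vec_def g_def divide_inverse_commute)
    also have "\<dots> = (\<Sum>j\<in>UNIV. LINT x:\<Omega>|lebesgue. V x $ j * ((k (x - t n *\<^sub>R e) $ j - k x $ j) / t n))"
      using t0[of n]
      by (intro set_integral_sum set_integrable_continuous_closure[OF \<Omega>] continuous_intros Vc sh kc) auto
    finally show ?thesis using w by (simp add: \<phi>_def)
  qed
  have "(\<lambda>n. \<Sum>j\<in>UNIV. LINT x:\<Omega>|lebesgue. V x $ j * ((k (x - t n *\<^sub>R e) $ j - k x $ j) / t n))
      \<longlonglongrightarrow> (\<Sum>j\<in>UNIV. LINT x:\<Omega>|lebesgue. (Z j x \<bullet> e) * k x $ j)"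
    by (intro tendsto_sum ZL)
  then have "(\<Sum>j\<in>UNIV. LINT x:\<Omega>|lebesgue. (Z j x \<bullet> e) * k x $ j) = (LINT x:\<Omega>|lebesgue. (F' x \<bullet> e) * \<psi> x)"
    using FL unfolding eq by (rule LIMSEQ_unique)
  moreover have "(LINT x:\<Omega>|lebesgue. \<Sum>j\<in>UNIV. (Z j x \<bullet> e) * k x $ j)
      = (\<Sum>j\<in>UNIV. LINT x:\<Omega>|lebesgue. (Z j x \<bullet> e) * k x $ j)"
    by (intro set_integral_sum set_integrable_continuous_closure[OF \<Omega>] continuous_intros C1_pairD(2)[OF V] kc)
  ultimately show ?thesis by simp
qed

context strictly_convex_domain
begin

text \<open>\<open>v\<close> and \<open>w\<close> are the extended gradient and Hessian rows of the
  solution, and \<open>F\<close>, \<open>F'\<close> stand for f(u), f'(u). The set \<open>D\<close>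
  absorbs the alternative between (A1) and (A2): the extended gradient takes its values where the
  flux is differentiable with continuous Jacobian.\<close>

context
  fixes a :: "real \<Rightarrow> real" and D :: "(real^'n) set" and U :: "real^'n \<Rightarrow> real"
    and v :: "real^'n \<Rightarrow> real^'n" and w :: "'n \<Rightarrow> real^'n \<Rightarrow> real^'n" and F F' :: "real^'n \<Rightarrow> real"
  assumes a: "C11_loc_pos a" and a_pos: "\<And>t. t > 0 \<Longrightarrow> a t > 0"
    and a_ell: "\<And>t. t > 0 \<Longrightarrow> a t + deriv a t * t > 0"
    and D: "flux_domain a D" and vD: "v ` closure \<Omega> \<subseteq> D"
    and U: "C1_pair \<Omega> U v" and w: "\<And>i. C1_pair \<Omega> (\<lambda>x. v x $ i) (w i)"
    and F: "C1_pair \<Omega> F (\<lambda>x. F' x *\<^sub>R v x)" and F'c: "continuous_on (closure \<Omega>) F'"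
    and weak: "\<And>\<phi> g. C1_pair \<Omega> \<phi> g \<Longrightarrow>
       (LINT x:\<Omega>|lebesgue. (a (norm (v x)) *\<^sub>R v x) \<bullet> g x) = (LINT x:\<Omega>|lebesgue. F x * \<phi> x)"
    and stable: "\<And>\<phi> g. C1_pair \<Omega> \<phi> g \<Longrightarrow>
       0 \<le> (LINT x:\<Omega>|lebesgue. (A_matrix a (v x) *v g x) \<bullet> g x) - (LINT x:\<Omega>|lebesgue. F' x * (\<phi> x)\<^sup>2)"
begin

lemmas vc = gradient_field_continuous[OF w]

lemma wc: "continuous_on (closure \<Omega>) (w i)"
  by (rule C1_pairD(2)[OF w])

lemma v_D: "x \<in> closure \<Omega> \<Longrightarrow> v x \<in> D"
  using vD by auto

lemma hessian_symmetric: "x \<in> \<Omega> \<Longrightarrow> w i x $ j = w j x $ i"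
  by (rule symmetric_second_derivative[OF op, of x U v "\<lambda>i. w i x"])
     (use C1_pairD(3)[OF U] C1_pairD(3)[OF w] in auto)

lemma A_form_nonneg:
  assumes "x \<in> closure \<Omega>"
  shows "0 \<le> (A_matrix a (v x) *v h) \<bullet> h"
  using flux_zero_nonneg[OF a a_pos D] v_D[OF assms] a_pos a_ell by (intro A_matrix_nonneg) auto

lemma A_mult_continuous: "continuous_on (closure \<Omega>) h \<Longrightarrow> continuous_on (closure \<Omega>) (\<lambda>x. A_matrix a (v x) *v h x)"
  by (rule continuous_on_A_matrix_mult[OF a a_pos D vc vD])

text \<open>The weak form yields vanishing normal flux; where \<open>v p\<close> is nonzero, the
  positive factor a(|v p|) can be divided out.\<close>

lemma neumann_condition:
  assumes p: "p \<in> frontier \<Omega>"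
  shows "v p \<bullet> \<nu> p = 0"
proof (cases "v p = 0")
  case False
  have "(a (norm (v p)) *\<^sub>R v p) \<bullet> \<nu> p = 0"
    by (rule normal_flux_zero[OF _ C1_pairD(1)[OF F] weak p])
       (intro continuous_intros vc continuous_on_flux[OF a a_pos D vc vD])
  then show ?thesis using a_pos[of "norm (v p)"] False by simp
qed simp

text \<open>For smooth \<open>u\<close> the divergence of \<open>boundary_field\<close> is \<open>bulk\<close>, so the integral of \<open>bulk\<close> is a
  boundary integral.\<close>

definition bulk :: "real^'n \<Rightarrow> real" where
  "bulk x = (\<Sum>i\<in>UNIV. (A_matrix a (v x) *v w i x) \<bullet> w i x) - F' x * (v x \<bullet> v x)"

definition boundary_field :: "real^'n \<Rightarrow> real^'n" where
  "boundary_field x = A_matrix a (v x) *v (\<chi> i. w i x \<bullet> v x)"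

lemma bulk_continuous: "continuous_on (closure \<Omega>) bulk"
  unfolding bulk_def[abs_def] by (intro continuous_intros A_mult_continuous wc F'c vc)

lemma boundary_field_continuous: "continuous_on (closure \<Omega>) boundary_field"
  unfolding boundary_field_def[abs_def]
  by (intro A_mult_continuous continuous_on_vec_lambda continuous_intros wc vc)

text \<open>Since \<open>v p\<close> is orthogonal to the normal, the rank-one part of A does not
  contribute to the normal component. What remains is a(|v p|) times the Hessian term whose sign
  follows from convexity.\<close>

lemma boundary_field_sign:
  assumes p: "p \<in> frontier \<Omega>"
  shows "boundary_field p \<bullet> \<nu> p \<le> 0"
proof -
  have "(v has_derivative (\<lambda>h. \<chi> i. w i p \<bullet> h)) (at p within closure \<Omega>)"
    by (rule vec_has_derivative)
       (use C1_pair_has_derivative_closure[OF op conv w frontier_closure[OF p]] in simp)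
  from boundary_derivative_sign[OF p this neumann_condition]
  have s: "(\<chi> i. w i p \<bullet> v p) \<bullet> \<nu> p \<le> 0" .
  have "0 \<le> a (norm (v p))"
    using a_pos[of "norm (v p)"] flux_zero_nonneg[OF a a_pos D] v_D[OF frontier_closure[OF p]]
    by (cases "v p = 0") auto
  then show ?thesis
    using s neumann_condition[OF p] by (simp add: boundary_field_def A_matrix_inner mult_nonneg_nonpos)
qed

section \<open>The linearized equation and its integral identity\<close>

lemma flux_C1_pair:
  "C1_pair \<Omega> (\<lambda>x. (a (norm (v x)) *\<^sub>R v x) $ j)
     (\<lambda>x. \<Sum>i\<in>UNIV. (A_matrix a (v x) *v axis j 1) $ i *\<^sub>R w i x)"
  unfolding C1_pair_def
proof (intro conjI ballI)
  show "continuous_on (closure \<Omega>) (\<lambda>x. (a (norm (v x)) *\<^sub>R v x) $ j)"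
    by (intro continuous_intros vc continuous_on_flux[OF a a_pos D vc vD])
  show "continuous_on (closure \<Omega>) (\<lambda>x. \<Sum>i\<in>UNIV. (A_matrix a (v x) *v axis j 1) $ i *\<^sub>R w i x)"
    by (intro continuous_intros wc A_mult_continuous)
  fix x assume x: "x \<in> \<Omega>"
  then have xc: "x \<in> closure \<Omega>" using closure_subset by blast
  have "((\<lambda>x. a (norm (v x)) *\<^sub>R v x) has_derivative (\<lambda>h. A_matrix a (v x) *v (\<chi> i. w i x \<bullet> h))) (at x)"
    by (rule has_derivative_compose[OF gradient_field_has_derivative[OF w x] flux_has_derivative[OF a a_pos D v_D[OF xc]]])
  from bounded_linear.has_derivative[OF bounded_linear_vec_nth this]
  have "((\<lambda>x. (a (norm (v x)) *\<^sub>R v x) $ j) has_derivative (\<lambda>h. (A_matrix a (v x) *v (\<chi> i. w i x \<bullet> h)) $ j)) (at x)" .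
  moreover have "(A_matrix a (v x) *v (\<chi> i. w i x \<bullet> h)) $ j
      = (\<Sum>i\<in>UNIV. (A_matrix a (v x) *v axis j 1) $ i *\<^sub>R w i x) \<bullet> h" for h
  proof -
    have "(A_matrix a (v x) *v (\<chi> i. w i x \<bullet> h)) $ j = (A_matrix a (v x) *v (\<chi> i. w i x \<bullet> h)) \<bullet> axis j 1"
      by (simp add: inner_axis)
    also have "\<dots> = (A_matrix a (v x) *v axis j 1) \<bullet> (\<chi> i. w i x \<bullet> h)" by (rule A_matrix_inner_commute)
    also have "\<dots> = (\<Sum>i\<in>UNIV. (A_matrix a (v x) *v axis j 1) $ i *\<^sub>R w i x) \<bullet> h"
      by (simp add: inner_vec_def[of _ "\<chi> i. w i x \<bullet> h"] inner_sum_left)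
    finally show ?thesis .
  qed
  ultimately show "((\<lambda>x. (a (norm (v x)) *\<^sub>R v x) $ j) has_derivative
      (\<lambda>h. (\<Sum>i\<in>UNIV. (A_matrix a (v x) *v axis j 1) $ i *\<^sub>R w i x) \<bullet> h)) (at x)" by simp
qed

text \<open>The left side is the i-th partial derivative of the flux paired with \<open>h\<close>.
  Symmetry of the Hessian and of A rewrites it as A applied to the gradient of \<open>v_i\<close>,
  so the differentiated equation is the linearized equation for \<open>v_i\<close>.\<close>

lemma flux_derivative_swap:
  assumes x: "x \<in> \<Omega>"
  shows "(\<Sum>j\<in>UNIV. ((\<Sum>l\<in>UNIV. (A_matrix a (v x) *v axis j 1) $ l *\<^sub>R w l x) \<bullet> axis i 1) * h $ j)
     = (A_matrix a (v x) *v w i x) \<bullet> h"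
proof -
  have "(\<Sum>l\<in>UNIV. (A_matrix a (v x) *v axis j 1) $ l *\<^sub>R w l x) \<bullet> axis i 1 = (A_matrix a (v x) *v w i x) $ j" for j
  proof -
    have "(\<Sum>l\<in>UNIV. (A_matrix a (v x) *v axis j 1) $ l *\<^sub>R w l x) \<bullet> axis i 1
        = (\<Sum>l\<in>UNIV. (A_matrix a (v x) *v axis j 1) $ l * w i x $ l)"
      using hessian_symmetric[OF x] by (simp add: inner_sum_left inner_axis)
    also have "\<dots> = (A_matrix a (v x) *v axis j 1) \<bullet> w i x" by (simp add: inner_vec_def)
    also have "\<dots> = (A_matrix a (v x) *v w i x) \<bullet> axis j 1" by (rule A_matrix_inner_commute)
    finally show ?thesis by (simp add: inner_axis)
  qed
  then show ?thesis by (simp add: inner_vec_def)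
qed

lemma hessian_gradient:
  assumes "x \<in> \<Omega>"
  shows "(\<chi> i. w i x \<bullet> v x) = (\<Sum>i\<in>UNIV. v x $ i *\<^sub>R w i x)"
  using hessian_symmetric[OF assms] by (simp add: vec_eq_iff inner_vec_def mult.commute)

text \<open>The equation differentiated in direction i is tested with \<eta> times the i-th
  component of \<open>v\<close>, and the results are added over i. This is the weak form of the
  divergence identity between \<open>boundary_field\<close> and \<open>bulk\<close>.\<close>

lemma localized_identity:
  assumes \<eta>: "\<And>x. (\<eta> has_derivative (\<lambda>h. g x \<bullet> h)) (at x)" and g: "continuous_on UNIV g"
    and K: "compact K" "K \<subseteq> \<Omega>" and off: "\<And>x. x \<notin> K \<Longrightarrow> \<eta> x = 0 \<and> g x = 0"
  shows "(LINT x:\<Omega>|lebesgue. \<eta> x * bulk x) = - (LINT x:\<Omega>|lebesgue. boundary_field x \<bullet> g x)"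
proof -
  have \<eta>c: "continuous_on S \<eta>" for S
    by (rule has_derivative_continuous_on) (use \<eta> has_derivative_at_withinI in blast)
  have gc: "continuous_on S g" for S using g continuous_on_subset by blast
  define k where "k i x = \<eta> x *\<^sub>R w i x + v x $ i *\<^sub>R g x" for i x
  have KK: "\<Omega> \<union> - K = UNIV" using K by blast
  have oK: "open (- K)" using K(1) by (simp add: compact_imp_closed open_Compl)
  \<comment> \<open>Nothing is known about \<open>v\<close> and \<open>w\<close> off the closure of
    \<Omega>, but \<eta> and \<open>g\<close> vanish off \<open>K\<close>; the open sets \<Omega>
    and \<open>- K\<close> cover the space.\<close>
  have kc: "continuous_on UNIV (k i)" for i
  proof -
    have "continuous_on \<Omega> (k i)"
      unfolding k_def
      by (intro continuous_intros \<eta>c gc continuous_on_subset[OF wc closure_subset] continuous_on_subset[OF vc closure_subset])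
    moreover have "continuous_on (- K) (k i)"
      by (rule continuous_on_eq[OF continuous_on_const[of _ 0]]) (use off in \<open>simp add: k_def\<close>)
    ultimately show ?thesis using continuous_on_open_Un[OF op oK] KK by metis
  qed
  have \<psi>: "((\<lambda>x. \<eta> x * v x $ i) has_derivative (\<lambda>h. k i x \<bullet> h)) (at x)" for i x
  proof (cases "x \<in> K")
    case True
    then have "x \<in> \<Omega>" using K by blast
    from has_derivative_mult[OF \<eta> C1_pairD(3)[OF w this]] show ?thesis
      by (rule has_derivative_eq_rhs) (simp add: k_def fun_eq_iff inner_add_left mult.commute)
  next
    case False
    have "((\<lambda>x. \<eta> x * v x $ i) has_derivative (\<lambda>h. 0)) (at x)"
      by (rule has_derivative_transform_within_open[OF has_derivative_const[of 0] oK]) (use False off in auto)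
    then show ?thesis using off[OF False] by (simp add: k_def)
  qed
  have off': "\<eta> x * v x $ i = 0 \<and> k i x = 0" if "x \<notin> K" for i x
    using off[OF that] by (simp add: k_def)
  have "(LINT x:\<Omega>|lebesgue. (A_matrix a (v x) *v w i x) \<bullet> k i x)
      = (LINT x:\<Omega>|lebesgue. F' x * (v x $ i)\<^sup>2 * \<eta> x)" (is "?L i = ?R i") for i
  proof -
    have "?L i = (LINT x:\<Omega>|lebesgue. \<Sum>j\<in>UNIV.
        ((\<Sum>l\<in>UNIV. (A_matrix a (v x) *v axis j 1) $ l *\<^sub>R w l x) \<bullet> axis i 1) * k i x $ j)"
      using flux_derivative_swap op by (intro set_lebesgue_integral_cong) auto
    also have "\<dots> = (LINT x:\<Omega>|lebesgue. ((F' x *\<^sub>R v x) \<bullet> axis i 1) * (\<eta> x * v x $ i))"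
      by (rule weak_form_differentiated[OF op bdd flux_C1_pair F weak \<psi> kc K off'])
    also have "\<dots> = ?R i"
      by (simp add: inner_axis power2_eq_square mult_ac)
    finally show ?thesis .
  qed
  then have eq: "(\<Sum>i\<in>UNIV. ?L i) = (\<Sum>i\<in>UNIV. ?R i)" by simp
  have kc': "continuous_on (closure \<Omega>) (k i)" for i using kc continuous_on_subset by blast
  have "(\<Sum>i\<in>UNIV. ?L i) = (LINT x:\<Omega>|lebesgue. \<Sum>i\<in>UNIV. (A_matrix a (v x) *v w i x) \<bullet> k i x)"
    by (rule set_integral_sum[symmetric])
       (auto intro!: set_integrable_continuous_closure[OF op bdd] continuous_intros A_mult_continuous wc kc')
  moreover have "(\<Sum>i\<in>UNIV. ?R i) = (LINT x:\<Omega>|lebesgue. \<Sum>i\<in>UNIV. F' x * (v x $ i)\<^sup>2 * \<eta> x)"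
    by (rule set_integral_sum[symmetric])
       (auto intro!: set_integrable_continuous_closure[OF op bdd] continuous_intros F'c vc \<eta>c)
  ultimately have eq2: "(LINT x:\<Omega>|lebesgue. (\<Sum>i\<in>UNIV. (A_matrix a (v x) *v w i x) \<bullet> k i x)
      - (\<Sum>i\<in>UNIV. F' x * (v x $ i)\<^sup>2 * \<eta> x)) = 0"
    using eq
    by (subst set_integral_diff(2))
       (auto intro!: set_integrable_continuous_closure[OF op bdd] continuous_intros A_mult_continuous wc kc' F'c vc \<eta>c)
  \<comment> \<open>Of the two summands of \<open>k i\<close>, the one with \<eta> produces
    \<open>bulk\<close> together with the F' term, and the one with \<open>g\<close> produces
    \<open>boundary_field\<close> through the symmetry of A.\<close>
  have pt: "(\<Sum>i\<in>UNIV. (A_matrix a (v x) *v w i x) \<bullet> k i x) - (\<Sum>i\<in>UNIV. F' x * (v x $ i)\<^sup>2 * \<eta> x)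
      = \<eta> x * bulk x + boundary_field x \<bullet> g x" if x: "x \<in> \<Omega>" for x
  proof -
    have "boundary_field x \<bullet> g x = (A_matrix a (v x) *v g x) \<bullet> (\<Sum>i\<in>UNIV. v x $ i *\<^sub>R w i x)"
      unfolding boundary_field_def hessian_gradient[OF x] by (rule A_matrix_inner_commute)
    also have "\<dots> = (\<Sum>i\<in>UNIV. v x $ i * ((A_matrix a (v x) *v w i x) \<bullet> g x))"
      by (simp add: inner_sum_right A_matrix_inner_commute[of a "v x" "g x"])
    finally have "boundary_field x \<bullet> g x = (\<Sum>i\<in>UNIV. v x $ i * ((A_matrix a (v x) *v w i x) \<bullet> g x))" .
    moreover have "(\<Sum>i\<in>UNIV. F' x * (v x $ i)\<^sup>2 * \<eta> x) = \<eta> x * (F' x * (v x \<bullet> v x))"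
      by (simp add: inner_vec_def power2_eq_square sum_distrib_left mult_ac)
    moreover have "(\<Sum>i\<in>UNIV. (A_matrix a (v x) *v w i x) \<bullet> k i x)
        = \<eta> x * (\<Sum>i\<in>UNIV. (A_matrix a (v x) *v w i x) \<bullet> w i x)
          + (\<Sum>i\<in>UNIV. v x $ i * ((A_matrix a (v x) *v w i x) \<bullet> g x))"
      by (simp add: k_def inner_add_right sum.distrib sum_distrib_left)
    ultimately show ?thesis by (simp add: bulk_def right_diff_distrib)
  qed
  have "(LINT x:\<Omega>|lebesgue. \<eta> x * bulk x + boundary_field x \<bullet> g x) = 0"
    unfolding eq2[symmetric] using pt op by (intro set_lebesgue_integral_cong) auto
  then show ?thesis
    by (subst (asm) set_integral_add(2))
       (auto intro!: set_integrable_continuous_closure[OF op bdd] continuous_intros \<eta>c gc bulk_continuous boundary_field_continuous)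
qed

lemma bulk_integral_nonpos: "(LINT x:\<Omega>|lebesgue. bulk x) \<le> 0"
  by (rule boundary_layer_limit[OF bulk_continuous boundary_field_continuous boundary_field_sign localized_identity])

text \<open>The gap in the Cauchy-Schwarz inequality, in the form A, for \<Sum> v_i w_i, which is
  half the gradient of |v|^2. It carries the factor |v|^2 instead of a quotient, so it is continuous
  also where \<open>v\<close> vanishes.\<close>

definition defect :: "real^'n \<Rightarrow> real" where
  "defect x = (v x \<bullet> v x) * (\<Sum>i\<in>UNIV. (A_matrix a (v x) *v w i x) \<bullet> w i x)
     - (A_matrix a (v x) *v (\<Sum>i\<in>UNIV. v x $ i *\<^sub>R w i x)) \<bullet> (\<Sum>i\<in>UNIV. v x $ i *\<^sub>R w i x)"

lemma defect_continuous: "continuous_on (closure \<Omega>) defect"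
  unfolding defect_def[abs_def] by (intro continuous_intros A_mult_continuous wc vc)

text \<open>Lagrange's identity for A: because z is the sum of the v_i w_i, the cross terms collapse
  to the form at z. Besides nonnegativity, it makes the equality case explicit.\<close>

lemma defect_square_expansion:
  fixes x
  defines "z \<equiv> \<Sum>i\<in>UNIV. v x $ i *\<^sub>R w i x"
  shows "(\<Sum>i\<in>UNIV. (A_matrix a (v x) *v ((v x \<bullet> v x) *\<^sub>R w i x - v x $ i *\<^sub>R z)) \<bullet> ((v x \<bullet> v x) *\<^sub>R w i x - v x $ i *\<^sub>R z))
       = (v x \<bullet> v x) * defect x"
proof -
  define s where "s = v x \<bullet> v x"
  define B where "B h k = (A_matrix a (v x) *v h) \<bullet> k" for h k
  have s: "(\<Sum>i\<in>UNIV. v x $ i * v x $ i) = s" by (simp add: s_def inner_vec_def)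
  have Bz: "(\<Sum>i\<in>UNIV. v x $ i * B (w i x) z) = B z z"
  proof -
    have "B z z = B z (\<Sum>i\<in>UNIV. v x $ i *\<^sub>R w i x)" by (simp add: z_def)
    also have "\<dots> = (\<Sum>i\<in>UNIV. v x $ i * B z (w i x))" by (simp add: B_def inner_sum_right)
    also have "\<dots> = (\<Sum>i\<in>UNIV. v x $ i * B (w i x) z)"
      by (simp add: B_def A_matrix_inner_commute[of a "v x" z])
    finally show ?thesis by simp
  qed
  have "B (s *\<^sub>R w i x - v x $ i *\<^sub>R z) (s *\<^sub>R w i x - v x $ i *\<^sub>R z)
      = s * (s * B (w i x) (w i x)) - 2 * s * (v x $ i * B (w i x) z) + (v x $ i * v x $ i) * B z z" for i
  proof -
    have "B z (w i x) = B (w i x) z" unfolding B_def by (rule A_matrix_inner_commute)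
    then show ?thesis
      unfolding B_def
      by (simp add: matrix_vector_mult_diff_distrib matrix_vector_mult_scaleR inner_diff_left inner_diff_right algebra_simps)
  qed
  then have "(\<Sum>i\<in>UNIV. B (s *\<^sub>R w i x - v x $ i *\<^sub>R z) (s *\<^sub>R w i x - v x $ i *\<^sub>R z))
      = s * (s * (\<Sum>i\<in>UNIV. B (w i x) (w i x))) - 2 * s * B z z + s * B z z"
    by (simp add: sum.distrib sum_subtractf sum_distrib_left[symmetric] sum_distrib_right[symmetric] s Bz)
  also have "\<dots> = s * (s * (\<Sum>i\<in>UNIV. B (w i x) (w i x)) - B z z)" by (simp add: algebra_simps)
  finally show ?thesis by (simp add: B_def s_def defect_def z_def)
qed

lemma defect_nonneg:
  assumes "x \<in> closure \<Omega>"
  shows "0 \<le> defect x"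
proof (cases "v x = 0")
  case True then show ?thesis by (simp add: defect_def)
next
  case False
  have "0 \<le> (v x \<bullet> v x) * defect x"
    unfolding defect_square_expansion[symmetric] by (intro sum_nonneg A_form_nonneg assms)
  moreover have "0 < v x \<bullet> v x" using False by simp
  ultimately show ?thesis by (meson mult_pos_neg not_le)
qed

text \<open>Stability tested with the regularized length of \<open>v\<close> bounds from below
  nearly the same quantity that \<open>bulk_integral_nonpos\<close> bounds from above; the
  difference controls the integral of \<open>defect\<close>, up to O(\<epsilon>^2).\<close>

lemma defect_zero:
  assumes x: "x \<in> \<Omega>"
  shows "defect x = 0"
proof -
  let ?b = "\<lambda>x. \<Sum>i\<in>UNIV. (A_matrix a (v x) *v w i x) \<bullet> w i x"
  let ?z = "\<lambda>x. \<Sum>i\<in>UNIV. v x $ i *\<^sub>R w i x"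
  let ?s = "\<lambda>x. v x \<bullet> v x"
  let ?q = "\<lambda>x. (A_matrix a (v x) *v ?z x) \<bullet> ?z x"
  have zc: "continuous_on (closure \<Omega>) ?z" by (intro continuous_intros wc vc)
  have "bounded (v ` closure \<Omega>)"
    using compact_imp_bounded[OF compact_continuous_image[OF vc compact_closure_dom]] .
  then obtain M where M: "\<And>x. x \<in> closure \<Omega> \<Longrightarrow> norm (v x) \<le> M" unfolding bounded_iff by blast
  \<comment> \<open>The square of the test function exceeds |v|^2 by \<epsilon>^2, which leaves
    \<epsilon>^2 times the integral of F' as error.\<close>
  define C where "C = - (LINT x:\<Omega>|lebesgue. F' x)"
  have key: "(LINT x:\<Omega>|lebesgue. defect x) \<le> (1 + M\<^sup>2) * (\<epsilon>\<^sup>2 * C)" if \<epsilon>: "0 < \<epsilon>" "\<epsilon> \<le> 1" for \<epsilon>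
  proof -
    define r where "r x = \<epsilon>\<^sup>2 + ?s x" for x
    have rpos: "0 < r x" for x using \<epsilon> by (simp add: r_def add_pos_nonneg)
    have rc: "continuous_on (closure \<Omega>) r" unfolding r_def by (intro continuous_intros vc)
    have pair: "C1_pair \<Omega> (\<lambda>x. sqrt (r x)) (\<lambda>x. ?z x /\<^sub>R sqrt (r x))"
      unfolding C1_pair_def
    proof (intro conjI ballI)
      show "continuous_on (closure \<Omega>) (\<lambda>x. sqrt (r x))" by (intro continuous_intros rc)
      show "continuous_on (closure \<Omega>) (\<lambda>x. ?z x /\<^sub>R sqrt (r x))"
        using rpos by (intro continuous_intros zc rc) (auto simp: less_le)
      fix x assume x: "x \<in> \<Omega>"
      have "(r has_derivative (\<lambda>h. v x \<bullet> (\<chi> i. w i x \<bullet> h) + (\<chi> i. w i x \<bullet> h) \<bullet> v x)) (at x)"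
        unfolding r_def
        using has_derivative_add[OF has_derivative_const has_derivative_inner[OF gradient_field_has_derivative[OF w x] gradient_field_has_derivative[OF w x]]]
        by simp
      moreover have "(\<chi> i. w i x \<bullet> h) \<bullet> v x = ?z x \<bullet> h" for h
        by (simp add: inner_vec_def[of "\<chi> i. w i x \<bullet> h"] inner_sum_left mult.commute)
      ultimately have "(r has_derivative (\<lambda>h. 2 * (?z x \<bullet> h))) (at x)"
        by (simp add: inner_commute[of "v x"])
      from has_derivative_compose[OF this DERIV_real_sqrt[OF rpos, unfolded has_field_derivative_def]]
      show "((\<lambda>x. sqrt (r x)) has_derivative (\<lambda>h. (?z x /\<^sub>R sqrt (r x)) \<bullet> h)) (at x)"
        by (simp add: field_simps)
    qed
    have A: "(A_matrix a (v x) *v (?z x /\<^sub>R sqrt (r x))) \<bullet> (?z x /\<^sub>R sqrt (r x)) = ?q x / r x" for x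
    proof -
      have "(A_matrix a (v x) *v (?z x /\<^sub>R sqrt (r x))) \<bullet> (?z x /\<^sub>R sqrt (r x))
          = ?q x * (inverse (sqrt (r x)) * inverse (sqrt (r x)))"
        unfolding matrix_vector_mult_scaleR by simp
      also have "inverse (sqrt (r x)) * inverse (sqrt (r x)) = inverse (r x)"
        using rpos[of x] by (simp add: inverse_mult_distrib[symmetric])
      finally show ?thesis by (simp add: divide_inverse)
    qed
    note cont = continuous_intros wc vc zc rc F'c A_mult_continuous
    have i1: "set_integrable lebesgue \<Omega> (\<lambda>x. ?q x / r x)"
      using rpos by (intro set_integrable_continuous_closure[OF op bdd] cont) (auto simp: less_le)
    have i2: "set_integrable lebesgue \<Omega> (\<lambda>x. F' x * r x)"
      by (intro set_integrable_continuous_closure[OF op bdd] cont)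
    have i3: "set_integrable lebesgue \<Omega> (\<lambda>x. \<epsilon>\<^sup>2 * F' x)"
      by (intro set_integrable_continuous_closure[OF op bdd] cont)
    have i4: "set_integrable lebesgue \<Omega> bulk"
      by (intro set_integrable_continuous_closure[OF op bdd] bulk_continuous)
    have i5: "set_integrable lebesgue \<Omega> (\<lambda>x. defect x / (1 + M\<^sup>2))"
      by (intro set_integrable_continuous_closure[OF op bdd] cont defect_continuous) (auto simp: add_nonneg_eq_0_iff)
    have "0 \<le> (LINT x:\<Omega>|lebesgue. ?q x / r x) - (LINT x:\<Omega>|lebesgue. F' x * r x)"
      using stable[OF pair] rpos by (simp only: A) (simp add: less_imp_le)
    then have st: "0 \<le> (LINT x:\<Omega>|lebesgue. ?q x / r x - F' x * r x)"
      using i1 i2 by simp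
    \<comment> \<open>The F' terms cancel exactly, leaving
      \<open>(\<epsilon>\<^sup>2 * ?b x + defect x) / r x\<close>. The restriction to \<epsilon>
      \<le> 1 bounds \<open>r\<close> by \<open>1 + M\<^sup>2\<close>, uniformly in
      \<epsilon>.\<close>
    have low: "defect x / (1 + M\<^sup>2) \<le> bulk x - (?q x / r x - F' x * r x) - \<epsilon>\<^sup>2 * F' x" if x: "x \<in> \<Omega>" for x
    proof -
      have xc: "x \<in> closure \<Omega>" using x closure_subset by blast
      have b0: "0 \<le> ?b x" by (intro sum_nonneg A_form_nonneg xc)
      have "?s x \<le> M\<^sup>2"
        using power_mono[OF M[OF xc] norm_ge_zero, of 2] by (simp add: power2_norm_eq_inner)
      moreover have "\<epsilon>\<^sup>2 \<le> 1" using \<epsilon> by (simp add: power_le_one)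
      ultimately have r1: "r x \<le> 1 + M\<^sup>2" by (simp add: r_def)
      have "bulk x - (?q x / r x - F' x * r x) - \<epsilon>\<^sup>2 * F' x = ?b x - ?q x / r x"
        by (simp add: bulk_def r_def algebra_simps)
      also have "\<dots> = (\<epsilon>\<^sup>2 * ?b x + defect x) / r x"
        using rpos[of x] by (simp add: defect_def r_def field_simps)
      finally have e: "bulk x - (?q x / r x - F' x * r x) - \<epsilon>\<^sup>2 * F' x = (\<epsilon>\<^sup>2 * ?b x + defect x) / r x" .
      have "defect x / (1 + M\<^sup>2) \<le> defect x / r x"
        using defect_nonneg[OF xc] r1 rpos[of x] by (intro divide_left_mono) (auto intro!: mult_pos_pos add_pos_nonneg)
      also have "\<dots> \<le> (\<epsilon>\<^sup>2 * ?b x + defect x) / r x"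
        using rpos[of x] b0 by (intro divide_right_mono) auto
      finally show ?thesis using e by simp
    qed
    have "(LINT x:\<Omega>|lebesgue. defect x) / (1 + M\<^sup>2) = (LINT x:\<Omega>|lebesgue. defect x / (1 + M\<^sup>2))" by simp
    also have "\<dots> \<le> (LINT x:\<Omega>|lebesgue. bulk x - (?q x / r x - F' x * r x) - \<epsilon>\<^sup>2 * F' x)"
      by (intro set_integral_mono i5 low set_integral_diff(1) i1 i2 i3 i4)
    also have "\<dots> = (LINT x:\<Omega>|lebesgue. bulk x) - (LINT x:\<Omega>|lebesgue. ?q x / r x - F' x * r x) - (LINT x:\<Omega>|lebesgue. \<epsilon>\<^sup>2 * F' x)"
      by (subst set_integral_diff(2), intro set_integral_diff(1) i1 i2 i4, rule i3)
         (subst set_integral_diff(2)[OF i4 set_integral_diff(1)[OF i1 i2]], rule refl)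
    also have "\<dots> \<le> \<epsilon>\<^sup>2 * C"
      using st bulk_integral_nonpos by (simp add: C_def)
    finally show ?thesis
      by (simp add: pos_divide_le_eq add_pos_nonneg mult.commute)
  qed
  have lim: "((\<lambda>\<epsilon>. (1 + M\<^sup>2) * (\<epsilon>\<^sup>2 * C)) \<longlongrightarrow> (1 + M\<^sup>2) * (0\<^sup>2 * C)) (at_right 0)"
    by (intro tendsto_intros)
  have "(LINT x:\<Omega>|lebesgue. defect x) \<le> (1 + M\<^sup>2) * (0\<^sup>2 * C)"
  proof (rule tendsto_lowerbound[OF lim])
    show "\<forall>\<^sub>F \<epsilon> in at_right 0. (LINT x:\<Omega>|lebesgue. defect x) \<le> (1 + M\<^sup>2) * (\<epsilon>\<^sup>2 * C)"
      unfolding eventually_at_right_field using key by (intro exI[of _ 1]) auto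
  qed simp
  then have le: "(LINT x:\<Omega>|lebesgue. defect x) \<le> 0" by simp
  show ?thesis
    by (rule set_integral_nonpos_imp_zero[OF op bdd defect_continuous defect_nonneg le x])
       (use closure_subset in blast)
qed

text \<open>Definiteness of A at \<open>v x\<close> annihilates every summand of the square
  expansion, so all rows \<open>w i x\<close> are multiples of one vector \<open>z\<close>; symmetry
  of the Hessian then makes \<open>z\<close> parallel to \<open>v x\<close>.\<close>

lemma hessian_one_dimensional:
  assumes x: "x \<in> \<Omega>" and vx: "v x \<noteq> 0"
  shows "\<exists>l. \<forall>i. w i x = (l * v x $ i) *\<^sub>R v x"
proof -
  define s where "s = v x \<bullet> v x"
  define z where "z = (\<Sum>i\<in>UNIV. v x $ i *\<^sub>R w i x)"
  have s: "s > 0" using vx by (simp add: s_def)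
  have xc: "x \<in> closure \<Omega>" using x closure_subset by blast
  have "(\<Sum>i\<in>UNIV. (A_matrix a (v x) *v (s *\<^sub>R w i x - v x $ i *\<^sub>R z)) \<bullet> (s *\<^sub>R w i x - v x $ i *\<^sub>R z)) = 0"
    unfolding s_def z_def defect_square_expansion by (simp add: defect_zero[OF x])
  then have "(A_matrix a (v x) *v (s *\<^sub>R w i x - v x $ i *\<^sub>R z)) \<bullet> (s *\<^sub>R w i x - v x $ i *\<^sub>R z) = 0" for i
    by (subst (asm) sum_nonneg_eq_0_iff) (auto intro!: A_form_nonneg xc)
  then have "s *\<^sub>R w i x - v x $ i *\<^sub>R z = 0" for i
    using vx by (intro A_matrix_definite[of "v x" a] a_pos a_ell) auto
  then have W: "s *\<^sub>R w i x = v x $ i *\<^sub>R z" for i by simp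
  then have Wc: "s * w i x $ j = v x $ i * z $ j" for i j by (metis vector_scaleR_component real_scaleR_def)
  \<comment> \<open>Symmetry of the rank-one matrix with entries v_i z_j; contracting it with
    \<open>v x\<close> expresses \<open>z\<close> through \<open>v x\<close>.\<close>
  have sw: "v x $ i * z $ j = v x $ j * z $ i" for i j
    using Wc[of i j] Wc[of j i] hessian_symmetric[OF x, of i j] by simp
  define m where "m = (v x \<bullet> z) / s"
  have "s * z $ j = (v x \<bullet> z) * v x $ j" for j
  proof -
    have "s * z $ j = (\<Sum>i\<in>UNIV. v x $ i * (v x $ i * z $ j))"
      by (simp add: s_def inner_vec_def sum_distrib_right mult.assoc)
    also have "\<dots> = (\<Sum>i\<in>UNIV. v x $ i * (v x $ j * z $ i))" by (simp only: sw)
    also have "\<dots> = (v x \<bullet> z) * v x $ j" by (simp add: inner_vec_def sum_distrib_left sum_distrib_right mult_ac)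
    finally show ?thesis .
  qed
  then have z: "z $ j = m * v x $ j" for j using s by (simp add: m_def field_simps)
  have "w i x = (m / s * v x $ i) *\<^sub>R v x" for i
    unfolding vec_eq_iff using Wc[of i] s by (simp add: z field_simps)
  then show ?thesis by blast
qed

lemma stable_gradient_zero:
  assumes "CARD('n) \<ge> 2" "x \<in> \<Omega>"
  shows "v x = 0"
proof -
  have "\<forall>x. \<exists>l. x \<in> \<Omega> \<longrightarrow> v x \<noteq> 0 \<longrightarrow> (\<forall>i. w i x = (l * v x $ i) *\<^sub>R v x)"
    using hessian_one_dimensional by blast
  then obtain l where l: "\<And>x i. x \<in> \<Omega> \<Longrightarrow> v x \<noteq> 0 \<Longrightarrow> w i x = (l x * v x $ i) *\<^sub>R v x" by metis
  show ?thesis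
  proof (rule one_dimensional_field_zero[OF assms(1) _ vc neumann_condition assms(2)])
    fix x assume x: "x \<in> \<Omega>" "v x \<noteq> 0"
    show "(v has_derivative (\<lambda>h. (l x * (v x \<bullet> h)) *\<^sub>R v x)) (at x)"
      by (rule has_derivative_eq_rhs[OF gradient_field_has_derivative[OF w x(1)]])
         (simp add: fun_eq_iff vec_eq_iff l[OF x] mult_ac)
  qed
qed

end

end

section \<open>From the solution to its extensions, and conclusion\<close>

theorem theorem1p5:
  fixes \<Omega> :: "(real^'n::finite) set"
    and a f :: "real \<Rightarrow> real"
    and u :: "real^'n \<Rightarrow> real"
  assumes dim: "CARD('n) \<ge> 2"
    and domain: "open \<Omega>" "connected \<Omega>" "\<Omega> \<noteq> {}"
    and bounded: "bounded \<Omega>"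
    and boundary: "smooth_boundary \<Omega>"
    and convex: "convex \<Omega>"
    and curvatures: "\<And>p \<kappa>. p \<in> frontier \<Omega> \<Longrightarrow> principal_curvature \<Omega> p \<kappa> \<Longrightarrow> \<kappa> > 0"
    and f: "f C1_differentiable_on UNIV"
    and a_reg: "C11_loc_pos a"
    and a_pos: "\<And>t. t > 0 \<Longrightarrow> a t > 0"
    and a_ell: "\<And>t. t > 0 \<Longrightarrow> a t + deriv a t * t > 0"
    and u_reg: "Ck_closure 2 \<Omega> u"
    and u_stable: "stable_weak_solution \<Omega> a f u"
  shows "u constant_on \<Omega>"
proof -
  obtain \<nu> where "strictly_convex_domain \<Omega> \<nu>"
    using strictly_convex_domain_exists[OF domain(1) bounded convex domain(3) boundary] curvatures by blast
  then interpret strictly_convex_domain \<Omega> \<nu> .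
  have "Ck_closure (Suc 1) \<Omega> u" using u_reg by (simp add: numeral_2_eq_2)
  then have C2: "extends_to_closure \<Omega> u" "\<And>x. x \<in> \<Omega> \<Longrightarrow> u differentiable (at x)" "\<And>i. Ck_closure 1 \<Omega> (partial i u)"
    by (auto simp only: Ck_closure.simps(2))
  \<comment> \<open>The values of \<open>u\<close> on the frontier carry no information, so
    everything below is phrased with the continuous extension \<open>U\<close>.\<close>
  obtain U where U: "continuous_on (closure \<Omega>) U" "\<And>x. x \<in> \<Omega> \<Longrightarrow> U x = u x"
    using C2(1) unfolding extends_to_closure_def by blast
  have "\<forall>i. \<exists>\<psi> g. C1_pair \<Omega> \<psi> g \<and> (\<forall>x\<in>\<Omega>. \<psi> x = partial i u x)"
    using C1_pair_extension[OF op C2(3)] by blast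
  then obtain \<psi> w where w0: "\<And>i. C1_pair \<Omega> (\<psi> i) (w i)" "\<And>i x. x \<in> \<Omega> \<Longrightarrow> \<psi> i x = partial i u x"
    by metis
  define v where "v x = (\<chi> i. \<psi> i x)" for x
  have w: "C1_pair \<Omega> (\<lambda>x. v x $ i) (w i)" for i using w0(1) by (simp add: v_def)
  have v: "v x = gradient u x" if "x \<in> \<Omega>" for x using w0(2)[OF that] by (simp add: v_def gradient_def)
  note vc = gradient_field_continuous[OF w]
  have Uv: "C1_pair \<Omega> U v"
    unfolding C1_pair_def
  proof (intro conjI ballI U(1) vc)
    fix x assume x: "x \<in> \<Omega>"
    show "(U has_derivative (\<lambda>h. v x \<bullet> h)) (at x)"
      by (rule has_derivative_transform_within_open[OF gradient_has_derivative[OF C2(2)[OF x], folded v[OF x]] op x])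
         (use U(2) in auto)
  qed
  have fd: "\<And>t. (f has_real_derivative deriv f t) (at t)" and f'c: "continuous_on UNIV (deriv f)"
  proof -
    obtain f' where f': "\<And>t. (f has_real_derivative f' t) (at t)" "continuous_on UNIV f'"
      using f unfolding C1_differentiable_on_def by (auto simp: has_real_derivative_iff_has_vector_derivative)
    then have "f' = deriv f" by (metis DERIV_imp_deriv ext)
    with f' show "\<And>t. (f has_real_derivative deriv f t) (at t)" "continuous_on UNIV (deriv f)" by auto
  qed
  have fc: "continuous_on UNIV f" using fd DERIV_isCont continuous_at_imp_continuous_on by blast
  have F'c: "continuous_on (closure \<Omega>) (\<lambda>x. deriv f (U x))"
    by (rule continuous_on_compose2[OF f'c U(1)]) simp
  have F: "C1_pair \<Omega> (\<lambda>x. f (U x)) (\<lambda>x. deriv f (U x) *\<^sub>R v x)"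
    unfolding C1_pair_def
  proof (intro conjI ballI)
    show "continuous_on (closure \<Omega>) (\<lambda>x. f (U x))" by (rule continuous_on_compose2[OF fc U(1)]) simp
    show "continuous_on (closure \<Omega>) (\<lambda>x. deriv f (U x) *\<^sub>R v x)" by (intro continuous_intros F'c vc)
    fix x assume "x \<in> \<Omega>"
    from has_derivative_compose[OF C1_pairD(3)[OF Uv this] fd[unfolded has_field_derivative_def]]
    show "((\<lambda>x. f (U x)) has_derivative (\<lambda>h. (deriv f (U x) *\<^sub>R v x) \<bullet> h)) (at x)" by simp
  qed
  have weak: "(LINT x:\<Omega>|lebesgue. (a (norm (v x)) *\<^sub>R v x) \<bullet> g x) = (LINT x:\<Omega>|lebesgue. f (U x) * \<phi> x)"
    if P: "C1_pair \<Omega> \<phi> g" for \<phi> g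
  proof -
    have "(LINT x:\<Omega>|lebesgue. a (norm (gradient u x)) * (gradient u x \<bullet> gradient \<phi> x))
        - (LINT x:\<Omega>|lebesgue. f (u x) * \<phi> x) = 0"
      using u_stable C1_pair_Ck_closure(1)[OF P] unfolding stable_weak_solution_def weak_solution_def by blast
    moreover have "(LINT x:\<Omega>|lebesgue. a (norm (gradient u x)) * (gradient u x \<bullet> gradient \<phi> x))
        = (LINT x:\<Omega>|lebesgue. (a (norm (v x)) *\<^sub>R v x) \<bullet> g x)"
      using op v C1_pair_Ck_closure(2)[OF P] by (intro set_lebesgue_integral_cong) auto
    moreover have "(LINT x:\<Omega>|lebesgue. f (u x) * \<phi> x) = (LINT x:\<Omega>|lebesgue. f (U x) * \<phi> x)"
      using op U(2) by (intro set_lebesgue_integral_cong) auto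
    ultimately show ?thesis by simp
  qed
  have stab: "0 \<le> (LINT x:\<Omega>|lebesgue. (A_matrix a (v x) *v g x) \<bullet> g x) - (LINT x:\<Omega>|lebesgue. deriv f (U x) * (\<phi> x)\<^sup>2)"
    if P: "C1_pair \<Omega> \<phi> g" for \<phi> g
  proof -
    have "(LINT x:\<Omega>|lebesgue. (A_matrix a (gradient u x) *v gradient \<phi> x) \<bullet> gradient \<phi> x)
        - (LINT x:\<Omega>|lebesgue. deriv f (u x) * (\<phi> x)\<^sup>2) \<ge> 0"
      using u_stable C1_pair_Ck_closure(1)[OF P] unfolding stable_weak_solution_def by blast
    moreover have "(LINT x:\<Omega>|lebesgue. (A_matrix a (gradient u x) *v gradient \<phi> x) \<bullet> gradient \<phi> x)
        = (LINT x:\<Omega>|lebesgue. (A_matrix a (v x) *v g x) \<bullet> g x)"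
      using op v C1_pair_Ck_closure(2)[OF P] by (intro set_lebesgue_integral_cong) auto
    moreover have "(LINT x:\<Omega>|lebesgue. deriv f (u x) * (\<phi> x)\<^sup>2) = (LINT x:\<Omega>|lebesgue. deriv f (U x) * (\<phi> x)\<^sup>2)"
      using op U(2) by (intro set_lebesgue_integral_cong) auto
    ultimately show ?thesis by simp
  qed
  \<comment> \<open>This translates (A1), which is stated through a limit, into nonvanishing of
    \<open>v\<close> on the closure. The limit determines the value because every point of the
    closure of an open set is a limit point of the set.\<close>
  have cg: "closure_gradient \<Omega> u x = v x" if x: "x \<in> closure \<Omega>" for x
  proof -
    have "x \<in> closure (\<Omega> - {x})"
    proof (cases "x \<in> \<Omega>")
      case True
      then show ?thesis using op by (simp add: islimpt_in_closure[symmetric] interior_limit_point interior_open)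
    next
      case False
      then show ?thesis using x by simp
    qed
    then have nb: "at x within \<Omega> \<noteq> bot" by (simp add: trivial_limit_within islimpt_in_closure)
    have "(v \<longlongrightarrow> v x) (at x within \<Omega>)"
      using vc x closure_subset by (auto simp: continuous_on_def intro: tendsto_within_subset)
    moreover have "\<forall>\<^sub>F y in at x within \<Omega>. v y = gradient u y"
      using v by (auto simp: eventually_at_filter)
    ultimately have "(gradient u \<longlongrightarrow> v x) (at x within \<Omega>)" by (rule Lim_transform_eventually)
    then show ?thesis unfolding closure_gradient_def by (rule tendsto_Lim[OF nb])
  qed
  define D where "D = (if condition_A2 a then UNIV else - {0 :: real^'n})"
  have D: "flux_domain a D" by (simp add: flux_domain_def D_def)
  have vD: "v ` closure \<Omega> \<subseteq> D"
  proof (cases "condition_A2 a")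
    case False
    then have "condition_A1 \<Omega> u" using u_stable unfolding stable_weak_solution_def weak_solution_def by blast
    then show ?thesis using cg False by (auto simp: condition_A1_def D_def)
  qed (simp add: D_def)
  have zero: "v x = 0" if "x \<in> \<Omega>" for x
    by (rule stable_gradient_zero[OF a_reg a_pos a_ell D vD Uv w F F'c weak stab dim that])
  have "(U has_derivative (\<lambda>h. 0)) (at x)" if "x \<in> \<Omega>" for x
    using C1_pairD(3)[OF Uv that] zero[OF that] by simp
  then have "U x = U y" if "x \<in> \<Omega>" "y \<in> \<Omega>" for x y
    using has_derivative_zero_unique_connected[OF domain(1,2) _ that] by blast
  then have "u x = u y" if "x \<in> \<Omega>" "y \<in> \<Omega>" for x y using that U(2) by metis
  then show ?thesis unfolding constant_on_def by metis
qed

end
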